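(* There exist positive constants $C$ and $c$ such that the following holds for all sufficiently large $n$. Let $1\le k<n/2$ be an integer, and let $\varepsilon\in\mathbb{R}$ and $\beta\ge 0$ be real numbers such that $\max\{|\varepsilon|,\beta\}\le ck$. If $\mathcal{F}\subseteq S_n$ is a family of size $s=(k+\varepsilon)(n-1)!$ and $$\mathrm{dp}(\mathcal{F})\le \mathrm{dp}(\mathcal{T}(n,s))+\beta(n-1)!\,D_{n-1},$$ then there is some union $\mathcal{G}$ of $k$ cosets with the property that $$|\mathcal{F}\,\triangle\,\mathcal{G}|\le Ck^2\left(\frac1n+\sqrt{\frac{6(|\varepsilon|+\beta)}{k}}\right)(n-1)!.$$
   Context: $S_n$ is the set of all permutations of $[n]=\{1,\dots,n\}$. Two permutations $\sigma,\pi\in S_n$ are disjoint if $\sigma(i)\ne\pi(i)$ for all $i\in[n]$. For $\mathcal{F}\subseteq S_n$, $\mathrm{dp}(\mathcal{F})$ is the number of (unordered) disjoint pairs of permutations in $\mathcal{F}$. For $i,j\in[n]$, the coset $\mathcal{T}_{(i,j)}$ is the set of all $\pi\in S_n$ with $\pi(i)=j$. Equip $S_n$ with the lexicographic ordering: $\pi<\sigma$ if there is some $m\in[n]$ such that $\pi(m)<\sigma(m)$ and $\pi(i)=\sigma(i)$ for all $i<m$; for $0\le s\le n!$, $\mathcal{T}(n,s)$ denotes the family of the first $s$ permutations in this ordering. $d_m$ is the number of derangements (fixed-point-free permutations) in $S_m$, and $D_m=d_m+d_{m-1}$. $\triangle$ denotes symmetric difference. *)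

theory Defs
  imports Complex_Main "HOL-Combinatorics.Permutations"
begin

definition Sym :: "nat \<Rightarrow> (nat \<Rightarrow> nat) set" where
  "Sym n = {\<pi>. \<pi> permutes {1..n}}"

definition disjoint_perms :: "nat \<Rightarrow> (nat \<Rightarrow> nat) \<Rightarrow> (nat \<Rightarrow> nat) \<Rightarrow> bool" where
  "disjoint_perms n \<sigma> \<pi> \<longleftrightarrow> (\<forall>i\<in>{1..n}. \<sigma> i \<noteq> \<pi> i)"

definition dp :: "nat \<Rightarrow> (nat \<Rightarrow> nat) set \<Rightarrow> nat" where
  "dp n F = card {{\<sigma>, \<pi>} |\<sigma> \<pi>. \<sigma> \<in> F \<and> \<pi> \<in> F \<and> disjoint_perms n \<sigma> \<pi>}"

definition perm_coset :: "nat \<Rightarrow> nat \<Rightarrow> nat \<Rightarrow> (nat \<Rightarrow> nat) set" where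
  "perm_coset n i j = {\<pi> \<in> Sym n. \<pi> i = j}"

definition perm_cosets :: "nat \<Rightarrow> (nat \<Rightarrow> nat) set set" where
  "perm_cosets n = {perm_coset n i j |i j. i \<in> {1..n} \<and> j \<in> {1..n}}"

definition lex_less :: "nat \<Rightarrow> (nat \<Rightarrow> nat) \<Rightarrow> (nat \<Rightarrow> nat) \<Rightarrow> bool" where
  "lex_less n \<pi> \<sigma> \<longleftrightarrow> (\<exists>m\<in>{1..n}. \<pi> m < \<sigma> m \<and> (\<forall>i\<in>{1..<m}. \<pi> i = \<sigma> i))"

text \<open>A permutation is among the first \<open>s\<close> iff it has fewer than \<open>s\<close> predecessors;
  see \<open>card_lex_initial\<close> and \<open>lex_initial_downward\<close> below.\<close>

definition lex_initial :: "nat \<Rightarrow> nat \<Rightarrow> (nat \<Rightarrow> nat) set" where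
  "lex_initial n s = {\<pi> \<in> Sym n. card {\<sigma> \<in> Sym n. lex_less n \<sigma> \<pi>} < s}"

definition derangements :: "nat \<Rightarrow> nat" where
  "derangements m = card {\<pi> \<in> Sym m. \<forall>i\<in>{1..m}. \<pi> i \<noteq> i}"

text \<open>Meaningful for \<open>m \<ge> 1\<close> only, because of truncated subtraction.\<close>

definition derangement_sum :: "nat \<Rightarrow> nat" where
  "derangement_sum m = derangements m + derangements (m - 1)"

lemma finite_Sym: "finite (Sym n)"
  by (simp add: Sym_def finite_permutations)

lemma card_Sym: "card (Sym n) = fact n"
  by (simp add: Sym_def card_permutations)

lemma lex_less_irrefl: "\<not> lex_less n \<pi> \<pi>"
  by (auto simp: lex_less_def)

lemma lex_less_trans:
  assumes "lex_less n \<pi> \<sigma>" "lex_less n \<sigma> \<tau>"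
  shows "lex_less n \<pi> \<tau>"
proof -
  obtain a where a: "a \<in> {1..n}" "\<pi> a < \<sigma> a" "\<forall>i\<in>{1..<a}. \<pi> i = \<sigma> i"
    using assms(1) by (auto simp: lex_less_def)
  obtain b where b: "b \<in> {1..n}" "\<sigma> b < \<tau> b" "\<forall>i\<in>{1..<b}. \<sigma> i = \<tau> i"
    using assms(2) by (auto simp: lex_less_def)
  have "min a b \<in> {1..n}" "\<forall>i\<in>{1..<min a b}. \<pi> i = \<tau> i"
    using a b by auto
  moreover have "\<pi> (min a b) < \<tau> (min a b)"
    using a b by (cases a b rule: linorder_cases) (auto simp: min_def)
  ultimately show ?thesis
    unfolding lex_less_def by blast
qed

lemma lex_less_total:
  assumes "\<pi> \<in> Sym n" "\<sigma> \<in> Sym n" "\<pi> \<noteq> \<sigma>"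
  shows "lex_less n \<pi> \<sigma> \<or> lex_less n \<sigma> \<pi>"
proof -
  define m where "m = (LEAST i. \<pi> i \<noteq> \<sigma> i)"
  have "\<exists>i. \<pi> i \<noteq> \<sigma> i"
    using assms(3) by blast
  then have m: "\<pi> m \<noteq> \<sigma> m"
    unfolding m_def by (rule LeastI_ex)
  have eq: "\<pi> i = \<sigma> i" if "i < m" for i
    using not_less_Least[OF that[unfolded m_def]] by simp
  have "m \<in> {1..n}"
    using m assms(1,2) by (metis Sym_def mem_Collect_eq permutes_not_in)
  then show ?thesis
    using m eq unfolding lex_less_def
    by (metis atLeastLessThan_iff linorder_neqE_nat)
qed

lemma lex_initial_downward:
  assumes "\<pi> \<in> lex_initial n s" "\<sigma> \<in> Sym n" "lex_less n \<sigma> \<pi>"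
  shows "\<sigma> \<in> lex_initial n s"
proof -
  have "card {\<tau> \<in> Sym n. lex_less n \<tau> \<sigma>} \<le> card {\<tau> \<in> Sym n. lex_less n \<tau> \<pi>}"
    using assms(3) lex_less_trans by (intro card_mono) (auto simp: finite_Sym)
  then show ?thesis
    using assms by (auto simp: lex_initial_def)
qed

lemma card_lex_initial:
  assumes "s \<le> fact n"
  shows "card (lex_initial n s) = s"
proof -
  define r where "r \<pi> = card {\<sigma> \<in> Sym n. lex_less n \<sigma> \<pi>}" for \<pi>
  have less: "r \<pi> < r \<sigma>" if "\<pi> \<in> Sym n" "lex_less n \<pi> \<sigma>" for \<pi> \<sigma>
    unfolding r_def
  proof (rule psubset_card_mono)
    show "finite {\<tau> \<in> Sym n. lex_less n \<tau> \<sigma>}"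
      by (simp add: finite_Sym)
    show "{\<tau> \<in> Sym n. lex_less n \<tau> \<pi>} \<subset> {\<tau> \<in> Sym n. lex_less n \<tau> \<sigma>}"
      using that lex_less_irrefl lex_less_trans by blast
  qed
  have inj: "inj_on r (Sym n)"
    by (rule inj_onI) (metis less lex_less_total less_irrefl)
  have "r \<pi> < fact n" if "\<pi> \<in> Sym n" for \<pi>
    unfolding r_def card_Sym[symmetric]
    by (rule psubset_card_mono[OF finite_Sym]) (use that lex_less_irrefl in blast)
  then have "r ` Sym n \<subseteq> {..<fact n}"
    by auto
  then have "r ` Sym n = {..<fact n}"
    by (intro card_subset_eq) (auto simp: card_image[OF inj] card_Sym)
  moreover have "r ` lex_initial n s = r ` Sym n \<inter> {..<s}"
    by (auto simp: lex_initial_def r_def)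
  ultimately have "r ` lex_initial n s = {..<s}"
    using assms by auto
  moreover have "inj_on r (lex_initial n s)"
    by (rule inj_on_subset[OF inj]) (auto simp: lex_initial_def)
  ultimately show ?thesis
    by (metis card_image card_lessThan)
qed

end

theory Submission
  imports Defs
begin

text \<open>Identify a family with its indicator and project it to the span of the coset indicators; let
  \<open>h\<close> be the remainder. The disjointness matrix maps the indicator of a coset to \<open>D\<^bsub>n-1\<^esub>\<close> times the
  indicator of the complement, so \<open>2 dp\<close> is an explicit function of the size of the family and of the
  squared norm of \<open>h\<close>, plus the disjointness form of \<open>h\<close>. By inclusion-exclusion that form is the
  alternating sum of \<open>x k / k!\<close>, where \<open>x k\<close> is the \<open>k\<close>-th factorial moment of the number of
  agreements of two permutations, weighted by \<open>h\<close>. Positivity of the kernel \<open>N\<^sup>2 - 3 N + 1\<close> makes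
  \<open>x\<close> convex, and orthogonality of \<open>h\<close> to the cosets gives \<open>x 0 = x 1 = 0\<close>; this bounds the form of
  \<open>h\<close> below by \<open>- 4 / 5 * D\<^bsub>n-1\<^esub>\<close> times the squared norm. Hence few disjoint pairs force \<open>h\<close> to be
  small in norm.

  For the structure of the family, split the rows into pairs and swap the values within each pair
  independently. On the resulting cubes the projection is affine and close to Boolean in mean square,
  so its coefficients, the switch differences of the matrix of coset densities, are nearly integral.
  As the row and column sums are small compared to \<open>n\<close>, this makes the densities themselves close to 0
  or 1, and the cosets of density close to 1 are the ones sought.\<close>

section \<open>Positivity of the agreement kernel\<close>

text \<open>On combinations of coset indicators with total coefficient 0 the disjointness matrix is
  multiplication by \<open>- D\<close>, where D stands for \<open>derangement_sum (n - 1)\<close>.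
  What the argument needs is a gap: a bound \<open>- c * D\<close> with c < 1 for the form
  orthogonal to the cosets. The spectrum there never has to be computed: the sequence of moments
  starts with two zeros and ends with two equal values, and its chords give the constant 1/4. Set
  against the bound 1/3 for the density of derangements, this leaves 4/5 from \<open>n = 17\<close>
  on.

  For sizes close to \<open>k * fact (n - 1)\<close> an initial segment has, up to a term of order
  \<open>\<bar>\<epsilon>\<bar>\<close>, as many disjoint pairs as the lower bound allows a family
  without remainder. So any excess bounds the remainder.

  Rounding the densities works only if k / n and \<open>\<bar>\<epsilon>\<bar> + \<beta>\<close> are
  below absolute constants. Outside that range the asserted bound exceeds
  \<open>3 * k * fact (n - 1)\<close>, which every union of k cosets satisfies; so
  \<open>c = 1\<close> can be taken. Inside it only the part of the union missed by the family is
  estimated; cardinalities give the rest.\<close>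

lemma sum_offdiag_swap:
  fixes g :: "'a \<Rightarrow> 'a \<Rightarrow> real"
  assumes "finite A"
  shows "(\<Sum>i\<in>A. \<Sum>j\<in>A - {i}. g i j) = (\<Sum>i\<in>A. \<Sum>j\<in>A - {i}. g j i)"
proof -
  have "A - {i} = {j. j \<in> A \<and> i \<noteq> j}" "A - {i} = {j. j \<in> A \<and> j \<noteq> i}" for i
    by auto
  then show ?thesis
    using sum.swap_restrict[OF assms assms, of g "\<lambda>i j. i \<noteq> j"] by simp
qed

definition offdiag_sum ::
  "'a set \<Rightarrow> 'b set \<Rightarrow> ('a \<Rightarrow> 'a \<Rightarrow> 'b \<Rightarrow> 'b \<Rightarrow> real) \<Rightarrow> real" where
  "offdiag_sum A B g = (\<Sum>i\<in>A. \<Sum>j\<in>A - {i}. \<Sum>a\<in>B. \<Sum>b\<in>B - {a}. g i j a b)"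

lemma offdiag_sum_swap1:
  assumes "finite A"
  shows "offdiag_sum A B (\<lambda>i j. g j i) = offdiag_sum A B g"
  unfolding offdiag_sum_def by (rule sum_offdiag_swap[OF assms])

lemma offdiag_sum_swap2:
  assumes "finite B"
  shows "offdiag_sum A B (\<lambda>i j a b. g i j b a) = offdiag_sum A B g"
  unfolding offdiag_sum_def
  by (intro sum.cong refl sum_offdiag_swap[OF assms])

lemma offdiag_sum_add:
  "offdiag_sum A B (\<lambda>i j a b. g i j a b + g' i j a b) = offdiag_sum A B g + offdiag_sum A B g'"
  by (simp add: offdiag_sum_def sum.distrib)

lemma offdiag_sum_diff:
  "offdiag_sum A B (\<lambda>i j a b. g i j a b - g' i j a b) = offdiag_sum A B g - offdiag_sum A B g'"
  by (simp add: offdiag_sum_def sum_subtractf)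

lemma offdiag_sum_scale:
  "offdiag_sum A B (\<lambda>i j a b. c * g i j a b) = c * offdiag_sum A B g"
  by (simp add: offdiag_sum_def sum_distrib_left)

lemma offdiag_sum_nonneg:
  "(\<And>i j a b. g i j a b \<ge> 0) \<Longrightarrow> offdiag_sum A B g \<ge> 0"
  unfolding offdiag_sum_def by (intro sum_nonneg) auto

text \<open>With \<open>q = m - 1\<close> and \<open>u = 1 / (q\<^sup>2 - 1)\<close>, the function
  \<open>u * q * (e i a + e j b) + u * (e i b + e j a)\<close> has the same marginals as
  \<open>z\<close>. It is therefore the orthogonal projection of \<open>z\<close> to functions that
  are sums of functions of one row and one value, and its squared norm is twice that of
  \<open>e\<close>. The proof expands the square of the difference.\<close>

lemma offdiag_marginal_inequality:
  fixes e :: "'a \<Rightarrow> 'b \<Rightarrow> real" and z :: "'a \<Rightarrow> 'a \<Rightarrow> 'b \<Rightarrow> 'b \<Rightarrow> real"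
  assumes fin: "finite A" "finite B" and card: "card A = m" "card B = m" "m \<ge> 3"
    and row: "\<And>i. i \<in> A \<Longrightarrow> (\<Sum>a\<in>B. e i a) = 0"
    and col: "\<And>a. a \<in> B \<Longrightarrow> (\<Sum>i\<in>A. e i a) = 0"
    and sym: "\<And>i j a b. z i j a b = z j i b a"
    and z1: "\<And>i j a. \<lbrakk>i \<in> A; j \<in> A; i \<noteq> j; a \<in> B\<rbrakk> \<Longrightarrow> (\<Sum>b\<in>B - {a}. z i j a b) = e i a"
    and z2: "\<And>i a b. \<lbrakk>i \<in> A; a \<in> B; b \<in> B; a \<noteq> b\<rbrakk> \<Longrightarrow> (\<Sum>j\<in>A - {i}. z i j a b) = e i a"
  shows "2 * (\<Sum>i\<in>A. \<Sum>a\<in>B. (e i a)\<^sup>2) \<le> offdiag_sum A B (\<lambda>i j a b. (z i j a b)\<^sup>2)"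
proof -
  define S where "S = offdiag_sum A B"
  define E where "E = (\<Sum>i\<in>A. \<Sum>a\<in>B. (e i a)\<^sup>2)"
  define q :: real where "q = real m - 1"
  have q: "q \<ge> 2"
    using card(3) by (simp add: q_def)
  have cA: "real (card (A - {i})) = q" if "i \<in> A" for i
    using fin card that by (simp add: q_def of_nat_diff)
  have cB: "real (card (B - {a})) = q" if "a \<in> B" for a
    using fin card that by (simp add: q_def of_nat_diff)
  have rowd: "(\<Sum>b\<in>B - {a}. e i b) = - e i a" if "i \<in> A" "a \<in> B" for i a
    using sum.remove[OF fin(2) that(2), of "e i"] row[OF that(1)] by simp
  have cold: "(\<Sum>j\<in>A - {i}. e j a) = - e i a" if "i \<in> A" "a \<in> B" for i a
    using sum.remove[OF fin(1) that(1), of "\<lambda>j. e j a"] col[OF that(2)] by simp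
  note sw1 = offdiag_sum_swap1[OF fin(1), of B, folded S_def]
  note sw2 = offdiag_sum_swap2[OF fin(2), of A, folded S_def]
  \<comment> \<open>The names list the factors: a, b, c, d stand for \<open>e i a\<close>,
    \<open>e j b\<close>, \<open>e i b\<close>, \<open>e j a\<close>, and z for
    \<open>z i j a b\<close>.\<close>
  have aa: "S (\<lambda>i j a b. e i a * e i a) = q\<^sup>2 * E"
    unfolding S_def offdiag_sum_def E_def
    by (simp add: cA cB sum_distrib_left power2_eq_square mult_ac del: card_Diff_singleton card_Diff_insert)
  have bb: "S (\<lambda>i j a b. e j b * e j b) = q\<^sup>2 * E"
    using aa sw1[of "\<lambda>i j a b. e i b * e i b"] sw2[of "\<lambda>i j a b. e i a * e i a"] by simp
  have cc: "S (\<lambda>i j a b. e i b * e i b) = q\<^sup>2 * E"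
    using aa sw2[of "\<lambda>i j a b. e i a * e i a"] by simp
  have dd: "S (\<lambda>i j a b. e j a * e j a) = q\<^sup>2 * E"
    using aa sw1[of "\<lambda>i j a b. e i a * e i a"] by simp
  have ac: "S (\<lambda>i j a b. e i a * e i b) = - q * E"
    unfolding S_def offdiag_sum_def E_def
    by (simp add: rowd cA sum_distrib_left[symmetric] sum_negf power2_eq_square del: card_Diff_singleton card_Diff_insert)
  have bd: "S (\<lambda>i j a b. e j b * e j a) = - q * E"
    using ac sw1[of "\<lambda>i j a b. e i a * e i b"] by (simp add: mult.commute)
  have ad: "S (\<lambda>i j a b. e i a * e j a) = - q * E"
  proof -
    have "S (\<lambda>i j a b. e i a * e j a) = (\<Sum>i\<in>A. \<Sum>j\<in>A - {i}. \<Sum>a\<in>B. q * (e i a * e j a))"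
      unfolding S_def offdiag_sum_def by (simp add: cB del: card_Diff_singleton card_Diff_insert)
    also have "\<dots> = (\<Sum>i\<in>A. \<Sum>a\<in>B. \<Sum>j\<in>A - {i}. q * (e i a * e j a))"
      by (intro sum.cong refl sum.swap)
    also have "\<dots> = (\<Sum>i\<in>A. \<Sum>a\<in>B. - q * (e i a)\<^sup>2)"
      by (intro sum.cong refl)
        (simp add: sum_distrib_left[symmetric] cold power2_eq_square)
    finally show ?thesis
      by (simp add: E_def sum_distrib_left)
  qed
  have bc: "S (\<lambda>i j a b. e j b * e i b) = - q * E"
    using ad sw2[of "\<lambda>i j a b. e i a * e j a"] by (simp add: mult.commute)
  have ab: "S (\<lambda>i j a b. e i a * e j b) = E"
  proof -
    have "S (\<lambda>i j a b. e i a * e j b) = (\<Sum>i\<in>A. \<Sum>j\<in>A - {i}. \<Sum>a\<in>B. - (e i a * e j a))"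
      unfolding S_def offdiag_sum_def
      by (intro sum.cong refl) (simp add: sum_distrib_left[symmetric] rowd)
    also have "\<dots> = (\<Sum>i\<in>A. \<Sum>a\<in>B. \<Sum>j\<in>A - {i}. - (e i a * e j a))"
      by (intro sum.cong refl sum.swap)
    also have "\<dots> = (\<Sum>i\<in>A. \<Sum>a\<in>B. (e i a)\<^sup>2)"
      by (intro sum.cong refl)
        (simp add: sum_distrib_left[symmetric] sum_negf cold power2_eq_square)
    finally show ?thesis
      by (simp add: E_def)
  qed
  have cd: "S (\<lambda>i j a b. e i b * e j a) = E"
    using ab sw2[of "\<lambda>i j a b. e i a * e j b"] by simp
  have za: "S (\<lambda>i j a b. z i j a b * e i a) = q * E"
  proof -
    have "S (\<lambda>i j a b. z i j a b * e i a) = (\<Sum>i\<in>A. \<Sum>j\<in>A - {i}. \<Sum>a\<in>B. (e i a)\<^sup>2)"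
      unfolding S_def offdiag_sum_def
      by (intro sum.cong refl) (auto simp: sum_distrib_right[symmetric] z1 power2_eq_square)
    then show ?thesis
      by (simp add: E_def cA sum_distrib_left del: card_Diff_singleton card_Diff_insert)
  qed
  have zb: "S (\<lambda>i j a b. z i j a b * e j b) = q * E"
  proof -
    have "S (\<lambda>i j a b. z i j a b * e j b) = S (\<lambda>i j a b. z j i b a * e j b)"
      by (simp add: sym[symmetric])
    also have "\<dots> = S (\<lambda>i j a b. z i j b a * e i b)"
      using sw1[of "\<lambda>i j a b. z i j b a * e i b"] by simp
    also have "\<dots> = S (\<lambda>i j a b. z i j a b * e i a)"
      using sw2[of "\<lambda>i j a b. z i j a b * e i a"] by simp
    finally show ?thesis
      using za by simp
  qed
  have zc: "S (\<lambda>i j a b. z i j a b * e i b) = - E"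
  proof -
    have "S (\<lambda>i j a b. z i j a b * e i b) = (\<Sum>i\<in>A. \<Sum>a\<in>B. \<Sum>j\<in>A - {i}. \<Sum>b\<in>B - {a}. z i j a b * e i b)"
      unfolding S_def offdiag_sum_def by (intro sum.cong refl sum.swap)
    also have "\<dots> = (\<Sum>i\<in>A. \<Sum>a\<in>B. \<Sum>b\<in>B - {a}. \<Sum>j\<in>A - {i}. z i j a b * e i b)"
      by (intro sum.cong refl sum.swap)
    also have "\<dots> = (\<Sum>i\<in>A. \<Sum>a\<in>B. \<Sum>b\<in>B - {a}. e i a * e i b)"
      by (intro sum.cong refl) (auto simp: sum_distrib_right[symmetric] z2)
    also have "\<dots> = (\<Sum>i\<in>A. \<Sum>a\<in>B. - (e i a)\<^sup>2)"
      by (intro sum.cong refl) (simp add: sum_distrib_left[symmetric] rowd power2_eq_square)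
    finally show ?thesis
      by (simp add: E_def sum_negf)
  qed
  have zd: "S (\<lambda>i j a b. z i j a b * e j a) = - E"
  proof -
    have "S (\<lambda>i j a b. z i j a b * e j a) = S (\<lambda>i j a b. z j i b a * e j a)"
      by (simp add: sym[symmetric])
    also have "\<dots> = S (\<lambda>i j a b. z i j b a * e i a)"
      using sw1[of "\<lambda>i j a b. z i j b a * e i a"] by simp
    also have "\<dots> = S (\<lambda>i j a b. z i j a b * e i b)"
      using sw2[of "\<lambda>i j a b. z i j a b * e i b"] by simp
    finally show ?thesis
      using zc by simp
  qed
  define u where "u = 1 / (q\<^sup>2 - 1)"
  have "q\<^sup>2 \<ge> 2\<^sup>2"
    using q by (intro power_mono) auto
  then have u: "u * (q\<^sup>2 - 1) = 1"
    by (simp add: u_def)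
  have "0 \<le> S (\<lambda>i j a b. (z i j a b - (u * q) * (e i a + e j b) - u * (e i b + e j a))\<^sup>2)"
    unfolding S_def by (rule offdiag_sum_nonneg) simp
  also have "\<dots> = S (\<lambda>i j a b. (z i j a b)\<^sup>2
      - (2 * u * q) * (z i j a b * e i a) - (2 * u * q) * (z i j a b * e j b)
      - (2 * u) * (z i j a b * e i b) - (2 * u) * (z i j a b * e j a)
      + (u\<^sup>2 * q\<^sup>2) * (e i a * e i a) + (u\<^sup>2 * q\<^sup>2) * (e j b * e j b) + (2 * u\<^sup>2 * q\<^sup>2) * (e i a * e j b)
      + u\<^sup>2 * (e i b * e i b) + u\<^sup>2 * (e j a * e j a) + (2 * u\<^sup>2) * (e i b * e j a)
      + (2 * u\<^sup>2 * q) * (e i a * e i b) + (2 * u\<^sup>2 * q) * (e i a * e j a)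
      + (2 * u\<^sup>2 * q) * (e j b * e i b) + (2 * u\<^sup>2 * q) * (e j b * e j a))"
    by (rule arg_cong[of _ _ S], intro ext) algebra
  also have "\<dots> = S (\<lambda>i j a b. (z i j a b)\<^sup>2)
      - (2 * u * q) * (q * E) - (2 * u * q) * (q * E)
      - (2 * u) * (- E) - (2 * u) * (- E)
      + (u\<^sup>2 * q\<^sup>2) * (q\<^sup>2 * E) + (u\<^sup>2 * q\<^sup>2) * (q\<^sup>2 * E) + (2 * u\<^sup>2 * q\<^sup>2) * E
      + u\<^sup>2 * (q\<^sup>2 * E) + u\<^sup>2 * (q\<^sup>2 * E) + (2 * u\<^sup>2) * E
      + (2 * u\<^sup>2 * q) * (- q * E) + (2 * u\<^sup>2 * q) * (- q * E)
      + (2 * u\<^sup>2 * q) * (- q * E) + (2 * u\<^sup>2 * q) * (- q * E)"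
    using aa bb cc dd ab ac ad bc bd cd za zb zc zd unfolding S_def
    by (simp only: offdiag_sum_add offdiag_sum_diff offdiag_sum_scale)
  also have "\<dots> = S (\<lambda>i j a b. (z i j a b)\<^sup>2) - 2 * E"
    using u by algebra
  finally show ?thesis
    by (simp add: S_def E_def)
qed

declare sum_of_bool_eq [simp del] sum_mult_of_bool_eq [simp del] sum_of_bool_mult_eq [simp del]

section \<open>Quadratic forms with a kernel, and the agreement kernel\<close>

definition quad_form :: "'a set \<Rightarrow> ('a \<Rightarrow> real) \<Rightarrow> ('a \<Rightarrow> 'a \<Rightarrow> real) \<Rightarrow> real" where
  "quad_form \<Omega> h K = (\<Sum>\<sigma>\<in>\<Omega>. \<Sum>\<pi>\<in>\<Omega>. h \<sigma> * h \<pi> * K \<sigma> \<pi>)"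

lemma quad_form_cong:
  assumes "\<And>\<sigma> \<pi>. \<sigma> \<in> \<Omega> \<Longrightarrow> \<pi> \<in> \<Omega> \<Longrightarrow> K \<sigma> \<pi> = K' \<sigma> \<pi>"
  shows "quad_form \<Omega> h K = quad_form \<Omega> h K'"
  unfolding quad_form_def by (intro sum.cong refl) (simp add: assms)

lemma quad_form_sum:
  "quad_form \<Omega> h (\<lambda>\<sigma> \<pi>. \<Sum>x\<in>X. K x \<sigma> \<pi>) = (\<Sum>x\<in>X. quad_form \<Omega> h (K x))"
proof -
  have "quad_form \<Omega> h (\<lambda>\<sigma> \<pi>. \<Sum>x\<in>X. K x \<sigma> \<pi>)
      = (\<Sum>\<sigma>\<in>\<Omega>. \<Sum>x\<in>X. \<Sum>\<pi>\<in>\<Omega>. h \<sigma> * h \<pi> * K x \<sigma> \<pi>)"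
    unfolding quad_form_def sum_distrib_left by (intro sum.cong refl sum.swap)
  then show ?thesis
    unfolding quad_form_def by (simp add: sum.swap[of _ X])
qed

lemma quad_form_add:
  "quad_form \<Omega> h (\<lambda>\<sigma> \<pi>. K \<sigma> \<pi> + K' \<sigma> \<pi>) = quad_form \<Omega> h K + quad_form \<Omega> h K'"
  by (simp add: quad_form_def sum.distrib algebra_simps)

lemma quad_form_scale:
  "quad_form \<Omega> h (\<lambda>\<sigma> \<pi>. c * K \<sigma> \<pi>) = c * quad_form \<Omega> h K"
  by (simp add: quad_form_def sum_distrib_left mult_ac)

lemma quad_form_square:
  "(\<Sum>\<sigma>\<in>\<Omega>. h \<sigma> * \<phi> \<sigma>)\<^sup>2 = quad_form \<Omega> h (\<lambda>\<sigma> \<pi>. \<phi> \<sigma> * \<phi> \<pi>)"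
  by (simp add: quad_form_def power2_eq_square sum_product mult_ac)

text \<open>A kernel that vanishes unless both arguments have the same image under \<open>R\<close>
  is block diagonal. With \<open>R\<close> the restriction to a set of points, positivity can be
  checked block by block.\<close>

lemma quad_form_partition:
  assumes "finite \<Omega>"
  shows "quad_form \<Omega> h (\<lambda>\<sigma> \<pi>. of_bool (R \<sigma> = R \<pi>) * K \<sigma> \<pi>)
    = (\<Sum>\<alpha>\<in>R ` \<Omega>. quad_form {\<sigma> \<in> \<Omega>. R \<sigma> = \<alpha>} h K)"
proof -
  have "quad_form \<Omega> h (\<lambda>\<sigma> \<pi>. of_bool (R \<sigma> = R \<pi>) * K \<sigma> \<pi>)
      = (\<Sum>\<sigma>\<in>\<Omega>. \<Sum>\<pi>\<in>{\<pi> \<in> \<Omega>. R \<pi> = R \<sigma>}. h \<sigma> * h \<pi> * K \<sigma> \<pi>)"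
    unfolding quad_form_def using assms
    by (intro sum.cong[OF refl] sum.mono_neutral_cong_right) auto
  also have "\<dots> = (\<Sum>\<alpha>\<in>R ` \<Omega>. \<Sum>\<sigma>\<in>{\<sigma> \<in> \<Omega>. R \<sigma> = \<alpha>}. \<Sum>\<pi>\<in>{\<pi> \<in> \<Omega>. R \<pi> = R \<sigma>}. h \<sigma> * h \<pi> * K \<sigma> \<pi>)"
    by (rule sum.image_gen[OF assms])
  also have "\<dots> = (\<Sum>\<alpha>\<in>R ` \<Omega>. quad_form {\<sigma> \<in> \<Omega>. R \<sigma> = \<alpha>} h K)"
    unfolding quad_form_def by (intro sum.cong refl) auto
  finally show ?thesis .
qed

definition agreements :: "'a set \<Rightarrow> ('a \<Rightarrow> 'b) \<Rightarrow> ('a \<Rightarrow> 'b) \<Rightarrow> nat" where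
  "agreements A \<sigma> \<pi> = card {i \<in> A. \<sigma> i = \<pi> i}"

lemma sum_of_bool_agreements:
  "finite A \<Longrightarrow> (\<Sum>i\<in>A. of_bool (\<sigma> i = \<pi> i)) = real (agreements A \<sigma> \<pi>)"
  by (simp add: agreements_def of_bool_def sum.inter_filter[symmetric])

lemma sum_delta_of_bool:
  fixes g :: "'a \<Rightarrow> real"
  shows "finite B \<Longrightarrow> (\<Sum>b\<in>B. of_bool (p = b) * g b) = of_bool (p \<in> B) * g p"
  by (simp add: of_bool_def if_distrib[of "\<lambda>x. x * _"] cong: if_cong)

lemma sum_offdiag_of_bool_agreements:
  assumes "finite A"
  shows "(\<Sum>i\<in>A. \<Sum>j\<in>A - {i}. of_bool (\<sigma> i = \<pi> i) * of_bool (\<sigma> j = \<pi> j))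
    = (real (agreements A \<sigma> \<pi>))\<^sup>2 - real (agreements A \<sigma> \<pi>)"
proof -
  have "(\<Sum>i\<in>A. \<Sum>j\<in>A - {i}. of_bool (\<sigma> i = \<pi> i) * of_bool (\<sigma> j = \<pi> j))
      = (\<Sum>i\<in>A. of_bool (\<sigma> i = \<pi> i) * real (agreements A \<sigma> \<pi>) - of_bool (\<sigma> i = \<pi> i))"
  proof (intro sum.cong refl)
    fix i assume "i \<in> A"
    then have "(\<Sum>j\<in>A - {i}. of_bool (\<sigma> j = \<pi> j)) = real (agreements A \<sigma> \<pi>) - of_bool (\<sigma> i = \<pi> i)"
      using assms by (subst sum_diff1) (simp_all add: sum_of_bool_agreements)
    then show "(\<Sum>j\<in>A - {i}. of_bool (\<sigma> i = \<pi> i) * of_bool (\<sigma> j = \<pi> j))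
        = of_bool (\<sigma> i = \<pi> i) * real (agreements A \<sigma> \<pi>) - of_bool (\<sigma> i = \<pi> i)"
      by (simp only: sum_distrib_left[symmetric]) (simp add: algebra_simps)
  qed
  then show ?thesis
    using assms
    by (simp add: sum_subtractf sum_distrib_right[symmetric] sum_of_bool_agreements power2_eq_square)
qed

text \<open>The kernel is the sum of the characters of the irreducible representations of the symmetric
  group that belong to the partitions \<open>(m - 2, 2)\<close> and \<open>(m - 2, 1, 1)\<close>.\<close>

lemma agreement_kernel_psd:
  fixes h :: "('a \<Rightarrow> 'b) \<Rightarrow> real"
  assumes fin: "finite A" "finite B" and card: "card A = m" "card B = m" "m \<ge> 3"
    and bij: "\<And>\<sigma>. \<sigma> \<in> \<Omega> \<Longrightarrow> bij_betw \<sigma> A B"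
  shows "0 \<le> quad_form \<Omega> h
    (\<lambda>\<sigma> \<pi>. (real (agreements A \<sigma> \<pi>))\<^sup>2 - 3 * real (agreements A \<sigma> \<pi>) + 1)"
proof -
  \<comment> \<open>Total weight, and weights of the permutations with one or two prescribed values.
    The squares of these quantities sum to the forms with the kernels 1, N and
    \<open>N\<^sup>2 - N\<close>, where N is the number of agreements.\<close>
  define s where "s = (\<Sum>\<sigma>\<in>\<Omega>. h \<sigma>)"
  define Y where "Y i a = (\<Sum>\<sigma>\<in>\<Omega>. h \<sigma> * of_bool (\<sigma> i = a))" for i a
  define Z where "Z i j a b = (\<Sum>\<sigma>\<in>\<Omega>. h \<sigma> * (of_bool (\<sigma> i = a) * of_bool (\<sigma> j = b)))" for i j a b
  let ?N = "\<lambda>\<sigma> \<pi>. real (agreements A \<sigma> \<pi>)"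
  have inB: "\<sigma> i \<in> B" if "\<sigma> \<in> \<Omega>" "i \<in> A" for \<sigma> i
    using bij[OF that(1)] that(2) by (auto simp: bij_betw_def)
  have inj: "\<sigma> i = \<sigma> j \<longleftrightarrow> i = j" if "\<sigma> \<in> \<Omega>" "i \<in> A" "j \<in> A" for \<sigma> i j
    using bij[OF that(1)] that(2,3) by (auto simp: bij_betw_def inj_on_def)
  have preim: "(\<Sum>i\<in>A. of_bool (\<sigma> i = a)) = (1::real)" if "\<sigma> \<in> \<Omega>" "a \<in> B" for \<sigma> a
  proof -
    have "(\<Sum>i\<in>A. of_bool (\<sigma> i = a)) = (\<Sum>b\<in>B. of_bool (a = b) * (1::real))"
      by (subst sum.reindex_bij_betw[OF bij[OF that(1)], symmetric])
        (auto intro!: sum.cong)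
    then show ?thesis
      using that fin by (subst (asm) sum_delta_of_bool) auto
  qed
  have quadY: "(\<Sum>i\<in>A. \<Sum>a\<in>B. (Y i a)\<^sup>2) = quad_form \<Omega> h ?N"
  proof -
    have "(\<Sum>i\<in>A. \<Sum>a\<in>B. (Y i a)\<^sup>2)
        = quad_form \<Omega> h (\<lambda>\<sigma> \<pi>. \<Sum>i\<in>A. \<Sum>a\<in>B. of_bool (\<sigma> i = a) * of_bool (\<pi> i = a))"
      by (simp add: Y_def quad_form_square quad_form_sum)
    also have "\<dots> = quad_form \<Omega> h ?N"
    proof (rule quad_form_cong)
      fix \<sigma> \<pi> assume "\<sigma> \<in> \<Omega>" "\<pi> \<in> \<Omega>"
      then have "(\<Sum>i\<in>A. \<Sum>a\<in>B. of_bool (\<sigma> i = a) * of_bool (\<pi> i = a))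
          = (\<Sum>i\<in>A. of_bool (\<sigma> i = \<pi> i) :: real)"
        using fin inB by (intro sum.cong refl) (simp add: sum_delta_of_bool eq_commute[of "\<pi> _" "\<sigma> _"])
      then show "(\<Sum>i\<in>A. \<Sum>a\<in>B. of_bool (\<sigma> i = a) * of_bool (\<pi> i = a)) = ?N \<sigma> \<pi>"
        using fin by (simp add: sum_of_bool_agreements)
    qed
    finally show ?thesis .
  qed
  have quadZ: "offdiag_sum A B (\<lambda>i j a b. (Z i j a b)\<^sup>2) = quad_form \<Omega> h (\<lambda>\<sigma> \<pi>. (?N \<sigma> \<pi>)\<^sup>2 - ?N \<sigma> \<pi>)"
  proof -
    have "offdiag_sum A B (\<lambda>i j a b. (Z i j a b)\<^sup>2)
        = quad_form \<Omega> h (\<lambda>\<sigma> \<pi>. \<Sum>i\<in>A. \<Sum>j\<in>A - {i}. \<Sum>a\<in>B. \<Sum>b\<in>B - {a}.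
            (of_bool (\<sigma> i = a) * of_bool (\<sigma> j = b)) * (of_bool (\<pi> i = a) * of_bool (\<pi> j = b)))"
      by (simp add: Z_def quad_form_square quad_form_sum offdiag_sum_def del: of_bool_conj)
    also have "\<dots> = quad_form \<Omega> h (\<lambda>\<sigma> \<pi>. (?N \<sigma> \<pi>)\<^sup>2 - ?N \<sigma> \<pi>)"
    proof (rule quad_form_cong)
      fix \<sigma> \<pi> assume \<sigma>: "\<sigma> \<in> \<Omega>" and \<pi>: "\<pi> \<in> \<Omega>"
      have "(\<Sum>a\<in>B. \<Sum>b\<in>B - {a}.
            (of_bool (\<sigma> i = a) * of_bool (\<sigma> j = b)) * (of_bool (\<pi> i = a) * of_bool (\<pi> j = b)))
          = (of_bool (\<sigma> i = \<pi> i) * of_bool (\<sigma> j = \<pi> j) :: real)"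
        if "i \<in> A" "j \<in> A - {i}" for i j
      proof -
        have "(\<Sum>b\<in>B - {a}.
            (of_bool (\<sigma> i = a) * of_bool (\<sigma> j = b)) * (of_bool (\<pi> i = a) * of_bool (\<pi> j = b)))
            = of_bool (\<sigma> i = a) * (of_bool (\<pi> i = a) * of_bool (\<sigma> j = \<pi> j) :: real)" if a: "a \<in> B" for a
        proof -
          have "(\<Sum>b\<in>B - {a}.
              (of_bool (\<sigma> i = a) * of_bool (\<sigma> j = b)) * (of_bool (\<pi> i = a) * of_bool (\<pi> j = b)))
            = (\<Sum>b\<in>B - {a}. of_bool (\<sigma> j = b) * (of_bool (\<sigma> i = a) * (of_bool (\<pi> i = a) * of_bool (\<pi> j = b)) :: real))"
            by (simp only: mult_ac)
          also have "\<dots> = of_bool (\<sigma> j \<in> B - {a}) * (of_bool (\<sigma> i = a) * (of_bool (\<pi> i = a) * of_bool (\<pi> j = \<sigma> j)))"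
            using fin by (subst sum_delta_of_bool) auto
          also have "\<dots> = of_bool (\<sigma> i = a) * (of_bool (\<pi> i = a) * of_bool (\<sigma> j = \<pi> j) :: real)"
            using inj[OF \<sigma>, of i j] inB[OF \<sigma>, of j] that \<open>i \<in> A\<close> \<open>j \<in> A - {i}\<close> by auto
          finally show ?thesis .
        qed
        then show ?thesis
          using fin inB[OF \<sigma>, of i] that
          by (simp add: sum_delta_of_bool eq_commute[of "\<pi> _" "\<sigma> _"] del: of_bool_conj)
      qed
      then have "(\<Sum>i\<in>A. \<Sum>j\<in>A - {i}. \<Sum>a\<in>B. \<Sum>b\<in>B - {a}.
            (of_bool (\<sigma> i = a) * of_bool (\<sigma> j = b)) * (of_bool (\<pi> i = a) * of_bool (\<pi> j = b)))
          = (\<Sum>i\<in>A. \<Sum>j\<in>A - {i}. of_bool (\<sigma> i = \<pi> i) * of_bool (\<sigma> j = \<pi> j) :: real)"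
        by (intro sum.cong refl)
      then show "(\<Sum>i\<in>A. \<Sum>j\<in>A - {i}. \<Sum>a\<in>B. \<Sum>b\<in>B - {a}.
            (of_bool (\<sigma> i = a) * of_bool (\<sigma> j = b)) * (of_bool (\<pi> i = a) * of_bool (\<pi> j = b)))
          = (?N \<sigma> \<pi>)\<^sup>2 - ?N \<sigma> \<pi>"
        using fin by (simp only: sum_offdiag_of_bool_agreements)
    qed
    finally show ?thesis .
  qed
  have Y1: "(\<Sum>a\<in>B. Y i a) = s" if "i \<in> A" for i
  proof -
    have "(\<Sum>a\<in>B. Y i a) = (\<Sum>\<sigma>\<in>\<Omega>. h \<sigma> * (\<Sum>a\<in>B. of_bool (\<sigma> i = a) * 1))"
      unfolding Y_def sum_distrib_left by (simp add: sum.swap[of _ B])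
    then show ?thesis
      using fin inB that by (simp only: sum_delta_of_bool) (simp add: s_def)
  qed
  have Y2: "(\<Sum>i\<in>A. Y i a) = s" if "a \<in> B" for a
  proof -
    have "(\<Sum>i\<in>A. Y i a) = (\<Sum>\<sigma>\<in>\<Omega>. h \<sigma> * (\<Sum>i\<in>A. of_bool (\<sigma> i = a)))"
      unfolding Y_def sum_distrib_left by (simp add: sum.swap[of _ A])
    then show ?thesis
      using preim that by (simp add: s_def)
  qed
  have Z1: "(\<Sum>b\<in>B - {a}. Z i j a b) = Y i a" if "i \<in> A" "j \<in> A" "i \<noteq> j" "a \<in> B" for i j a
  proof -
    have "(\<Sum>b\<in>B - {a}. Z i j a b)
        = (\<Sum>\<sigma>\<in>\<Omega>. h \<sigma> * (of_bool (\<sigma> i = a) * (\<Sum>b\<in>B - {a}. of_bool (\<sigma> j = b) * 1)))"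
      unfolding Z_def sum_distrib_left by (simp add: sum.swap[of _ "B - {a}"] del: of_bool_conj)
    also have "\<dots> = (\<Sum>\<sigma>\<in>\<Omega>. h \<sigma> * of_bool (\<sigma> i = a))"
    proof (intro sum.cong refl)
      fix \<sigma> assume "\<sigma> \<in> \<Omega>"
      then show "h \<sigma> * (of_bool (\<sigma> i = a) * (\<Sum>b\<in>B - {a}. of_bool (\<sigma> j = b) * 1)) = h \<sigma> * of_bool (\<sigma> i = a)"
        using fin inB[of \<sigma> j] inj[of \<sigma> i j] that by (subst sum_delta_of_bool) auto
    qed
    finally show ?thesis
      by (simp add: Y_def)
  qed
  have Z2: "(\<Sum>j\<in>A - {i}. Z i j a b) = Y i a" if "i \<in> A" "a \<in> B" "b \<in> B" "a \<noteq> b" for i a b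
  proof -
    have "(\<Sum>j\<in>A - {i}. Z i j a b)
        = (\<Sum>\<sigma>\<in>\<Omega>. h \<sigma> * (of_bool (\<sigma> i = a) * (\<Sum>j\<in>A - {i}. of_bool (\<sigma> j = b))))"
      unfolding Z_def sum_distrib_left by (simp add: sum.swap[of _ "A - {i}"] del: of_bool_conj)
    also have "\<dots> = (\<Sum>\<sigma>\<in>\<Omega>. h \<sigma> * of_bool (\<sigma> i = a))"
    proof (intro sum.cong refl)
      fix \<sigma> assume "\<sigma> \<in> \<Omega>"
      then have "(\<Sum>j\<in>A - {i}. of_bool (\<sigma> j = b)) = (1 - of_bool (\<sigma> i = b) :: real)"
        using fin preim[of \<sigma> b] that by (simp add: sum_diff1)
      then show "h \<sigma> * (of_bool (\<sigma> i = a) * (\<Sum>j\<in>A - {i}. of_bool (\<sigma> j = b))) = h \<sigma> * of_bool (\<sigma> i = a)"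
        using that by auto
    qed
    finally show ?thesis
      by (simp add: Y_def)
  qed
  define r where "r = real m"
  have r: "r \<ge> 3"
    using card by (simp add: r_def)
  \<comment> \<open>The mean of \<open>Z i j\<close> over the \<open>r * (r - 1)\<close> pairs of
    distinct values; the mean of \<open>Y i\<close> is then \<open>t * (r - 1)\<close>. Subtracting
    the means produces the zero row and column sums that \<open>offdiag_marginal_inequality\<close>
    requires.\<close>
  define t where "t = s / (r * (r - 1))"
  have t: "t * (r * (r - 1)) = s"
    using r by (simp add: t_def)
  have cA: "real (card (A - {i})) = r - 1" if "i \<in> A" for i
    using fin card that by (simp add: r_def of_nat_diff)
  have cB: "real (card (B - {a})) = r - 1" if "a \<in> B" for a
    using fin card that by (simp add: r_def of_nat_diff)
  have cAB: "real (card A) = r" "real (card B) = r"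
    using card by (simp_all add: r_def)
  note del = card_Diff_singleton card_Diff_insert
  have "2 * (\<Sum>i\<in>A. \<Sum>a\<in>B. (Y i a - t * (r - 1))\<^sup>2) \<le> offdiag_sum A B (\<lambda>i j a b. (Z i j a b - t)\<^sup>2)"
  proof (rule offdiag_marginal_inequality[OF fin card])
    show "(\<Sum>a\<in>B. Y i a - t * (r - 1)) = 0" if "i \<in> A" for i
      using Y1[OF that] t by (simp add: sum_subtractf cAB mult_ac)
    show "(\<Sum>i\<in>A. Y i a - t * (r - 1)) = 0" if "a \<in> B" for a
      using Y2[OF that] t by (simp add: sum_subtractf cAB mult_ac)
    show "Z i j a b - t = Z j i b a - t" for i j a b
      by (simp add: Z_def mult_ac del: of_bool_conj)
    show "(\<Sum>b\<in>B - {a}. Z i j a b - t) = Y i a - t * (r - 1)"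
      if "i \<in> A" "j \<in> A" "i \<noteq> j" "a \<in> B" for i j a
      using Z1[OF that] cB[OF that(4)] by (simp add: sum_subtractf del: del)
    show "(\<Sum>j\<in>A - {i}. Z i j a b - t) = Y i a - t * (r - 1)"
      if "i \<in> A" "a \<in> B" "b \<in> B" "a \<noteq> b" for i a b
      using Z2[OF that] cA[OF that(1)] by (simp add: sum_subtractf del: del)
  qed
  moreover have "(\<Sum>i\<in>A. \<Sum>a\<in>B. (Y i a - t * (r - 1))\<^sup>2)
      = (\<Sum>i\<in>A. \<Sum>a\<in>B. (Y i a)\<^sup>2) - s\<^sup>2"
  proof -
    have "(\<Sum>i\<in>A. \<Sum>a\<in>B. (Y i a - d)\<^sup>2)
        = (\<Sum>i\<in>A. (\<Sum>a\<in>B. (Y i a)\<^sup>2) - 2 * d * (\<Sum>a\<in>B. Y i a) + r * d\<^sup>2)" for d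
      by (simp add: power2_diff sum.distrib sum_subtractf sum_distrib_left cAB mult_ac)
    then have "(\<Sum>i\<in>A. \<Sum>a\<in>B. (Y i a - t * (r - 1))\<^sup>2)
        = (\<Sum>i\<in>A. \<Sum>a\<in>B. (Y i a)\<^sup>2) - r * (2 * (t * (r - 1)) * s) + r * (r * (t * (r - 1))\<^sup>2)"
      by (simp add: Y1 sum.distrib sum_subtractf cAB)
    also have "\<dots> = (\<Sum>i\<in>A. \<Sum>a\<in>B. (Y i a)\<^sup>2) - s\<^sup>2"
    proof -
      have "r * (2 * (t * (r - 1)) * s) = 2 * (t * (r * (r - 1))) * s"
        "r * (r * (t * (r - 1))\<^sup>2) = (t * (r * (r - 1)))\<^sup>2"
        by algebra+
      then show ?thesis
        unfolding t power2_eq_square by linarith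
    qed
    finally show ?thesis .
  qed
  moreover have "offdiag_sum A B (\<lambda>i j a b. (Z i j a b - t)\<^sup>2)
      = offdiag_sum A B (\<lambda>i j a b. (Z i j a b)\<^sup>2) - s\<^sup>2"
  proof -
    have const: "offdiag_sum A B (\<lambda>i j a b. t\<^sup>2) = r * ((r - 1) * (r * ((r - 1) * t\<^sup>2)))"
      unfolding offdiag_sum_def by (simp add: cA cB cAB del: del)
    have "offdiag_sum A B Z = (\<Sum>i\<in>A. \<Sum>j\<in>A - {i}. \<Sum>a\<in>B. Y i a)"
      unfolding offdiag_sum_def by (intro sum.cong refl Z1) auto
    then have "offdiag_sum A B Z = r * ((r - 1) * s)"
      by (simp add: Y1 cA cAB del: del)
    moreover have "offdiag_sum A B (\<lambda>i j a b. (Z i j a b - t)\<^sup>2)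
        = offdiag_sum A B (\<lambda>i j a b. (Z i j a b)\<^sup>2 - (2 * t) * Z i j a b + t\<^sup>2)"
      by (simp add: power2_diff algebra_simps)
    ultimately have "offdiag_sum A B (\<lambda>i j a b. (Z i j a b - t)\<^sup>2)
        = offdiag_sum A B (\<lambda>i j a b. (Z i j a b)\<^sup>2) - (2 * t) * (r * ((r - 1) * s))
          + r * ((r - 1) * (r * ((r - 1) * t\<^sup>2)))"
      using const by (simp only: offdiag_sum_add offdiag_sum_diff offdiag_sum_scale)
    also have "\<dots> = offdiag_sum A B (\<lambda>i j a b. (Z i j a b)\<^sup>2) - s\<^sup>2"
    proof -
      have "(2 * t) * (r * ((r - 1) * s)) = 2 * (t * (r * (r - 1))) * s"
        "r * ((r - 1) * (r * ((r - 1) * t\<^sup>2))) = (t * (r * (r - 1)))\<^sup>2"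
        by algebra+
      then show ?thesis
        unfolding t power2_eq_square by linarith
    qed
    finally show ?thesis .
  qed
  \<comment> \<open>Centring lowers the squared norms of \<open>Y\<close> and of \<open>Z\<close> by
    \<open>s\<^sup>2\<close> each. As \<open>Y\<close> enters with the factor 2, one
    \<open>s\<^sup>2\<close> is left over and supplies the constant 1 of the kernel.\<close>
  ultimately have "0 \<le> quad_form \<Omega> h (\<lambda>\<sigma> \<pi>. (?N \<sigma> \<pi>)\<^sup>2 - ?N \<sigma> \<pi>) - 2 * quad_form \<Omega> h ?N + s\<^sup>2"
    using quadY quadZ by simp
  also have "\<dots> = quad_form \<Omega> h (\<lambda>\<sigma> \<pi>. (?N \<sigma> \<pi>)\<^sup>2 - ?N \<sigma> \<pi>)
      + (- 2) * quad_form \<Omega> h ?N + quad_form \<Omega> h (\<lambda>\<sigma> \<pi>. 1)"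
    using quad_form_square[where h = h and \<phi> = "\<lambda>_. 1" and \<Omega> = \<Omega>] by (simp add: s_def)
  also have "\<dots> = quad_form \<Omega> h (\<lambda>\<sigma> \<pi>. (?N \<sigma> \<pi>)\<^sup>2 - 3 * ?N \<sigma> \<pi> + 1)"
    unfolding quad_form_scale[symmetric] quad_form_add[symmetric]
    by (rule quad_form_cong) simp
  finally show ?thesis .
qed

section \<open>Factorial moments of the number of agreements\<close>

definition agreement_moment :: "nat \<Rightarrow> ((nat \<Rightarrow> nat) \<Rightarrow> real) \<Rightarrow> nat \<Rightarrow> real" where
  "agreement_moment n h k
    = quad_form (Sym n) h (\<lambda>\<sigma> \<pi>. fact k * real (agreements {1..n} \<sigma> \<pi> choose k))"

text \<open>The falling factorial of length k is a common factor; with M = N - k what remains is M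
  (M - 1) - 2 M + 1. For \<open>k > N\<close> the subtraction is truncated, but then all binomial
  coefficients vanish.\<close>

lemma choose_second_difference:
  "fact (k + 2) * real (N choose (k + 2)) - 2 * (fact (k + 1) * real (N choose (k + 1)))
      + fact k * real (N choose k)
    = fact k * (real (N choose k) * ((real (N - k))\<^sup>2 - 3 * real (N - k) + 1))"
proof (cases "k \<le> N")
  case True
  have step: "real (N choose Suc j) * (real j + 1) = real (N choose j) * (real N - real j)" for j
  proof (cases "j \<le> N")
    case True
    have "Suc j * (N choose Suc j) = (N - j) * (N choose j)"
      by (metis binomial_absorb_comp binomial_absorption)
    then have "real (Suc j * (N choose Suc j)) = real ((N - j) * (N choose j))"
      by (rule arg_cong)
    then show ?thesis
      using True by (simp add: of_nat_diff algebra_simps)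
  qed (simp add: binomial_eq_0)
  define x where "x = real (N choose k)"
  define y where "y = real (N choose (k + 1))"
  define z where "z = real (N choose (k + 2))"
  have 1: "y * (real k + 1) = x * (real N - real k)"
    using step[of k] by (simp add: x_def y_def)
  have 2: "z * (real k + 2) = y * (real N - real k - 1)"
    using step[of "k + 1"] by (simp add: z_def y_def algebra_simps)
  have "(real k + 2) * (real k + 1) * z - 2 * (real k + 1) * y + x
      = x * ((real N - real k)\<^sup>2 - 3 * (real N - real k) + 1)"
    using 1 2 by algebra
  then have "fact k * ((real k + 2) * (real k + 1) * z - 2 * (real k + 1) * y + x)
      = fact k * (x * ((real N - real k)\<^sup>2 - 3 * (real N - real k) + 1))"
    by simp
  then show ?thesis
    using True unfolding x_def y_def z_def by (simp add: of_nat_diff algebra_simps)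
qed (simp add: binomial_eq_0)

text \<open>\<open>N choose k\<close> counts the k-sets \<open>I\<close> of agreements, and N - k
  agreements lie outside \<open>I\<close>. So the second difference is a sum over \<open>I\<close>
  of the kernel of \<open>agreement_kernel_psd\<close> on the complement of \<open>I\<close>,
  restricted to pairs that agree on \<open>I\<close>. The bound on \<open>k\<close> leaves at least
  3 points there.\<close>

lemma agreement_moment_convex:
  assumes "k + 3 \<le> n"
  shows "0 \<le> agreement_moment n h (k + 2) - 2 * agreement_moment n h (k + 1) + agreement_moment n h k"
proof -
  define \<phi> where "\<phi> N = (real N)\<^sup>2 - 3 * real N + 1" for N
  define \<I> where "\<I> = {I. I \<subseteq> {1..n} \<and> card I = k}"
  have psd: "0 \<le> quad_form (Sym n) h
      (\<lambda>\<sigma> \<pi>. of_bool (\<forall>i\<in>I. \<sigma> i = \<pi> i) * \<phi> (agreements ({1..n} - I) \<sigma> \<pi>))" if "I \<in> \<I>" for I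
  proof -
    have I: "I \<subseteq> {1..n}" "card I = k" "finite I"
      using that finite_subset by (auto simp: \<I>_def)
    \<comment> \<open>The restriction of \<open>\<sigma>\<close> to \<open>I\<close>, padded by 0 so
      that agreement on \<open>I\<close> becomes an equality of functions.\<close>
    define R where "R \<sigma> = (\<lambda>i. if i \<in> I then \<sigma> i else 0)" for \<sigma> :: "nat \<Rightarrow> nat"
    have R: "(\<forall>i\<in>I. \<sigma> i = \<pi> i) \<longleftrightarrow> R \<sigma> = R \<pi>" for \<sigma> \<pi>
      by (auto simp: R_def fun_eq_iff)
    have "0 \<le> quad_form {\<sigma> \<in> Sym n. R \<sigma> = \<alpha>} h (\<lambda>\<sigma> \<pi>. \<phi> (agreements ({1..n} - I) \<sigma> \<pi>))"
      if \<alpha>: "\<alpha> \<in> R ` Sym n" for \<alpha>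
    proof -
      obtain \<tau> where \<tau>: "\<tau> \<in> Sym n" "\<alpha> = R \<tau>"
        using \<alpha> by auto
      \<comment> \<open>Within a block all permutations map \<open>I\<close> to the same set, hence
        they are bijections between the same two complements.\<close>
      have im: "\<sigma> ` I = \<tau> ` I" if "R \<sigma> = \<alpha>" for \<sigma>
        using that \<tau> R[of \<sigma> \<tau>] by (auto intro!: image_cong)
      have injI: "inj_on \<tau> {1..n}" "\<tau> ` {1..n} = {1..n}"
        using \<tau>(1) by (auto simp: Sym_def permutes_inj_on permutes_image)
      show ?thesis
        unfolding \<phi>_def
      proof (rule agreement_kernel_psd[where B = "{1..n} - \<tau> ` I" and m = "n - k"])
        have "card (\<tau> ` I) = k"
          using I injI by (metis card_image inj_on_subset)
        then show "card ({1..n} - \<tau> ` I) = n - k"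
          using I injI by (subst card_Diff_subset) auto
        show "card ({1..n} - I) = n - k"
          using I by (subst card_Diff_subset) auto
        show "bij_betw \<sigma> ({1..n} - I) ({1..n} - \<tau> ` I)" if "\<sigma> \<in> {\<sigma> \<in> Sym n. R \<sigma> = \<alpha>}" for \<sigma>
        proof -
          have "\<sigma> permutes {1..n}"
            using that by (simp add: Sym_def)
          then have "bij_betw \<sigma> ({1..n} - I) (\<sigma> ` {1..n} - \<sigma> ` I)"
            using I(1) by (metis bij_betw_def image_set_diff inj_on_subset permutes_inj subset_UNIV)
          then show ?thesis
            using \<open>\<sigma> permutes {1..n}\<close> im[of \<sigma>] that by (simp add: permutes_image)
        qed
      qed (use assms in auto)
    qed
    then show ?thesis
      unfolding R by (subst quad_form_partition) (auto simp: finite_Sym intro!: sum_nonneg)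
  qed
  have count: "(\<Sum>I\<in>\<I>. of_bool (\<forall>i\<in>I. \<sigma> i = \<pi> i) * \<phi> (agreements ({1..n} - I) \<sigma> \<pi>))
      = real (agreements {1..n} \<sigma> \<pi> choose k) * \<phi> (agreements {1..n} \<sigma> \<pi> - k)" for \<sigma> \<pi> :: "nat \<Rightarrow> nat"
  proof -
    define G where "G = {i \<in> {1..n}. \<sigma> i = \<pi> i}"
    have G: "finite G" "agreements {1..n} \<sigma> \<pi> = card G"
      by (auto simp: G_def agreements_def)
    have "agreements ({1..n} - I) \<sigma> \<pi> = card G - k" if "I \<in> \<I>" "\<forall>i\<in>I. \<sigma> i = \<pi> i" for I
    proof -
      have "I \<subseteq> G"
        using that by (auto simp: G_def \<I>_def)
      moreover have "{i \<in> {1..n} - I. \<sigma> i = \<pi> i} = G - I"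
        by (auto simp: G_def)
      ultimately show ?thesis
        using that G by (simp add: agreements_def \<I>_def card_Diff_subset finite_subset)
    qed
    then have "(\<Sum>I\<in>\<I>. of_bool (\<forall>i\<in>I. \<sigma> i = \<pi> i) * \<phi> (agreements ({1..n} - I) \<sigma> \<pi>))
        = (\<Sum>I\<in>\<I>. of_bool (\<forall>i\<in>I. \<sigma> i = \<pi> i) * \<phi> (card G - k))"
      by (intro sum.cong refl) (simp add: of_bool_def)
    also have "\<dots> = real (card {I \<in> \<I>. \<forall>i\<in>I. \<sigma> i = \<pi> i}) * \<phi> (card G - k)"
      by (simp add: sum_distrib_right[symmetric] of_bool_def \<I>_def sum.inter_filter[symmetric])
    also have "{I \<in> \<I>. \<forall>i\<in>I. \<sigma> i = \<pi> i} = {I. I \<subseteq> G \<and> card I = k}"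
      by (auto simp: \<I>_def G_def)
    finally show ?thesis
      using G by (simp add: n_subsets)
  qed
  have "0 \<le> fact k * (\<Sum>I\<in>\<I>. quad_form (Sym n) h
      (\<lambda>\<sigma> \<pi>. of_bool (\<forall>i\<in>I. \<sigma> i = \<pi> i) * \<phi> (agreements ({1..n} - I) \<sigma> \<pi>)))"
    using psd by (intro mult_nonneg_nonneg sum_nonneg) auto
  also have "\<dots> = quad_form (Sym n) h (\<lambda>\<sigma> \<pi>. fact k *
      (real (agreements {1..n} \<sigma> \<pi> choose k) * \<phi> (agreements {1..n} \<sigma> \<pi> - k)))"
    by (simp only: quad_form_sum[symmetric] count quad_form_scale)
  also have "\<dots> = quad_form (Sym n) h (\<lambda>\<sigma> \<pi>.
      fact (k + 2) * real (agreements {1..n} \<sigma> \<pi> choose (k + 2))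
      + (- 2) * (fact (k + 1) * real (agreements {1..n} \<sigma> \<pi> choose (k + 1)))
      + fact k * real (agreements {1..n} \<sigma> \<pi> choose k))"
  proof (rule quad_form_cong)
    fix \<sigma> \<pi> :: "nat \<Rightarrow> nat"
    show "fact k * (real (agreements {1..n} \<sigma> \<pi> choose k) * \<phi> (agreements {1..n} \<sigma> \<pi> - k))
        = fact (k + 2) * real (agreements {1..n} \<sigma> \<pi> choose (k + 2))
          + (- 2) * (fact (k + 1) * real (agreements {1..n} \<sigma> \<pi> choose (k + 1)))
          + fact k * real (agreements {1..n} \<sigma> \<pi> choose k)"
      using choose_second_difference[of k "agreements {1..n} \<sigma> \<pi>"] unfolding \<phi>_def by linarith
  qed
  also have "\<dots> = agreement_moment n h (k + 2) + (- 2) * agreement_moment n h (k + 1) + agreement_moment n h k"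
    by (simp only: agreement_moment_def quad_form_add quad_form_scale)
  finally show ?thesis
    by simp
qed

section \<open>The disjointness form on functions orthogonal to cosets\<close>

text \<open>The chords of a convex sequence from the point (1, 0) have nondecreasing slopes
  \<open>x k / (k - 1)\<close>. Denominators are cleared so that the induction can start at
  \<open>k = 1\<close>.\<close>

lemma convex_seq_ratio_mono:
  fixes x :: "nat \<Rightarrow> real"
  assumes "x 0 = 0" "x 1 = 0"
    and convex: "\<And>k. k + 3 \<le> n \<Longrightarrow> 0 \<le> x (k + 2) - 2 * x (k + 1) + x k"
    and "1 \<le> k" "k + 2 \<le> n"
  shows "real k * x k \<le> (real k - 1) * x (k + 1)"
  using assms(4,5)
proof (induction k rule: dec_induct)
  case base
  then show ?case
    using assms(2) by simp
next
  case (step k)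
  then have "real k * x k \<le> (real k - 1) * x (k + 1)"
    by simp
  moreover have "real k * 0 \<le> real k * (x (k + 2) - 2 * x (k + 1) + x k)"
    using convex[of k] step.prems by (intro mult_left_mono) auto
  ultimately show ?case
    by (simp add: algebra_simps)
qed

text \<open>Let m be the slope \<open>M / (n - 2)\<close> of the chord from 1 to n - 1, so that
  \<open>x k \<le> (k - 1) * m\<close>. Up to index 4 the loss is at most x 3 / 6 - x 4 / 24, which
  is at most 5/48 * x 3 and so at most 5 m / 24; all later terms together lose at most m / 24. The
  sum is m / 4.\<close>

lemma convex_seq_alternating_sum:
  fixes x :: "nat \<Rightarrow> real"
  assumes "n \<ge> 6" "x 0 = 0" "x 1 = 0"
    and convex: "\<And>k. k + 3 \<le> n \<Longrightarrow> 0 \<le> x (k + 2) - 2 * x (k + 1) + x k"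
    and last: "x n = M" "x (n - 1) = M"
  shows "- (M / (4 * (real n - 2))) \<le> (\<Sum>k\<le>n. (- 1) ^ k * (x k / fact k))"
proof -
  have ratio: "real k * x k \<le> (real k - 1) * x (k + 1)" if "1 \<le> k" "k + 2 \<le> n" for k
    using convex_seq_ratio_mono[of x n k] assms(2,3) convex that by blast
  have nonneg: "0 \<le> x k" if "2 \<le> k" "k \<le> n - 1" for k
    using that
  proof (induction k rule: dec_induct)
    case base
    then show ?case
      using convex[of 0] assms(1-3) by (simp add: numeral_2_eq_2)
  next
    case (step k)
    then have "0 \<le> real k * x k" "real k * x k \<le> (real k - 1) * x (k + 1)"
      using ratio[of k] by auto
    then have "0 \<le> (real k - 1) * x (k + 1)"
      by linarith
    then show ?case
      using step.hyps by (simp add: zero_le_mult_iff)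
  qed
  have M: "0 \<le> M"
    using nonneg[of "n - 1"] last assms(1) by simp
  have growth: "x k \<le> (real k - 1) * (M / (real n - 2))" if "2 \<le> k" "k \<le> n - 1" for k
    using that(2,1)
  proof (induction k rule: inc_induct)
    case base
    then show ?case
      using last assms(1) by (simp add: of_nat_diff)
  next
    case (step k)
    then have "real k * x k \<le> (real k - 1) * x (k + 1)"
      using ratio[of k] by auto
    also have "\<dots> \<le> (real k - 1) * (real k * (M / (real n - 2)))"
      using step by (intro mult_left_mono) auto
    finally have "real k * x k \<le> real k * ((real k - 1) * (M / (real n - 2)))"
      by (simp add: mult_ac)
    then show ?case
      using step.prems by (subst (asm) mult_le_cancel_left_pos) auto
  qed
  define m where "m = M / (real n - 2)"
  have m: "0 \<le> m"
    using M assms(1) by (simp add: m_def)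
  \<comment> \<open>Convexity is available only up to \<open>n - 1\<close>. The last entry repeats
    the value \<open>M\<close>, so it lies below the chord prolonged to \<open>n\<close>.\<close>
  have bound: "x k \<le> (real k - 1) * m" "0 \<le> x k" if "2 \<le> k" "k \<le> n" for k
  proof -
    have "M \<le> (real n - 1) * m"
      using M assms(1) by (simp add: m_def field_simps)
    then show "x k \<le> (real k - 1) * m"
      using growth[of k] that last by (cases "k = n") (auto simp: m_def)
    show "0 \<le> x k"
      using nonneg[of k] that last M by (cases "k = n") auto
  qed
  \<comment> \<open>The summand equals (k - 1) / k!, the weight of the chord bound for
    \<open>x k\<close>.\<close>
  have telescope: "(\<Sum>k\<in>{4<..N}. 1 / fact (k - 1) - 1 / fact k) = (1 / 24 - 1 / fact N :: real)"
    if "4 \<le> N" for N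
    using that
  proof (induction N rule: dec_induct)
    case base
    then show ?case by (simp add: fact_numeral)
  next
    case (step N)
    then have "{4<..Suc N} = insert (Suc N) {4<..N}"
      by auto
    then show ?case
      using step by simp
  qed
  have "- (m / 24) \<le> - m * (1 / 24 - 1 / fact n)"
    using m by (simp add: algebra_simps)
  also have "\<dots> = (\<Sum>k\<in>{4<..n}. - m * (1 / fact (k - 1) - 1 / fact k))"
    using telescope[of n] assms(1) by (simp only: sum_distrib_left[symmetric])
  also have "\<dots> \<le> (\<Sum>k\<in>{4<..n}. (- 1) ^ k * (x k / fact k))"
  proof (rule sum_mono)
    fix k assume k: "k \<in> {4<..n}"
    then obtain j where j: "k = Suc j"
      by (cases k) auto
    have "m * (1 / fact (k - 1) - 1 / fact k) = (real k - 1) * m / fact k"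
    proof -
      have "1 / fact j = (real j + 1) / (fact (Suc j) :: real)"
        by (simp add: add.commute)
      then show ?thesis
        unfolding j by (simp add: field_split_simps)
    qed
    moreover have "\<dots> \<ge> x k / fact k"
      using bound(1)[of k] k by (intro divide_right_mono) auto
    moreover have "(- 1) ^ k * (x k / fact k) \<ge> - (x k / fact k)"
      using bound(2)[of k] k by (cases "even k") auto
    ultimately show "- m * (1 / fact (k - 1) - 1 / fact k) \<le> (- 1) ^ k * (x k / fact k)"
      by linarith
  qed
  finally have tail: "- (m / 24) \<le> (\<Sum>k\<in>{4<..n}. (- 1) ^ k * (x k / fact k))" .
  have "{..n} = {..4} \<union> {4<..n}"
    using assms(1) by auto
  then have "(\<Sum>k\<le>n. (- 1) ^ k * (x k / fact k))
      = (\<Sum>k\<le>4. (- 1) ^ k * (x k / fact k)) + (\<Sum>k\<in>{4<..n}. (- 1) ^ k * (x k / fact k))"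
    by (simp only: sum.union_disjoint[OF finite_atMost finite_greaterThanAtMost] ivl_disj_int_one)
  moreover have "(\<Sum>k\<le>4. (- 1) ^ k * (x k / fact k)) = x 2 / 2 - x 3 / 6 + x 4 / 24"
    using assms(2,3) by (simp add: eval_nat_numeral fact_numeral)
  moreover have "0 \<le> x 2" "x 3 \<le> 2 * m" "3 * x 3 \<le> 2 * x 4"
    using bound(2)[of 2] bound(1)[of 3] ratio[of 3] assms(1) by simp_all
  moreover have "M / (4 * (real n - 2)) = m / 4"
    by (simp add: m_def)
  ultimately show ?thesis
    using tail by linarith
qed

section \<open>Disjointness by inclusion-exclusion, and the first and last agreement moments\<close>

lemma agreements_le: "agreements {1..n} \<sigma> \<pi> \<le> n"
  unfolding agreements_def by (rule order_trans[OF card_mono[of "{1..n}"]]) auto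

lemma disjoint_perms_iff_agreements: "disjoint_perms n \<sigma> \<pi> \<longleftrightarrow> agreements {1..n} \<sigma> \<pi> = 0"
  by (auto simp: disjoint_perms_def agreements_def)

lemma of_bool_eq_0_alternating:
  assumes "N \<le> n"
  shows "of_bool (N = 0) = (\<Sum>k\<le>n. (- 1) ^ k * real (N choose k))"
proof -
  have "(\<Sum>k\<le>n. (- 1) ^ k * real (N choose k)) = (\<Sum>k\<le>N. (- 1) ^ k * real (N choose k))"
    using assms by (intro sum.mono_neutral_right) (auto simp: binomial_eq_0)
  then show ?thesis
    using choose_alternating_sum[of N, where 'a = real] by (cases "N = 0") auto
qed

text \<open>A single disagreement is impossible: if the permutations differ at \<open>i\<close>,
  they also differ at the preimage of \<open>\<pi> i\<close> under \<open>\<sigma>\<close>.\<close>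

lemma eq_if_agreements_ge:
  assumes "\<sigma> \<in> Sym n" "\<pi> \<in> Sym n" "agreements {1..n} \<sigma> \<pi> \<ge> n - 1"
  shows "\<sigma> = \<pi>"
proof (rule ccontr)
  assume "\<sigma> \<noteq> \<pi>"
  have p: "\<sigma> permutes {1..n}" "\<pi> permutes {1..n}"
    using assms by (auto simp: Sym_def)
  obtain i where i: "\<sigma> i \<noteq> \<pi> i"
    using \<open>\<sigma> \<noteq> \<pi>\<close> by auto
  then have "i \<in> {1..n}"
    using p by (metis permutes_not_in)
  moreover obtain j where j: "\<sigma> j = \<pi> i" "j \<in> {1..n}"
    using p \<open>i \<in> {1..n}\<close> by (metis permutes_in_image permutes_surj surjD)
  moreover have "\<sigma> j \<noteq> \<pi> j" "j \<noteq> i"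
    using i j p by (metis permutes_inj injD)+
  ultimately have "{k \<in> {1..n}. \<sigma> k = \<pi> k} \<subseteq> {1..n} - {i, j}"
    using i by auto
  then have "agreements {1..n} \<sigma> \<pi> \<le> card ({1..n} - {i, j})"
    unfolding agreements_def by (intro card_mono) auto
  also have "\<dots> = n - 2"
    using \<open>i \<in> {1..n}\<close> j \<open>j \<noteq> i\<close> by (subst card_Diff_subset) auto
  finally have "n - 1 \<le> n - 2" "i \<le> n" "j \<le> n" "1 \<le> i" "1 \<le> j"
    using assms(3) \<open>i \<in> {1..n}\<close> j by auto
  then show False
    using \<open>j \<noteq> i\<close> by linarith
qed

lemma agreements_self: "agreements {1..n} \<sigma> \<sigma> = n"
  by (simp add: agreements_def del: atLeastAtMost_iff)

text \<open>Distinct permutations agree in fewer than n - 1 points, so only the diagonal of the form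
  survives. For \<open>k = n - 1\<close> and \<open>k = n\<close> the factor is
  \<open>fact n\<close> in both cases; these are the two equal end values of the convex
  sequence.\<close>

lemma agreement_moment_eq_diag:
  assumes "k \<ge> n - 1"
  shows "agreement_moment n h k = fact k * real (n choose k) * (\<Sum>\<sigma>\<in>Sym n. (h \<sigma>)\<^sup>2)"
proof -
  have "real (agreements {1..n} \<sigma> \<pi> choose k) = of_bool (\<sigma> = \<pi>) * real (n choose k)"
    if "\<sigma> \<in> Sym n" "\<pi> \<in> Sym n" for \<sigma> \<pi>
  proof (cases "\<sigma> = \<pi>")
    case False
    then have "agreements {1..n} \<sigma> \<pi> < k"
      using eq_if_agreements_ge[OF that] assms by fastforce
    then show ?thesis
      using False by (simp add: binomial_eq_0)
  qed (simp add: agreements_self[simplified])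
  then have "agreement_moment n h k
      = (\<Sum>\<sigma>\<in>Sym n. \<Sum>\<pi>\<in>Sym n. of_bool (\<sigma> = \<pi>) * (h \<sigma> * h \<pi> * (fact k * real (n choose k))))"
    unfolding agreement_moment_def quad_form_def by (intro sum.cong refl) simp
  also have "\<dots> = (\<Sum>\<sigma>\<in>Sym n. h \<sigma> * h \<sigma> * (fact k * real (n choose k)))"
    by (intro sum.cong refl) (simp only: sum_delta_of_bool[OF finite_Sym], simp)
  finally show ?thesis
    by (simp add: sum_distrib_left power2_eq_square mult_ac)
qed

lemma sum_Sym_by_value:
  fixes g :: "(nat \<Rightarrow> nat) \<Rightarrow> real"
  assumes "i \<in> {1..n}"
  shows "(\<Sum>\<pi>\<in>Sym n. g \<pi>) = (\<Sum>j\<in>{1..n}. \<Sum>\<pi>\<in>perm_coset n i j. g \<pi>)"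
proof -
  have "(\<lambda>\<pi>. \<pi> i) ` Sym n \<subseteq> {1..n}"
    using assms by (auto simp: Sym_def permutes_in_image simp del: atLeastAtMost_iff)
  then show ?thesis
    unfolding perm_coset_def
    by (subst sum.group[OF finite_Sym, of "{1..n}" "\<lambda>\<pi>. \<pi> i"]) auto
qed

lemma sum_perm_coset: "(\<Sum>\<pi>\<in>perm_coset n i j. g \<pi>) = (\<Sum>\<pi>\<in>Sym n. g \<pi> * of_bool (\<pi> i = j) :: real)"
  unfolding perm_coset_def by (simp add: sum.inter_filter[OF finite_Sym] of_bool_def if_distrib cong: if_cong)

lemma agreement_moment_0: "agreement_moment n h 0 = (\<Sum>\<sigma>\<in>Sym n. h \<sigma>)\<^sup>2"
  using quad_form_square[of h "\<lambda>_. 1" "Sym n"] by (simp add: agreement_moment_def)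

text \<open>An agreement is a coset containing both permutations, so the agreement count is the Gram
  kernel of the coset indicators. Orthogonality to the cosets therefore annihilates the first
  moment.\<close>

lemma agreement_moment_1:
  "agreement_moment n h 1 = (\<Sum>i\<in>{1..n}. \<Sum>j\<in>{1..n}. (\<Sum>\<pi>\<in>perm_coset n i j. h \<pi>)\<^sup>2)"
proof -
  have "(\<Sum>i\<in>{1..n}. \<Sum>j\<in>{1..n}. (\<Sum>\<pi>\<in>perm_coset n i j. h \<pi>)\<^sup>2)
      = quad_form (Sym n) h (\<lambda>\<sigma> \<pi>. \<Sum>i\<in>{1..n}. \<Sum>j\<in>{1..n}. of_bool (\<sigma> i = j) * of_bool (\<pi> i = j))"
    by (simp only: sum_perm_coset quad_form_square quad_form_sum)
  also have "\<dots> = quad_form (Sym n) h (\<lambda>\<sigma> \<pi>. real (agreements {1..n} \<sigma> \<pi>))"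
  proof (rule quad_form_cong)
    fix \<sigma> \<pi> assume "\<sigma> \<in> Sym n" "\<pi> \<in> Sym n"
    then have "\<sigma> i \<in> {1..n}" if "i \<in> {1..n}" for i
      using that by (simp add: Sym_def permutes_in_image del: atLeastAtMost_iff)
    then have "(\<Sum>i\<in>{1..n}. \<Sum>j\<in>{1..n}. of_bool (\<sigma> i = j) * of_bool (\<pi> i = j))
        = (\<Sum>i\<in>{1..n}. of_bool (\<sigma> i = \<pi> i) :: real)"
      by (intro sum.cong refl) (simp add: sum_delta_of_bool eq_commute[of "\<pi> _" "\<sigma> _"] del: atLeastAtMost_iff)
    then show "(\<Sum>i\<in>{1..n}. \<Sum>j\<in>{1..n}. of_bool (\<sigma> i = j) * of_bool (\<pi> i = j))
        = real (agreements {1..n} \<sigma> \<pi>)"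
      by (simp only: sum_of_bool_agreements[OF finite_atLeastAtMost])
  qed
  finally show ?thesis
    by (simp add: agreement_moment_def)
qed

lemma disjoint_form_lower_bound:
  assumes "n \<ge> 6"
    and orth: "\<And>i j. \<lbrakk>i \<in> {1..n}; j \<in> {1..n}\<rbrakk> \<Longrightarrow> (\<Sum>\<pi>\<in>perm_coset n i j. h \<pi>) = 0"
  shows "- (fact n / (4 * (real n - 2)) * (\<Sum>\<sigma>\<in>Sym n. (h \<sigma>)\<^sup>2))
    \<le> quad_form (Sym n) h (\<lambda>\<sigma> \<pi>. of_bool (disjoint_perms n \<sigma> \<pi>))"
proof -
  have "quad_form (Sym n) h (\<lambda>\<sigma> \<pi>. of_bool (disjoint_perms n \<sigma> \<pi>))
      = quad_form (Sym n) h (\<lambda>\<sigma> \<pi>. \<Sum>k\<le>n. ((- 1) ^ k / fact k) * (fact k * real (agreements {1..n} \<sigma> \<pi> choose k)))"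
    by (rule quad_form_cong)
      (simp add: disjoint_perms_iff_agreements of_bool_eq_0_alternating[OF agreements_le[simplified]])
  also have "\<dots> = (\<Sum>k\<le>n. ((- 1) ^ k / fact k) * agreement_moment n h k)"
    by (simp only: quad_form_sum quad_form_scale agreement_moment_def)
  also have "\<dots> = (\<Sum>k\<le>n. (- 1) ^ k * (agreement_moment n h k / fact k))"
    by simp
  also have "\<dots> \<ge> - ((fact n * (\<Sum>\<sigma>\<in>Sym n. (h \<sigma>)\<^sup>2)) / (4 * (real n - 2)))"
  proof (rule convex_seq_alternating_sum[OF assms(1)])
    have "(\<Sum>\<sigma>\<in>Sym n. h \<sigma>) = 0"
      using orth assms(1) by (subst sum_Sym_by_value[of 1]) auto
    then show "agreement_moment n h 0 = 0"
      by (simp add: agreement_moment_0)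
    show "agreement_moment n h 1 = 0"
      unfolding agreement_moment_1 using orth by (intro sum.neutral ballI) simp
    show "agreement_moment n h n = fact n * (\<Sum>\<sigma>\<in>Sym n. (h \<sigma>)\<^sup>2)"
      by (simp add: agreement_moment_eq_diag)
    have "n choose (n - 1) = n" "fact n = real n * fact (n - 1)"
      using assms(1) binomial_symmetric[of 1 n] by (auto simp: fact_reduce)
    then show "agreement_moment n h (n - 1) = fact n * (\<Sum>\<sigma>\<in>Sym n. (h \<sigma>)\<^sup>2)"
      by (simp add: agreement_moment_eq_diag)
  qed (rule agreement_moment_convex)
  finally show ?thesis
    by simp
qed

section \<open>Counting permutations and derangements\<close>

lemma sum_of_bool_card:
  "finite A \<Longrightarrow> (\<Sum>x\<in>A. of_bool (P x)) = real (card {x \<in> A. P x})"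
  by (simp add: of_bool_def sum.inter_filter[symmetric])

lemma card_Sym_fixing:
  assumes "I \<subseteq> {1..n}"
  shows "card {\<pi> \<in> Sym n. \<forall>i\<in>I. \<pi> i = i} = fact (n - card I)"
proof -
  have "{\<pi> \<in> Sym n. \<forall>i\<in>I. \<pi> i = i} = {\<pi>. \<pi> permutes ({1..n} - I)}"
  proof (intro equalityI subsetI CollectI)
    fix \<pi> assume "\<pi> \<in> {\<pi> \<in> Sym n. \<forall>i\<in>I. \<pi> i = i}"
    then have "\<pi> permutes {1..n}" "\<forall>i\<in>{1..n} - ({1..n} - I). \<pi> i = i"
      by (auto simp: Sym_def simp del: atLeastAtMost_iff)
    then show "\<pi> permutes ({1..n} - I)"
      using permutes_superset by blast
  next
    fix \<pi> assume "\<pi> \<in> {\<pi>. \<pi> permutes ({1..n} - I)}"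
    then have "\<pi> permutes ({1..n} - I)"
      by simp
    then show "\<pi> \<in> Sym n \<and> (\<forall>i\<in>I. \<pi> i = i)"
      using permutes_subset[of \<pi> "{1..n} - I" "{1..n}"] by (auto simp: Sym_def permutes_not_in)
  qed
  moreover have "card ({1..n} - I) = n - card I"
    using assms finite_subset[OF assms] by (simp add: card_Diff_subset)
  ultimately show ?thesis
    by (simp add: card_permutations[OF _ finite_Diff])
qed

lemma real_derangements:
  "real (derangements n) = (\<Sum>k\<le>n. (- 1) ^ k * (fact n / fact k))"
proof -
  \<comment> \<open>Double counting of the pairs of a permutation and a k-set of its fixed
    points.\<close>
  have "real (\<Sum>\<pi>\<in>Sym n. agreements {1..n} \<pi> (\<lambda>i. i) choose k) = fact n / fact k" if "k \<le> n" for k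
  proof -
    have "(\<Sum>\<pi>\<in>Sym n. agreements {1..n} \<pi> (\<lambda>i. i) choose k)
        = (\<Sum>\<pi>\<in>Sym n. \<Sum>I | I \<subseteq> {1..n} \<and> card I = k. of_bool (\<forall>i\<in>I. \<pi> i = i))"
    proof (rule sum.cong[OF refl])
      fix \<pi> :: "nat \<Rightarrow> nat"
      have "agreements {1..n} \<pi> (\<lambda>i. i) choose k = card {I. I \<subseteq> {i \<in> {1..n}. \<pi> i = i} \<and> card I = k}"
        by (simp add: agreements_def n_subsets)
      also have "{I. I \<subseteq> {i \<in> {1..n}. \<pi> i = i} \<and> card I = k}
          = {I \<in> {I. I \<subseteq> {1..n} \<and> card I = k}. \<forall>i\<in>I. \<pi> i = i}"
        by auto
      finally show "agreements {1..n} \<pi> (\<lambda>i. i) choose k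
          = (\<Sum>I | I \<subseteq> {1..n} \<and> card I = k. of_bool (\<forall>i\<in>I. \<pi> i = i))"
        by (simp add: of_bool_def sum.inter_filter[symmetric])
    qed
    also have "\<dots> = (\<Sum>I | I \<subseteq> {1..n} \<and> card I = k. card {\<pi> \<in> Sym n. \<forall>i\<in>I. \<pi> i = i})"
      by (subst sum.swap) (simp add: of_bool_def sum.inter_filter[OF finite_Sym, symmetric])
    also have "\<dots> = (n choose k) * fact (n - k)"
      by (simp add: card_Sym_fixing n_subsets)
    finally show ?thesis
      using that by (simp add: binomial_fact)
  qed
  then have sums: "(\<Sum>\<pi>\<in>Sym n. real (agreements {1..n} \<pi> (\<lambda>i. i) choose k)) = fact n / fact k" if "k \<le> n" for k
    using that by simp
  have "real (derangements n) = (\<Sum>\<pi>\<in>Sym n. of_bool (agreements {1..n} \<pi> (\<lambda>i. i) = 0))"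
  proof -
    have "agreements {1..n} \<pi> (\<lambda>i. i) = 0 \<longleftrightarrow> (\<forall>i\<in>{1..n}. \<pi> i \<noteq> i)" for \<pi>
      by (auto simp: agreements_def)
    then show ?thesis
      by (simp only: derangements_def sum_of_bool_card[OF finite_Sym])
  qed
  also have "\<dots> = (\<Sum>\<pi>\<in>Sym n. \<Sum>k\<le>n. (- 1) ^ k * real (agreements {1..n} \<pi> (\<lambda>i. i) choose k))"
    by (intro sum.cong refl of_bool_eq_0_alternating agreements_le)
  also have "\<dots> = (\<Sum>k\<le>n. (- 1) ^ k * (\<Sum>\<pi>\<in>Sym n. real (agreements {1..n} \<pi> (\<lambda>i. i) choose k)))"
    unfolding sum_distrib_left by (rule sum.swap)
  finally show ?thesis
    using sums by simp
qed

lemma derangements_Suc: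
  "real (derangements (Suc n)) = real (Suc n) * real (derangements n) + (- 1) ^ Suc n"
  by (simp add: real_derangements sum_distrib_left mult_ac)

lemma derangement_sum_recurrence:
  assumes "n \<ge> 2"
  shows "(real n - 1) * real (derangement_sum (n - 1)) = real (derangements n)"
proof -
  obtain m where m: "n = Suc (Suc m)"
    using assms by (metis Suc_le_D numeral_2_eq_2 Suc_le_mono)
  have 1: "real (derangements n) = (real m + 2) * real (derangements (Suc m)) + (- 1) ^ m"
    using derangements_Suc[of "Suc m"] by (simp add: m algebra_simps)
  have 2: "(real m + 1) * real (derangements m) = real (derangements (Suc m)) + (- 1) ^ m"
    using derangements_Suc[of m] by (simp add: algebra_simps)
  have "(real n - 1) * real (derangement_sum (n - 1))
      = (real m + 1) * real (derangements (Suc m)) + (real m + 1) * real (derangements m)"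
    by (simp add: m derangement_sum_def algebra_simps)
  also have "\<dots> = real (derangements n)"
    unfolding 1 2 by (simp add: algebra_simps)
  finally show ?thesis .
qed

text \<open>1/3 is a rational bound below the limit density 1/e. The recurrence
  \<open>derangements_Suc\<close> loses 1 in each step from even to odd, and the extra 1 at even
  \<open>n\<close>, multiplied by \<open>n + 1\<close>, pays for it.\<close>

lemma derangements_ge_aux:
  "n \<ge> 3 \<Longrightarrow> fact n / 3 + of_bool (even n) \<le> real (derangements n)"
proof (induction n rule: dec_induct)
  case base
  have "real (derangements 3) = 2"
    by (simp add: real_derangements eval_nat_numeral fact_numeral)
  then show ?case
    by (simp add: fact_numeral)
next
  case (step n)
  then have "real (Suc n) * (fact n / 3 + of_bool (even n)) \<le> real (Suc n) * real (derangements n)"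
    by (intro mult_left_mono) auto
  then show ?case
    using step.hyps unfolding derangements_Suc by (cases "even n") (auto simp: algebra_simps)
qed

lemma derangement_sum_ge:
  assumes "n \<ge> 3"
  shows "fact n \<le> 3 * (real n - 1) * real (derangement_sum (n - 1))"
proof -
  have "fact n \<le> 3 * real (derangements n)"
    using derangements_ge_aux[OF assms] by (cases "even n") auto
  also have "\<dots> = 3 * (real n - 1) * real (derangement_sum (n - 1))"
    using derangement_sum_recurrence[of n] assms by (simp only: mult.assoc)
  finally show ?thesis .
qed

section \<open>The symmetric group, and permutations or derangements with prescribed values\<close>

lemma Sym_comp: "\<sigma> \<in> Sym n \<Longrightarrow> \<pi> \<in> Sym n \<Longrightarrow> \<sigma> \<circ> \<pi> \<in> Sym n"
  by (simp add: Sym_def permutes_compose)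

lemma Sym_inv: "\<sigma> \<in> Sym n \<Longrightarrow> inv \<sigma> \<in> Sym n"
  by (simp add: Sym_def permutes_inv)

lemma Sym_in: "\<sigma> \<in> Sym n \<Longrightarrow> \<sigma> i \<in> {1..n} \<longleftrightarrow> i \<in> {1..n}"
  by (simp add: Sym_def permutes_in_image del: atLeastAtMost_iff)

lemma Sym_inverses: "\<sigma> \<in> Sym n \<Longrightarrow> \<sigma> (inv \<sigma> i) = i" "\<sigma> \<in> Sym n \<Longrightarrow> inv \<sigma> (\<sigma> i) = i"
  by (auto simp: Sym_def permutes_inverses)

lemma Sym_inj: "\<sigma> \<in> Sym n \<Longrightarrow> \<sigma> i = \<sigma> j \<longleftrightarrow> i = j"
  by (metis Sym_inverses(2))

lemma transpose_in_Sym: "i \<in> {1..n} \<Longrightarrow> j \<in> {1..n} \<Longrightarrow> transpose i j \<in> Sym n"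
  by (simp add: Sym_def permutes_swap_id del: atLeastAtMost_iff)

lemma bij_betw_Sym_comp_right: "\<tau> \<in> Sym n \<Longrightarrow> bij_betw (\<lambda>\<pi>. \<pi> \<circ> \<tau>) (Sym n) (Sym n)"
  by (rule bij_betw_byWitness[where f' = "\<lambda>\<pi>. \<pi> \<circ> inv \<tau>"])
    (auto simp: Sym_comp Sym_inv Sym_inverses fun_eq_iff)

lemma sum_Sym_comp_right: "\<tau> \<in> Sym n \<Longrightarrow> (\<Sum>\<pi>\<in>Sym n. g (\<pi> \<circ> \<tau>)) = (\<Sum>\<pi>\<in>Sym n. g \<pi>)"
  by (rule sum.reindex_bij_betw[OF bij_betw_Sym_comp_right])

text \<open>Composition with a permutation that sends \<open>j\<close> to \<open>i\<close> and
  \<open>j'\<close> to \<open>i'\<close> turns prescribed values into fixed points. The equivalence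
  in the hypotheses covers both a single coset, with \<open>i = i'\<close>, and two compatible
  ones.\<close>

lemma card_perm_two_cosets:
  assumes "i \<in> {1..n}" "j \<in> {1..n}" "i' \<in> {1..n}" "j' \<in> {1..n}" "i = i' \<longleftrightarrow> j = j'"
  shows "card {\<pi> \<in> Sym n. \<pi> i = j \<and> \<pi> i' = j'} = fact (n - card {i, i'})"
proof -
  \<comment> \<open>The inner transposition takes \<open>j\<close> to \<open>i\<close>; the outer
    one moves the image of \<open>j'\<close> to \<open>i'\<close> and keeps \<open>i\<close> in
    place.\<close>
  define \<tau> where "\<tau> = transpose (transpose j i j') i' \<circ> transpose j i"
  have \<tau>: "\<tau> \<in> Sym n"
    unfolding \<tau>_def using assms by (intro Sym_comp transpose_in_Sym) (auto simp: transpose_def)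
  have \<tau>v: "\<tau> j = i" "\<tau> j' = i'"
    using assms(5) by (auto simp: \<tau>_def transpose_def)
  have "bij_betw (\<lambda>\<pi>. \<tau> \<circ> \<pi>) {\<pi> \<in> Sym n. \<pi> i = j \<and> \<pi> i' = j'}
      {\<pi> \<in> Sym n. \<forall>x\<in>{i, i'}. \<pi> x = x}"
  proof (rule bij_betw_byWitness[where f' = "\<lambda>\<pi>. inv \<tau> \<circ> \<pi>"])
    show "(\<lambda>\<pi>. inv \<tau> \<circ> \<pi>) ` {\<pi> \<in> Sym n. \<forall>x\<in>{i, i'}. \<pi> x = x} \<subseteq> {\<pi> \<in> Sym n. \<pi> i = j \<and> \<pi> i' = j'}"
      using \<tau> by (auto simp: Sym_comp Sym_inv) (metis Sym_inverses(2) \<tau>v)+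
  qed (use \<tau> \<tau>v in \<open>auto simp: Sym_comp Sym_inv Sym_inverses fun_eq_iff\<close>)
  then have "card {\<pi> \<in> Sym n. \<pi> i = j \<and> \<pi> i' = j'} = card {\<pi> \<in> Sym n. \<forall>x\<in>{i, i'}. \<pi> x = x}"
    by (rule bij_betw_same_card)
  then show ?thesis
    using card_Sym_fixing[of "{i, i'}" n] assms by simp
qed

lemma card_perm_coset:
  assumes "i \<in> {1..n}" "j \<in> {1..n}"
  shows "card (perm_coset n i j) = fact (n - 1)"
  using card_perm_two_cosets[of i n j i j] assms by (simp add: perm_coset_def)

text \<open>Conjugation by the transposition of two values other than \<open>a\<close> preserves
  derangements, so all \<open>n - 1\<close> admissible values at \<open>a\<close> are equally
  frequent. By the recurrence each has \<open>derangement_sum (n - 1)\<close> derangements.\<close>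

lemma card_derangements_with_value:
  assumes a: "a \<in> {1..n}" and j: "j \<in> {1..n}" "j \<noteq> a"
  shows "card {\<tau> \<in> Sym n. (\<forall>i\<in>{1..n}. \<tau> i \<noteq> i) \<and> \<tau> a = j} = derangement_sum (n - 1)"
proof -
  define E where "E l = {\<tau> \<in> Sym n. (\<forall>i\<in>{1..n}. \<tau> i \<noteq> i) \<and> \<tau> a = l}" for l
  have le: "card (E l) = card (E j)" if l: "l \<in> {1..n} - {a}" for l
  proof -
    define t where "t = transpose l j"
    have t: "t \<in> Sym n" "t a = a" "t l = j" "t j = l"
      using l j by (auto simp: t_def intro!: transpose_in_Sym)
    have tt: "t (t x) = x" for x
      by (simp add: t_def)
    have tin: "t x \<in> {1..n} \<longleftrightarrow> x \<in> {1..n}" for x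
      using Sym_in[OF t(1)] .
    have der: "(t \<circ> \<tau> \<circ> t) i \<noteq> i" if "\<forall>i\<in>{1..n}. \<tau> i \<noteq> i" "i \<in> {1..n}" for \<tau> i
      using that tin tt by (metis comp_apply)
    have "bij_betw (\<lambda>\<tau>. t \<circ> \<tau> \<circ> t) (E l) (E j)"
      using t der unfolding E_def
      by (intro bij_betw_byWitness[where f' = "\<lambda>\<tau>. t \<circ> \<tau> \<circ> t"])
        (auto simp: Sym_comp tt fun_eq_iff)
    then show ?thesis
      by (rule bij_betw_same_card)
  qed
  have "n \<ge> 2"
    using a j by auto
  have "{\<tau> \<in> Sym n. \<forall>i\<in>{1..n}. \<tau> i \<noteq> i} = (\<Union>l\<in>{1..n} - {a}. E l)"
  proof (intro equalityI subsetI)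
    fix \<tau> assume \<tau>: "\<tau> \<in> {\<tau> \<in> Sym n. \<forall>i\<in>{1..n}. \<tau> i \<noteq> i}"
    then have "\<tau> a \<in> {1..n} - {a}"
      using a Sym_in[of \<tau> n a] by auto
    then show "\<tau> \<in> (\<Union>l\<in>{1..n} - {a}. E l)"
      using \<tau> by (auto simp: E_def)
  qed (auto simp: E_def)
  then have "derangements n = (\<Sum>l\<in>{1..n} - {a}. card (E l))"
    unfolding derangements_def
    by (subst card_UN_disjoint[symmetric]) (auto simp: E_def finite_Sym)
  also have "\<dots> = (n - 1) * card (E j)"
    using a le by simp
  finally have "(real n - 1) * real (card (E j)) = (real n - 1) * real (derangement_sum (n - 1))"
    using derangement_sum_recurrence[of n] \<open>n \<ge> 2\<close> by (simp add: of_nat_diff)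
  then have "real (card (E j)) = real (derangement_sum (n - 1))"
    using \<open>n \<ge> 2\<close> by simp
  then show ?thesis
    by (simp add: E_def)
qed

text \<open>Right composition with the inverse of \<open>\<sigma>\<close> turns permutations
  disjoint from \<open>\<sigma>\<close> into derangements, and the value \<open>j\<close> at
  \<open>i\<close> into the value \<open>j\<close> at \<open>\<sigma> i\<close>.\<close>

lemma sum_disjoint_coset:
  assumes "\<sigma> \<in> Sym n" "i \<in> {1..n}" "j \<in> {1..n}"
  shows "(\<Sum>\<pi>\<in>Sym n. of_bool (disjoint_perms n \<sigma> \<pi>) * of_bool (\<pi> i = j))
    = real (derangement_sum (n - 1)) * (1 - of_bool (\<sigma> i = j))"
proof (cases "\<sigma> i = j")
  case True
  then have "\<not> (disjoint_perms n \<sigma> \<pi> \<and> \<pi> i = j)" for \<pi>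
    using assms(2) unfolding disjoint_perms_def by metis
  then have "of_bool (disjoint_perms n \<sigma> \<pi>) * of_bool (\<pi> i = j) = (0 :: real)" for \<pi>
    by auto
  then show ?thesis
    using True by (simp only: sum.neutral_const) simp
next
  case False
  let ?E = "{\<tau> \<in> Sym n. (\<forall>l\<in>{1..n}. \<tau> l \<noteq> l) \<and> \<tau> (\<sigma> i) = j}"
  let ?A = "{\<pi> \<in> Sym n. disjoint_perms n \<sigma> \<pi> \<and> \<pi> i = j}"
  have "bij_betw (\<lambda>\<pi>. \<pi> \<circ> inv \<sigma>) ?A ?E"
  proof (rule bij_betw_byWitness[where f' = "\<lambda>\<tau>. \<tau> \<circ> \<sigma>"])
    show "(\<lambda>\<pi>. \<pi> \<circ> inv \<sigma>) ` ?A \<subseteq> ?E"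
    proof
      fix \<tau> assume "\<tau> \<in> (\<lambda>\<pi>. \<pi> \<circ> inv \<sigma>) ` ?A"
      then obtain \<pi> where \<pi>: "\<pi> \<in> Sym n" "disjoint_perms n \<sigma> \<pi>" "\<pi> i = j" "\<tau> = \<pi> \<circ> inv \<sigma>"
        by auto
      have "\<tau> l \<noteq> l" if "l \<in> {1..n}" for l
      proof -
        have "inv \<sigma> l \<in> {1..n}"
          using Sym_in[OF Sym_inv[OF assms(1)]] that by blast
        then have "\<sigma> (inv \<sigma> l) \<noteq> \<pi> (inv \<sigma> l)"
          using \<pi>(2) by (simp add: disjoint_perms_def)
        then show ?thesis
          using \<pi>(4) assms(1) by (simp add: Sym_inverses)
      qed
      then show "\<tau> \<in> ?E"
        using \<pi> assms by (simp add: Sym_comp Sym_inv Sym_inverses)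
    qed
    show "(\<lambda>\<tau>. \<tau> \<circ> \<sigma>) ` ?E \<subseteq> ?A"
    proof
      fix \<pi> assume "\<pi> \<in> (\<lambda>\<tau>. \<tau> \<circ> \<sigma>) ` ?E"
      then obtain \<tau> where \<tau>: "\<tau> \<in> ?E" "\<pi> = \<tau> \<circ> \<sigma>"
        by auto
      have "\<pi> l \<noteq> \<sigma> l" if "l \<in> {1..n}" for l
        using \<tau> Sym_in[OF assms(1), of l] that by simp
      then have "disjoint_perms n \<sigma> \<pi>"
        unfolding disjoint_perms_def by metis
      then show "\<pi> \<in> ?A"
        using \<tau> assms by (simp add: Sym_comp)
    qed
  qed (use assms in \<open>auto simp: fun_eq_iff Sym_inverses\<close>)
  then have "card ?A = card ?E"
    by (rule bij_betw_same_card)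
  also have "\<dots> = derangement_sum (n - 1)"
    using assms False Sym_in[of \<sigma> n i] by (intro card_derangements_with_value) auto
  finally show ?thesis
    using False
    by (simp add: sum_of_bool_card[OF finite_Sym] flip: of_bool_conj)
qed

lemma sum_Sym_linear:
  assumes "\<pi> \<in> Sym n" "finite S" "{1..n} \<subseteq> S"
  shows "(\<Sum>i\<in>{1..n}. y i (\<pi> i)) = (\<Sum>i\<in>{1..n}. \<Sum>j\<in>S. of_bool (\<pi> i = j) * y i j :: real)"
proof (intro sum.cong refl)
  fix i assume "i \<in> {1..n}"
  then have "\<pi> i \<in> S"
    using assms Sym_in by blast
  then show "y i (\<pi> i) = (\<Sum>j\<in>S. of_bool (\<pi> i = j) * y i j)"
    using assms by (simp add: sum_delta_of_bool)
qed

text \<open>If the coefficients \<open>y\<close> have total 0, the function is an eigenvector with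
  eigenvalue \<open>- derangement_sum (n - 1)\<close>, which the bound for the orthogonal remainder
  has to beat.\<close>

lemma sum_disjoint_linear:
  assumes "\<sigma> \<in> Sym n"
  shows "(\<Sum>\<pi>\<in>Sym n. of_bool (disjoint_perms n \<sigma> \<pi>) * (\<Sum>i\<in>{1..n}. y i (\<pi> i)))
    = real (derangement_sum (n - 1)) * ((\<Sum>i\<in>{1..n}. \<Sum>j\<in>{1..n}. y i j) - (\<Sum>i\<in>{1..n}. y i (\<sigma> i)))"
proof -
  let ?D = "real (derangement_sum (n - 1))"
  have "(\<Sum>\<pi>\<in>Sym n. of_bool (disjoint_perms n \<sigma> \<pi>) * (\<Sum>i\<in>{1..n}. y i (\<pi> i)))
      = (\<Sum>\<pi>\<in>Sym n. \<Sum>i\<in>{1..n}. \<Sum>j\<in>{1..n}. y i j * (of_bool (disjoint_perms n \<sigma> \<pi>) * of_bool (\<pi> i = j)))"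
    by (intro sum.cong refl)
      (simp only: sum_Sym_linear[OF _ finite_atLeastAtMost order_refl] sum_distrib_left mult_ac)
  also have "\<dots> = (\<Sum>i\<in>{1..n}. \<Sum>\<pi>\<in>Sym n. \<Sum>j\<in>{1..n}. y i j * (of_bool (disjoint_perms n \<sigma> \<pi>) * of_bool (\<pi> i = j)))"
    by (rule sum.swap)
  also have "\<dots> = (\<Sum>i\<in>{1..n}. \<Sum>j\<in>{1..n}. \<Sum>\<pi>\<in>Sym n. y i j * (of_bool (disjoint_perms n \<sigma> \<pi>) * of_bool (\<pi> i = j)))"
    by (intro sum.cong refl sum.swap)
  also have "\<dots> = (\<Sum>i\<in>{1..n}. \<Sum>j\<in>{1..n}. ?D * y i j - ?D * (of_bool (\<sigma> i = j) * y i j))"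
    by (intro sum.cong refl)
      (simp only: sum_distrib_left[symmetric] sum_disjoint_coset[OF assms], simp add: algebra_simps)
  also have "\<dots> = ?D * ((\<Sum>i\<in>{1..n}. \<Sum>j\<in>{1..n}. y i j) - (\<Sum>i\<in>{1..n}. y i (\<sigma> i)))"
    by (simp only: sum_subtractf sum_distrib_left[symmetric]
        sum_Sym_linear[OF assms finite_atLeastAtMost order_refl, of y] right_diff_distrib)
  finally show ?thesis .
qed

section \<open>Disjoint pairs in the lexicographic initial segment\<close>

abbreviation disjoint_form :: "nat \<Rightarrow> ((nat \<Rightarrow> nat) \<Rightarrow> real) \<Rightarrow> real" where
  "disjoint_form n h \<equiv> quad_form (Sym n) h (\<lambda>\<sigma> \<pi>. of_bool (disjoint_perms n \<sigma> \<pi>))"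

lemma disjoint_perms_commute: "disjoint_perms n \<sigma> \<pi> \<longleftrightarrow> disjoint_perms n \<pi> \<sigma>"
  by (auto simp: disjoint_perms_def)

text \<open>The form counts ordered pairs, hence the factor 2. For \<open>n \<ge> 1\<close> no
  permutation is disjoint from itself, so every unordered pair really has two orderings.\<close>

lemma disjoint_form_indicator:
  assumes "n \<ge> 1" "F \<subseteq> Sym n"
  shows "disjoint_form n (\<lambda>\<pi>. of_bool (\<pi> \<in> F)) = 2 * real (dp n F)"
proof -
  define R where "R = {(\<sigma>, \<pi>). \<sigma> \<in> F \<and> \<pi> \<in> F \<and> disjoint_perms n \<sigma> \<pi>}"
  define g :: "(nat \<Rightarrow> nat) \<times> (nat \<Rightarrow> nat) \<Rightarrow> (nat \<Rightarrow> nat) set" where "g = (\<lambda>(\<sigma>, \<pi>). {\<sigma>, \<pi>})"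
  have finF: "finite F"
    using assms(2) finite_Sym finite_subset by blast
  have finR: "finite R"
    by (rule finite_subset[of _ "F \<times> F"]) (auto simp: R_def finF)
  have fibre: "card {p \<in> R. g p = e} = 2" if e: "e \<in> g ` R" for e
  proof -
    obtain \<sigma> \<pi> where p: "(\<sigma>, \<pi>) \<in> R" "e = {\<sigma>, \<pi>}"
      using e by (auto simp: g_def)
    then have "\<sigma> \<noteq> \<pi>"
      using assms(1) by (auto simp: R_def disjoint_perms_def)
    moreover have "{q \<in> R. g q = e} = {(\<sigma>, \<pi>), (\<pi>, \<sigma>)}"
      using p by (auto simp: R_def g_def doubleton_eq_iff disjoint_perms_commute)
    ultimately show ?thesis
      by simp
  qed
  have "disjoint_form n (\<lambda>\<pi>. of_bool (\<pi> \<in> F))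
      = (\<Sum>\<sigma>\<in>F. \<Sum>\<pi>\<in>F. of_bool (disjoint_perms n \<sigma> \<pi>))"
    unfolding quad_form_def
  proof (rule sum.mono_neutral_cong_right[OF finite_Sym assms(2)])
    fix \<sigma> assume "\<sigma> \<in> F"
    then show "(\<Sum>\<pi>\<in>Sym n. of_bool (\<sigma> \<in> F) * of_bool (\<pi> \<in> F) * of_bool (disjoint_perms n \<sigma> \<pi>))
        = (\<Sum>\<pi>\<in>F. of_bool (disjoint_perms n \<sigma> \<pi>) :: real)"
      by (intro sum.mono_neutral_cong_right[OF finite_Sym assms(2)]) auto
  qed simp
  also have "\<dots> = (\<Sum>p\<in>F \<times> F. of_bool (p \<in> R))"
    by (auto simp: sum.cartesian_product R_def intro!: sum.cong)
  also have "\<dots> = real (card R)"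
    using finF by (subst sum.mono_neutral_cong_right[where S = R and h = "\<lambda>_. 1"]) (auto simp: R_def)
  also have "card R = (\<Sum>e\<in>g ` R. \<Sum>p\<in>{p \<in> R. g p = e}. 1)"
    by (subst sum.image_gen[OF finR, symmetric]) simp
  also have "\<dots> = 2 * card (g ` R)"
    using fibre by simp
  also have "g ` R = {{\<sigma>, \<pi>} |\<sigma> \<pi>. \<sigma> \<in> F \<and> \<pi> \<in> F \<and> disjoint_perms n \<sigma> \<pi>}"
    by (force simp: R_def g_def)
  finally show ?thesis
    by (simp add: dp_def)
qed

text \<open>The cross terms are grouped so that, outside the form of \<open>h\<close>, the kernel is
  applied to \<open>u\<close> only, where its action is explicit, and \<open>u + h\<close> can be
  replaced by an indicator.\<close>

lemma quad_form_split_sym: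
  assumes "\<And>\<sigma> \<pi>. K \<sigma> \<pi> = K \<pi> \<sigma>"
  shows "quad_form \<Omega> (\<lambda>\<pi>. u \<pi> + h \<pi>) K
    = (\<Sum>\<sigma>\<in>\<Omega>. (u \<sigma> + h \<sigma>) * (\<Sum>\<pi>\<in>\<Omega>. K \<sigma> \<pi> * u \<pi>))
      + (\<Sum>\<sigma>\<in>\<Omega>. h \<sigma> * (\<Sum>\<pi>\<in>\<Omega>. K \<sigma> \<pi> * u \<pi>)) + quad_form \<Omega> h K"
proof -
  have "(\<Sum>\<sigma>\<in>\<Omega>. \<Sum>\<pi>\<in>\<Omega>. u \<sigma> * (K \<sigma> \<pi> * h \<pi>)) = (\<Sum>\<sigma>\<in>\<Omega>. \<Sum>\<pi>\<in>\<Omega>. h \<sigma> * (K \<sigma> \<pi> * u \<pi>))"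
    by (subst sum.swap, intro sum.cong refl) (subst assms, simp)
  moreover have "quad_form \<Omega> (\<lambda>\<pi>. u \<pi> + h \<pi>) K
      = (\<Sum>\<sigma>\<in>\<Omega>. \<Sum>\<pi>\<in>\<Omega>. (u \<sigma> + h \<sigma>) * (K \<sigma> \<pi> * u \<pi>))
        + (\<Sum>\<sigma>\<in>\<Omega>. \<Sum>\<pi>\<in>\<Omega>. u \<sigma> * (K \<sigma> \<pi> * h \<pi>)) + quad_form \<Omega> h K"
    unfolding quad_form_def sum.distrib[symmetric]
    by (intro sum.cong refl) (simp add: algebra_simps)
  ultimately show ?thesis
    by (simp only: sum_distrib_left)
qed

text \<open>The order compares the values at 1 first, so the cosets of row 1 are consecutive blocks
  of \<open>fact (n - 1)\<close> permutations.\<close>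

lemma card_lex_before:
  assumes "\<pi> \<in> Sym n" "n \<ge> 1"
  shows "(\<pi> 1 - 1) * fact (n - 1) \<le> card {\<sigma> \<in> Sym n. lex_less n \<sigma> \<pi>}"
    and "card {\<sigma> \<in> Sym n. lex_less n \<sigma> \<pi>} < \<pi> 1 * fact (n - 1)"
proof -
  have disj: "card (\<Union>j\<in>{1..l}. perm_coset n 1 j) = l * fact (n - 1)" if "l \<le> n" for l
    using that assms(2)
    by (subst card_UN_disjoint) (auto simp: perm_coset_def finite_Sym card_perm_coset[unfolded perm_coset_def])
  have \<pi>1: "1 \<le> \<pi> 1" "\<pi> 1 \<le> n"
    using Sym_in[OF assms(1), of 1] assms(2) by auto
  have "card (\<Union>j\<in>{1..\<pi> 1 - 1}. perm_coset n 1 j) \<le> card {\<sigma> \<in> Sym n. lex_less n \<sigma> \<pi>}"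
  proof (rule card_mono)
    show "(\<Union>j\<in>{1..\<pi> 1 - 1}. perm_coset n 1 j) \<subseteq> {\<sigma> \<in> Sym n. lex_less n \<sigma> \<pi>}"
      using assms(2) \<pi>1 by (auto simp: perm_coset_def lex_less_def intro!: bexI[of _ 1])
  qed (simp add: finite_Sym)
  then show "(\<pi> 1 - 1) * fact (n - 1) \<le> card {\<sigma> \<in> Sym n. lex_less n \<sigma> \<pi>}"
    using \<pi>1 by (subst (asm) disj) auto
  have "\<sigma> 1 \<le> \<pi> 1" if less: "lex_less n \<sigma> \<pi>" for \<sigma>
  proof -
    obtain m where "m \<in> {1..n}" "\<sigma> m < \<pi> m" "\<forall>i\<in>{1..<m}. \<sigma> i = \<pi> i"
      using less by (auto simp: lex_less_def)
    then show ?thesis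
      by (cases "m = 1") auto
  qed
  then have "{\<sigma> \<in> Sym n. lex_less n \<sigma> \<pi>} \<subset> (\<Union>j\<in>{1..\<pi> 1}. perm_coset n 1 j)"
    using assms \<pi>1 Sym_in[of _ n 1] lex_less_irrefl[of n \<pi>] by (fastforce simp: perm_coset_def)
  then have "card {\<sigma> \<in> Sym n. lex_less n \<sigma> \<pi>} < card (\<Union>j\<in>{1..\<pi> 1}. perm_coset n 1 j)"
    by (intro psubset_card_mono) (auto simp: perm_coset_def finite_Sym)
  then show "card {\<sigma> \<in> Sym n. lex_less n \<sigma> \<pi>} < \<pi> 1 * fact (n - 1)"
    using \<pi>1 by (subst (asm) disj) auto
qed

text \<open>The segment consists of the first \<open>m\<close> cosets of row 1, with indicator
  \<open>u\<close>, and a part of the next one, with indicator \<open>x\<close>. Members of that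
  part agree at 1, so the form of \<open>x\<close> vanishes; the disjointness matrix acts on
  \<open>u\<close> explicitly.\<close>

lemma dp_lex_initial:
  assumes "m + 1 \<le> n" "m * fact (n - 1) \<le> s" "s \<le> (m + 1) * fact (n - 1)"
  shows "2 * real (dp n (lex_initial n s))
    = real (derangement_sum (n - 1)) * (2 * real m * real s - real m * (real m + 1) * fact (n - 1))"
proof -
  let ?D = "real (derangement_sum (n - 1))" and ?K = "\<lambda>\<sigma> \<pi>. of_bool (disjoint_perms n \<sigma> \<pi>) :: real"
  define T where "T = lex_initial n s"
  define u :: "(nat \<Rightarrow> nat) \<Rightarrow> real" where "u \<pi> = (\<Sum>j\<in>{1..m}. of_bool (\<pi> 1 = j))" for \<pi>
  define x :: "(nat \<Rightarrow> nat) \<Rightarrow> real" where "x \<pi> = of_bool (\<pi> \<in> T \<and> \<pi> 1 = m + 1)" for \<pi>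
  have n: "n \<ge> 1"
    using assms(1) by simp
  have T: "T \<subseteq> Sym n"
    by (auto simp: T_def lex_initial_def)
  have full: "\<pi> \<in> T" if "\<pi> \<in> Sym n" "\<pi> 1 \<le> m" for \<pi>
  proof -
    have "\<pi> 1 * fact (n - 1) \<le> m * fact (n - 1)"
      using that by (intro mult_right_mono) auto
    then have "card {\<sigma> \<in> Sym n. lex_less n \<sigma> \<pi>} < s"
      using card_lex_before(2)[OF that(1) n] assms(2) by linarith
    then show ?thesis
      using that(1) by (simp add: T_def lex_initial_def)
  qed
  have le: "\<pi> 1 \<le> m + 1" if "\<pi> \<in> T" for \<pi>
  proof (rule ccontr)
    assume "\<not> \<pi> 1 \<le> m + 1"
    then have "(m + 1) * fact (n - 1) \<le> (\<pi> 1 - 1) * fact (n - 1)"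
      by (intro mult_right_mono) auto
    moreover have "\<pi> \<in> Sym n" "card {\<sigma> \<in> Sym n. lex_less n \<sigma> \<pi>} < s"
      using that by (auto simp: T_def lex_initial_def)
    ultimately show False
      using card_lex_before(1)[of \<pi> n] n assms(3) by linarith
  qed
  have u: "u \<pi> = of_bool (\<pi> 1 \<le> m)" if "\<pi> \<in> Sym n" for \<pi>
    unfolding u_def using sum_delta_of_bool[of "{1..m}" "\<pi> 1" "\<lambda>_. 1"] Sym_in[OF that, of 1] n by auto
  have f: "of_bool (\<pi> \<in> T) = u \<pi> + x \<pi>" if "\<pi> \<in> Sym n" for \<pi>
    using u[OF that] full[OF that] le[of \<pi>] by (auto simp: x_def)
  have "card T = s"
  proof -
    have "s \<le> n * fact (n - 1)"
      using assms(1,3) by (meson mult_le_mono1 order_trans)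
    then show ?thesis
      unfolding T_def using n by (intro card_lex_initial) (simp add: fact_reduce)
  qed
  then have sumT: "(\<Sum>\<sigma>\<in>Sym n. u \<sigma> + x \<sigma>) = real s"
    using T by (simp add: f[symmetric] of_bool_def sum.inter_filter[OF finite_Sym, symmetric] Int_absorb1 Collect_conj_eq)
  have sumu: "(\<Sum>\<sigma>\<in>Sym n. u \<sigma>) = real m * fact (n - 1)"
  proof -
    have "(\<Sum>\<sigma>\<in>Sym n. u \<sigma>) = (\<Sum>j\<in>{1..m}. real (card (perm_coset n 1 j)))"
      unfolding u_def
      by (subst sum.swap) (simp add: of_bool_def sum.inter_filter[OF finite_Sym, symmetric] perm_coset_def)
    then show ?thesis
      using assms(1) by (simp add: card_perm_coset)
  qed
  have Ku: "(\<Sum>\<pi>\<in>Sym n. ?K \<sigma> \<pi> * u \<pi>) = ?D * (real m - u \<sigma>)" if "\<sigma> \<in> Sym n" for \<sigma>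
  proof -
    have "(\<Sum>\<pi>\<in>Sym n. ?K \<sigma> \<pi> * u \<pi>) = (\<Sum>j\<in>{1..m}. \<Sum>\<pi>\<in>Sym n. ?K \<sigma> \<pi> * of_bool (\<pi> 1 = j))"
      unfolding u_def sum_distrib_left by (rule sum.swap)
    also have "\<dots> = (\<Sum>j\<in>{1..m}. ?D * (1 - of_bool (\<sigma> 1 = j)))"
      using that assms(1) n by (intro sum.cong refl sum_disjoint_coset) auto
    finally show ?thesis
      by (simp add: u_def sum_distrib_left[symmetric] sum_subtractf)
  qed
  have "quad_form (Sym n) x ?K = 0"
    unfolding quad_form_def using n
    by (intro sum.neutral ballI) (auto simp: x_def disjoint_perms_def intro!: bexI[of _ 1])
  then have "disjoint_form n (\<lambda>\<pi>. u \<pi> + x \<pi>)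
      = (\<Sum>\<sigma>\<in>Sym n. (u \<sigma> + x \<sigma>) * (?D * (real m - u \<sigma>))) + (\<Sum>\<sigma>\<in>Sym n. x \<sigma> * (?D * (real m - u \<sigma>)))"
    by (subst quad_form_split_sym) (simp_all add: Ku disjoint_perms_commute)
  also have "\<dots> = (\<Sum>\<sigma>\<in>Sym n. ?D * (2 * real m * (u \<sigma> + x \<sigma>) - (real m + 1) * u \<sigma>))"
    unfolding sum.distrib[symmetric]
    by (intro sum.cong refl) (auto simp: u x_def of_bool_def algebra_simps)
  also have "\<dots> = ?D * (2 * real m * real s - (real m + 1) * (real m * fact (n - 1)))"
    by (simp only: sum_distrib_left[symmetric] sum_subtractf sumT sumu)
  finally have "disjoint_form n (\<lambda>\<pi>. u \<pi> + x \<pi>) = \<dots>" .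
  moreover have "disjoint_form n (\<lambda>\<pi>. u \<pi> + x \<pi>) = 2 * real (dp n T)"
    unfolding disjoint_form_indicator[OF n T, symmetric] quad_form_def
    by (intro sum.cong refl) (simp add: f)
  ultimately show ?thesis
    by (simp add: T_def mult_ac)
qed

section \<open>Affine functions on the cube that are nearly Boolean\<close>

definition int_dist :: "real \<Rightarrow> real" where
  "int_dist x = \<bar>x - of_int (round x)\<bar>"

lemma int_dist_le_half: "int_dist x \<le> 1 / 2"
  unfolding int_dist_def using of_int_round_abs_le[of x] by linarith

lemma int_dist_le: "int_dist x \<le> \<bar>x - of_int m\<bar>"
  unfolding int_dist_def by (rule round_diff_minimal)

lemma int_dist_nonneg: "0 \<le> int_dist x"
  by (simp add: int_dist_def)

lemma one_minus_cos_two_pi_le: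
  "1 - cos (2 * pi * x) \<le> 32 * (x - of_int m)\<^sup>2"
proof -
  define d where "d = x - of_int m"
  have "cos (2 * pi * x) = cos (2 * pi * d + 2 * pi * of_int m)"
    by (simp add: d_def algebra_simps)
  also have "\<dots> = cos (2 * (pi * d))"
    unfolding cos_add cos_int_2pin sin_int_2pin by (simp add: mult.assoc)
  also have "\<dots> = 1 - 2 * (sin (pi * d))\<^sup>2"
    by (rule cos_double_sin)
  finally have "1 - cos (2 * pi * x) = 2 * (sin (pi * d))\<^sup>2"
    by simp
  also have "\<dots> \<le> 2 * (4 * d)\<^sup>2"
  proof -
    have "\<bar>sin (pi * d)\<bar> \<le> \<bar>pi * d\<bar>"
      by (rule abs_sin_x_le_abs_x)
    also have "\<dots> \<le> \<bar>4 * d\<bar>"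
      unfolding abs_mult using pi_less_4 by (intro mult_right_mono) auto
    finally show ?thesis
      by (simp add: abs_le_square_iff)
  qed
  finally show ?thesis
    unfolding d_def[symmetric] by (simp add: power_mult_distrib)
qed

lemma cos_pi_sq_le: "(cos (pi * x))\<^sup>2 \<le> 1 - (int_dist x)\<^sup>2 / 4"
proof -
  define d where "d = x - of_int (round x)"
  have d: "\<bar>d\<bar> \<le> 1 / 2" "int_dist x = \<bar>d\<bar>"
    using int_dist_le_half[of x] by (simp_all add: d_def int_dist_def)
  have half: "\<bar>d\<bar> / 2 \<le> \<bar>sin (pi * d)\<bar>"
  proof (cases "d = 0")
    case False
    define r where "r = \<bar>d\<bar>"
    have r: "0 < r" "r \<le> 1 / 2"
      using False d by (auto simp: r_def)
    \<comment> \<open>On [0, 1/2], which lies in [0, pi/3], the cosine is at least 1/2, so the sine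
      of r is at least r / 2. Monotonicity then passes from r to pi * r, which is at most pi /
      2.\<close>
    obtain t where t: "0 < t" "t < r" "sin r - sin 0 = (r - 0) * cos t"
      using MVT2[of 0 r sin cos] r(1) by (auto intro: derivative_eq_intros)
    have "cos (pi / 3) \<le> cos t"
      using t r pi_ge_two by (intro cos_monotone_0_pi_le) auto
    then have "r * (1 / 2) \<le> r * cos t"
      using r by (intro mult_left_mono) (auto simp: cos_60)
    also have "\<dots> = sin r"
      using t by simp
    also have "sin r \<le> sin (pi * r)"
    proof (rule sin_monotone_2pi_le)
      have "1 * r \<le> pi * r"
        using r pi_ge_two by (intro mult_right_mono) auto
      then show "r \<le> pi * r"
        by simp
      have "pi * r \<le> pi * (1 / 2)"
        using r by (intro mult_left_mono) auto
      then show "pi * r \<le> pi / 2"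
        by simp
    qed (use r pi_ge_two in auto)
    finally show ?thesis
      by (cases "d \<ge> 0") (auto simp: r_def)
  qed simp
  have "2 * (pi * x) = 2 * (pi * d) + 2 * pi * of_int (round x)"
    by (simp add: d_def algebra_simps)
  then have "cos (2 * (pi * x)) = cos (2 * (pi * d) + 2 * pi * of_int (round x))"
    by (rule arg_cong)
  also have "\<dots> = cos (2 * (pi * d))"
    unfolding cos_add cos_int_2pin sin_int_2pin by (simp add: mult.assoc)
  finally have "2 * (cos (pi * x))\<^sup>2 = 2 - 2 * (sin (pi * d))\<^sup>2"
    using cos_double_cos[of "pi * x"] cos_double_sin[of "pi * d"] by linarith
  moreover have "(d / 2)\<^sup>2 \<le> (sin (pi * d))\<^sup>2"
    using half by (subst abs_le_square_iff[symmetric]) simp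
  ultimately show ?thesis
    using d by (simp add: power_divide)
qed

lemma sum_Pow_insert:
  fixes g :: "'a set \<Rightarrow> real"
  assumes "finite P" "p \<notin> P"
  shows "(\<Sum>A\<in>Pow (insert p P). g A) = (\<Sum>A\<in>Pow P. g A + g (insert p A))"
proof -
  have "inj_on (insert p) (Pow P)"
    using assms(2) by (auto simp: inj_on_def)
  then show ?thesis
    unfolding Pow_insert using assms
    by (subst sum.union_disjoint) (auto simp: sum.reindex sum.distrib)
qed

text \<open>For a uniformly random subset \<open>A\<close> the variance of the affine function is
  the sum of \<open>(z p)\<^sup>2 / 4\<close>, and a second moment is at least the variance.\<close>

lemma sum_Pow_affine_sq_ge:
  fixes z :: "'a \<Rightarrow> real"
  assumes "finite P"
  shows "2 ^ card P * (\<Sum>p\<in>P. (z p)\<^sup>2) / 4 \<le> (\<Sum>A\<in>Pow P. (c + (\<Sum>p\<in>A. z p))\<^sup>2)"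
  using assms
proof (induction P arbitrary: c rule: finite_induct)
  case (insert p P)
  have "(\<Sum>A\<in>Pow (insert p P). (c + (\<Sum>p\<in>A. z p))\<^sup>2)
      = (\<Sum>A\<in>Pow P. (c + (\<Sum>p\<in>A. z p))\<^sup>2 + (c + (z p + (\<Sum>p\<in>A. z p)))\<^sup>2)"
    using insert.hyps finite_subset[OF _ insert.hyps(1)]
    by (subst sum_Pow_insert[OF insert.hyps])
      (intro sum.cong refl arg_cong2[of _ _ _ _ "(+)"] arg_cong[of _ _ "\<lambda>x. x\<^sup>2"] sum.insert, auto)
  also have "\<dots> = (\<Sum>A\<in>Pow P. 2 * ((c + z p / 2) + (\<Sum>p\<in>A. z p))\<^sup>2 + (z p)\<^sup>2 / 2)"
    by (intro sum.cong refl) (simp add: power2_eq_square field_simps)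
  also have "\<dots> = 2 * (\<Sum>A\<in>Pow P. ((c + z p / 2) + (\<Sum>p\<in>A. z p))\<^sup>2) + 2 ^ card P * ((z p)\<^sup>2 / 2)"
    using insert.hyps by (simp add: sum.distrib sum_distrib_left card_Pow)
  also have "\<dots> \<ge> 2 * (2 ^ card P * (\<Sum>p\<in>P. (z p)\<^sup>2) / 4) + 2 ^ card P * ((z p)\<^sup>2 / 2)"
    using insert.IH[of "c + z p / 2"] by simp
  also have "2 * (2 ^ card P * (\<Sum>p\<in>P. (z p)\<^sup>2) / 4) + 2 ^ card P * ((z p)\<^sup>2 / 2)
      = 2 ^ card (insert p P) * (\<Sum>p\<in>insert p P. (z p)\<^sup>2) / 4"
    using insert.hyps by (simp add: field_simps)
  finally show ?case .
qed simp

text \<open>The sum factors over the coordinates. The angles are doubled because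
  \<open>cis (2 * x) + 1\<close> has modulus 2 |cos x|.\<close>

lemma cmod_sum_Pow_cis:
  fixes z :: "'a \<Rightarrow> real"
  assumes "finite P"
  shows "(cmod (\<Sum>A\<in>Pow P. cis (c + (\<Sum>p\<in>A. 2 * z p))))\<^sup>2 = (2 ^ card P)\<^sup>2 * (\<Prod>p\<in>P. (cos (z p))\<^sup>2)"
proof -
  have prod_cis: "(\<Prod>p\<in>A. cis (2 * z p)) = cis (\<Sum>p\<in>A. 2 * z p)" for A
    by (induction A rule: infinite_finite_induct) (simp_all add: cis_mult)
  have "(\<Sum>A\<in>Pow P. cis (c + (\<Sum>p\<in>A. 2 * z p))) = cis c * (\<Prod>p\<in>P. cis (2 * z p) + 1)"
    by (simp add: prod_add[OF assms] prod_cis sum_distrib_left cis_mult)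
  moreover have "(cmod (cis (2 * x) + 1))\<^sup>2 = 4 * (cos x)\<^sup>2" for x
  proof -
    have "(cmod (cis (2 * x) + 1))\<^sup>2 = (cos (2 * x) + 1)\<^sup>2 + (sin (2 * x))\<^sup>2"
      by (simp add: cmod_power2)
    also have "\<dots> = 2 + 2 * cos (2 * x)"
      using sin_cos_squared_add[of "2 * x"] by (simp add: power2_sum)
    finally show ?thesis
      by (simp add: cos_double_cos)
  qed
  ultimately have "(cmod (\<Sum>A\<in>Pow P. cis (c + (\<Sum>p\<in>A. 2 * z p))))\<^sup>2 = (\<Prod>p\<in>P. 4 * (cos (z p))\<^sup>2)"
    by (simp add: norm_mult prod_norm[symmetric] prod_power_distrib)
  also have "\<dots> = (2 ^ card P)\<^sup>2 * (\<Prod>p\<in>P. (cos (z p))\<^sup>2)"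
    by (simp add: prod.distrib power_mult[symmetric] mult.commute[of _ 2]) (simp add: power_mult)
  finally show ?thesis .
qed

text \<open>A quantitative Friedgut-Kalai-Naor theorem. The mean over the cube of the character
  \<open>exp (2 \<pi> \<i> l)\<close>, where \<open>l\<close> is the affine function, is close to 1, and it factors over the
  coordinates.\<close>

lemma affine_near_boolean:
  fixes z :: "'a \<Rightarrow> real"
  assumes fin: "finite P"
  shows "2 ^ card P * (\<Sum>p\<in>P. (int_dist (z p))\<^sup>2)
    \<le> 512 * (\<Sum>A\<in>Pow P. (of_bool (b A) - (c + (\<Sum>p\<in>A. z p)))\<^sup>2)"
proof -
  define N :: real where "N = 2 ^ card P"
  define l where "l A = c + (\<Sum>p\<in>A. z p)" for A
  define \<gamma> where "\<gamma> = (\<Sum>A\<in>Pow P. (of_bool (b A) - l A)\<^sup>2) / N"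
  define S where "S = (\<Sum>p\<in>P. (int_dist (z p))\<^sup>2)"
  have N: "N > 0" "(\<Sum>A\<in>Pow P. 1) = N"
    using fin by (auto simp: N_def card_Pow)
  have W: "(\<Sum>A\<in>Pow P. (of_bool (b A) - l A)\<^sup>2) = N * \<gamma>"
    using N by (simp add: \<gamma>_def)
  have \<gamma>0: "\<gamma> \<ge> 0"
    unfolding \<gamma>_def using N by (intro divide_nonneg_pos sum_nonneg) auto
  have S0: "S \<ge> 0"
    unfolding S_def by (intro sum_nonneg) auto
  have "S \<le> 512 * \<gamma>"
  \<comment> \<open>The threshold ensures \<open>1 - 64 * \<gamma> \<ge> 1 / 2\<close>. Then (1 - 64
    \<gamma>)(1 + S / 4) \<le> 1 yields S / 8 \<le> 64 \<gamma>, which is where 512 comes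
    from.\<close>
  proof (cases "\<gamma> \<le> 1 / 128")
    case True
    let ?s = "\<Sum>A\<in>Pow P. cis (2 * pi * c + (\<Sum>p\<in>A. 2 * (pi * z p)))"
    have "N - 32 * (N * \<gamma>) = (\<Sum>A\<in>Pow P. 1 - 32 * (of_bool (b A) - l A)\<^sup>2)"
      using N(2) W by (simp add: sum_subtractf sum_distrib_left[symmetric])
    also have "\<dots> \<le> (\<Sum>A\<in>Pow P. cos (2 * pi * l A))"
    proof (rule sum_mono)
      fix A
      show "1 - 32 * (of_bool (b A) - l A)\<^sup>2 \<le> cos (2 * pi * l A)"
        using one_minus_cos_two_pi_le[of "l A" "of_bool (b A)"] by (simp add: power2_commute)
    qed
    also have "\<dots> = Re ?s"
      by (simp add: l_def sum_distrib_left distrib_left mult.assoc)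
    also have "\<dots> \<le> cmod ?s"
      by (rule complex_Re_le_cmod)
    finally have "(N - 32 * (N * \<gamma>))\<^sup>2 \<le> (cmod ?s)\<^sup>2"
      using True N by (intro power_mono) auto
    also have "\<dots> = N\<^sup>2 * (\<Prod>p\<in>P. (cos (pi * z p))\<^sup>2)"
      unfolding N_def by (rule cmod_sum_Pow_cis[OF fin])
    also have "\<dots> \<le> N\<^sup>2 * (\<Prod>p\<in>P. exp (- ((int_dist (z p))\<^sup>2 / 4)))"
    proof (intro mult_left_mono prod_mono)
      fix p
      have "(cos (pi * z p))\<^sup>2 \<le> 1 + - ((int_dist (z p))\<^sup>2 / 4)"
        using cos_pi_sq_le[of "z p"] by simp
      also have "\<dots> \<le> exp (- ((int_dist (z p))\<^sup>2 / 4))"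
        by (rule exp_ge_add_one_self)
      finally show "0 \<le> (cos (pi * z p))\<^sup>2 \<and> (cos (pi * z p))\<^sup>2 \<le> exp (- ((int_dist (z p))\<^sup>2 / 4))"
        by simp
    qed auto
    also have "\<dots> = N\<^sup>2 * exp (- (S / 4))"
      using fin by (simp add: exp_sum[symmetric] S_def sum_negf sum_divide_distrib)
    finally have "N\<^sup>2 * (1 - 32 * \<gamma>)\<^sup>2 \<le> N\<^sup>2 * exp (- (S / 4))"
      by (simp add: power2_eq_square algebra_simps)
    then have "(1 - 32 * \<gamma>)\<^sup>2 \<le> exp (- (S / 4))"
      using N by simp
    moreover have "1 - 64 * \<gamma> \<le> (1 - 32 * \<gamma>)\<^sup>2"
      by (simp add: power2_diff)
    ultimately have "1 - 64 * \<gamma> \<le> exp (- (S / 4))"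
      by linarith
    then have "(1 - 64 * \<gamma>) * exp (S / 4) \<le> exp (- (S / 4)) * exp (S / 4)"
      by (intro mult_right_mono) auto
    then have "(1 - 64 * \<gamma>) * exp (S / 4) \<le> 1"
      by (simp add: exp_add[symmetric])
    moreover have "(1 - 64 * \<gamma>) * (1 + S / 4) \<le> (1 - 64 * \<gamma>) * exp (S / 4)"
      using True exp_ge_add_one_self by (intro mult_left_mono) auto
    ultimately have "(1 - 64 * \<gamma>) * (1 + S / 4) \<le> 1"
      by linarith
    moreover have "(1 / 2) * (S / 4) \<le> (1 - 64 * \<gamma>) * (S / 4)"
      using True S0 by (intro mult_right_mono) auto
    ultimately show ?thesis
      by (simp add: algebra_simps)
  next
    case False
    \<comment> \<open>With \<open>\<gamma>\<close> bounded below, the crude estimate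
      \<open>S \<le> 8 * \<gamma> + 2\<close> from the variance suffices. Shifting by 1/2 uses that
      a Boolean value has distance 1/2 from 1/2.\<close>
    have "N * S / 4 \<le> N * (\<Sum>p\<in>P. (z p)\<^sup>2) / 4"
    proof -
      have "(int_dist (z p))\<^sup>2 \<le> (z p)\<^sup>2" for p
        using int_dist_le[of "z p" 0] int_dist_nonneg[of "z p"] by (simp add: abs_le_square_iff[symmetric])
      then show ?thesis
        unfolding S_def using N by (intro divide_right_mono mult_left_mono sum_mono) auto
    qed
    also have "\<dots> \<le> (\<Sum>A\<in>Pow P. ((c - 1 / 2) + (\<Sum>p\<in>A. z p))\<^sup>2)"
      unfolding N_def by (rule sum_Pow_affine_sq_ge[OF fin])
    also have "\<dots> \<le> (\<Sum>A\<in>Pow P. 2 * (of_bool (b A) - l A)\<^sup>2 + 1 / 2)"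
    proof (rule sum_mono)
      fix A
      have "0 \<le> ((of_bool (b A) - l A) + (of_bool (b A) - 1 / 2))\<^sup>2"
        by simp
      then show "((c - 1 / 2) + (\<Sum>p\<in>A. z p))\<^sup>2 \<le> 2 * (of_bool (b A) - l A)\<^sup>2 + 1 / 2"
        by (cases "b A") (auto simp: l_def power2_eq_square algebra_simps)
    qed
    also have "\<dots> = 2 * (N * \<gamma>) + N / 2"
      using N(2) W by (simp add: sum.distrib sum_distrib_left[symmetric])
    finally have "N * S \<le> N * (8 * \<gamma> + 2)"
      by (simp add: algebra_simps)
    then show ?thesis
      using N False by simp
  qed
  then have "N * S \<le> 512 * (N * \<gamma>)"
    using N by simp
  then show ?thesis
    unfolding W[symmetric] by (simp add: N_def S_def l_def)
qed

section \<open>Switching values along matchings of the rows\<close>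

text \<open>The change of a sum of entries when rows \<open>i\<close>, \<open>j\<close> take the
  values \<open>a\<close>, \<open>b\<close> instead of \<open>b\<close>, \<open>a\<close>. Adding to
  \<open>x\<close> a function of the row alone or of the value alone does not affect it.\<close>

definition switch_diff :: "('a \<Rightarrow> 'b \<Rightarrow> real) \<Rightarrow> 'a \<Rightarrow> 'a \<Rightarrow> 'b \<Rightarrow> 'b \<Rightarrow> real" where
  "switch_diff x i j a b = x i a + x j b - x i b - x j a"

text \<open>Fixed points of \<open>\<nu>\<close> are rows left unpaired; every other pair is
  represented in \<open>low\<close> by its smaller member.\<close>

locale row_matching =
  fixes n :: nat and \<nu> :: "nat \<Rightarrow> nat"
  assumes in_Sym: "\<nu> \<in> Sym n" and invol: "\<nu> (\<nu> i) = i"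
begin

definition low :: "nat set" where
  "low = {i \<in> {1..n}. i < \<nu> i}"

definition flip :: "nat set \<Rightarrow> nat \<Rightarrow> nat" where
  "flip A i = (if i \<in> A \<or> \<nu> i \<in> A then \<nu> i else i)"

lemma finite_low: "finite low"
  by (simp add: low_def)

lemma low_subset: "low \<subseteq> {1..n}"
  by (auto simp: low_def)

lemma low_disjoint: "low \<inter> \<nu> ` low = {}"
proof -
  have False if "i \<in> low" "\<nu> i \<in> low" for i
    using that by (simp add: low_def invol)
  then show ?thesis
    by blast
qed

lemma flip_in_Sym:
  assumes "A \<subseteq> low"
  shows "flip A \<in> Sym n"
proof -
  have "flip A i = i" if "i \<notin> {1..n}" for i
    using assms that Sym_in[OF in_Sym, of i] by (auto simp: flip_def low_def)
  moreover have "flip A (flip A i) = i" for i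
    by (simp add: flip_def invol)
  ultimately show ?thesis
    unfolding Sym_def permutes_def mem_Collect_eq by metis
qed

lemma sum_flip:
  fixes x :: "nat \<Rightarrow> nat \<Rightarrow> real"
  assumes "A \<subseteq> low"
  shows "(\<Sum>i\<in>{1..n}. x i (\<pi> (flip A i)))
    = (\<Sum>i\<in>{1..n}. x i (\<pi> i)) + (\<Sum>i\<in>A. switch_diff x i (\<nu> i) (\<pi> (\<nu> i)) (\<pi> i))"
proof -
  define g where "g i = x i (\<pi> (\<nu> i)) - x i (\<pi> i)" for i
  have A: "A \<subseteq> {1..n}" "finite A"
    using assms low_subset finite_subset[OF _ finite_low] by auto
  have \<nu>A: "\<nu> ` A \<subseteq> {1..n}"
    using A(1) Sym_in[OF in_Sym] by blast
  have disj: "A \<inter> \<nu> ` A = {}"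
    using assms low_disjoint by blast
  have inj: "inj_on \<nu> A"
    by (metis invol inj_on_inverseI)
  have mem: "i \<in> A \<or> \<nu> i \<in> A \<longleftrightarrow> i \<in> A \<union> \<nu> ` A" for i
    by (metis Un_iff imageE imageI invol)
  have "(\<Sum>i\<in>{1..n}. x i (\<pi> (flip A i))) - (\<Sum>i\<in>{1..n}. x i (\<pi> i))
      = (\<Sum>i\<in>{1..n}. if i \<in> A \<union> \<nu> ` A then g i else 0)"
    unfolding sum_subtractf[symmetric] flip_def mem by (intro sum.cong refl) (simp add: g_def)
  also have "\<dots> = (\<Sum>i\<in>A \<union> \<nu> ` A. g i)"
    using A \<nu>A by (intro sum.mono_neutral_cong_right) auto
  also have "\<dots> = (\<Sum>i\<in>A. g i) + (\<Sum>i\<in>A. g (\<nu> i))"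
    using A disj inj by (simp add: sum.union_disjoint sum.reindex)
  also have "\<dots> = (\<Sum>i\<in>A. switch_diff x i (\<nu> i) (\<pi> (\<nu> i)) (\<pi> i))"
    unfolding sum.distrib[symmetric] by (intro sum.cong refl) (simp add: g_def switch_diff_def invol)
  finally show ?thesis
    by simp
qed

lemma sum_matching:
  fixes Q :: "nat \<Rightarrow> nat \<Rightarrow> real"
  assumes "\<And>i j. Q i j = Q j i" "\<And>i. Q i i = 0"
  shows "(\<Sum>i\<in>{1..n}. Q i (\<nu> i)) = 2 * (\<Sum>i\<in>low. Q i (\<nu> i))"
proof -
  have \<nu>L: "\<nu> ` low \<subseteq> {1..n}"
    using Sym_in[OF in_Sym] by (auto simp: low_def simp del: atLeastAtMost_iff)
  have inj: "inj_on \<nu> low"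
    by (metis invol inj_on_inverseI)
  have "\<nu> i = i" if "i \<in> {1..n}" "i \<notin> low" "i \<notin> \<nu> ` low" for i
  proof (rule ccontr)
    assume "\<nu> i \<noteq> i"
    then have "\<nu> i \<in> low"
      using that(1,2) Sym_in[OF in_Sym, of i] by (auto simp: low_def invol)
    then show False
      using that(3) invol by (metis imageI)
  qed
  then have "(\<Sum>i\<in>{1..n}. Q i (\<nu> i)) = (\<Sum>i\<in>low \<union> \<nu> ` low. Q i (\<nu> i))"
    using \<nu>L low_subset assms(2)
    by (intro sum.mono_neutral_right) (auto simp del: atLeastAtMost_iff)
  also have "\<dots> = (\<Sum>i\<in>low. Q i (\<nu> i)) + (\<Sum>i\<in>low. Q (\<nu> i) i)"
    using finite_low low_disjoint inj by (simp add: sum.union_disjoint sum.reindex invol)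
  also have "(\<Sum>i\<in>low. Q (\<nu> i) i) = (\<Sum>i\<in>low. Q i (\<nu> i))"
    using assms(1) by (intro sum.cong refl)
  finally show ?thesis
    by simp
qed

text \<open>\<open>affine_near_boolean\<close> is applied to the cube of all
  \<open>\<pi> \<circ> flip A\<close> for every \<open>\<pi>\<close>. Right composition with
  \<open>flip A\<close> is a bijection of \<open>Sym n\<close>, so the cubes together cover each
  permutation \<open>2 ^ card low\<close> times, and this factor cancels.\<close>

lemma matching_switch_bound:
  "(\<Sum>\<pi>\<in>Sym n. \<Sum>i\<in>low. (int_dist (switch_diff x i (\<nu> i) (\<pi> (\<nu> i)) (\<pi> i)))\<^sup>2)
    \<le> 512 * (\<Sum>\<pi>\<in>Sym n. (of_bool (b \<pi>) - (c + (\<Sum>i\<in>{1..n}. x i (\<pi> i))))\<^sup>2)"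
proof -
  define N :: real where "N = 2 ^ card low"
  define e where "e \<pi> = (of_bool (b \<pi>) - (c + (\<Sum>i\<in>{1..n}. x i (\<pi> i))))\<^sup>2" for \<pi>
  have "N * (\<Sum>\<pi>\<in>Sym n. \<Sum>i\<in>low. (int_dist (switch_diff x i (\<nu> i) (\<pi> (\<nu> i)) (\<pi> i)))\<^sup>2)
      \<le> (\<Sum>\<pi>\<in>Sym n. 512 * (\<Sum>A\<in>Pow low. e (\<pi> \<circ> flip A)))"
  proof (subst sum_distrib_left, rule sum_mono)
    fix \<pi>
    have "N * (\<Sum>i\<in>low. (int_dist (switch_diff x i (\<nu> i) (\<pi> (\<nu> i)) (\<pi> i)))\<^sup>2)
        \<le> 512 * (\<Sum>A\<in>Pow low. (of_bool (b (\<pi> \<circ> flip A)) - (c + (\<Sum>i\<in>{1..n}. x i (\<pi> i))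
            + (\<Sum>i\<in>A. switch_diff x i (\<nu> i) (\<pi> (\<nu> i)) (\<pi> i))))\<^sup>2)"
      unfolding N_def by (rule affine_near_boolean[OF finite_low])
    also have "(\<Sum>A\<in>Pow low. (of_bool (b (\<pi> \<circ> flip A)) - (c + (\<Sum>i\<in>{1..n}. x i (\<pi> i))
            + (\<Sum>i\<in>A. switch_diff x i (\<nu> i) (\<pi> (\<nu> i)) (\<pi> i))))\<^sup>2)
        = (\<Sum>A\<in>Pow low. e (\<pi> \<circ> flip A))"
    proof (rule sum.cong[OF refl])
      fix A assume "A \<in> Pow low"
      then have "(\<Sum>i\<in>{1..n}. x i ((\<pi> \<circ> flip A) i))
          = (\<Sum>i\<in>{1..n}. x i (\<pi> i)) + (\<Sum>i\<in>A. switch_diff x i (\<nu> i) (\<pi> (\<nu> i)) (\<pi> i))"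
        unfolding comp_apply by (intro sum_flip) simp
      then show "(of_bool (b (\<pi> \<circ> flip A)) - (c + (\<Sum>i\<in>{1..n}. x i (\<pi> i))
            + (\<Sum>i\<in>A. switch_diff x i (\<nu> i) (\<pi> (\<nu> i)) (\<pi> i))))\<^sup>2 = e (\<pi> \<circ> flip A)"
        unfolding e_def by (simp only: add.assoc)
    qed
    finally show "N * (\<Sum>i\<in>low. (int_dist (switch_diff x i (\<nu> i) (\<pi> (\<nu> i)) (\<pi> i)))\<^sup>2)
        \<le> 512 * (\<Sum>A\<in>Pow low. e (\<pi> \<circ> flip A))" .
  qed
  also have "\<dots> = 512 * (\<Sum>A\<in>Pow low. \<Sum>\<pi>\<in>Sym n. e (\<pi> \<circ> flip A))"
    by (simp only: sum_distrib_left[symmetric] sum.swap[of _ "Pow low"])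
  also have "\<dots> = 512 * (\<Sum>A\<in>Pow low. \<Sum>\<pi>\<in>Sym n. e \<pi>)"
    by (simp add: sum_Sym_comp_right[OF flip_in_Sym])
  also have "\<dots> = N * (512 * (\<Sum>\<pi>\<in>Sym n. e \<pi>))"
    using finite_low by (simp add: N_def card_Pow)
  finally show ?thesis
    unfolding e_def by (simp add: N_def)
qed

end

text \<open>Each ordered pair of distinct values is taken by \<open>fact (n - 2)\<close>
  permutations. As \<open>G\<close> vanishes on the diagonal, the sum may run over all
  pairs.\<close>

lemma sum_Sym_two_values:
  fixes G :: "nat \<Rightarrow> nat \<Rightarrow> real"
  assumes "i \<in> {1..n}" "j \<in> {1..n}" "i \<noteq> j" "\<And>a. G a a = 0"
  shows "(\<Sum>\<pi>\<in>Sym n. G (\<pi> j) (\<pi> i)) = fact (n - 2) * (\<Sum>a\<in>{1..n}. \<Sum>b\<in>{1..n}. G a b)"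
proof -
  have "(\<Sum>\<pi>\<in>Sym n. G (\<pi> j) (\<pi> i))
      = (\<Sum>\<pi>\<in>Sym n. \<Sum>a\<in>{1..n}. \<Sum>b\<in>{1..n}. of_bool (\<pi> j = a \<and> \<pi> i = b) * G a b)"
  proof (intro sum.cong refl)
    fix \<pi> assume "\<pi> \<in> Sym n"
    then have v: "\<pi> i \<in> {1..n}" "\<pi> j \<in> {1..n}"
      using Sym_in assms by blast+
    have "(\<Sum>a\<in>{1..n}. \<Sum>b\<in>{1..n}. of_bool (\<pi> j = a \<and> \<pi> i = b) * G a b)
        = (\<Sum>a\<in>{1..n}. of_bool (\<pi> j = a) * (\<Sum>b\<in>{1..n}. of_bool (\<pi> i = b) * G a b))"
      by (simp add: sum_distrib_left mult.assoc of_bool_conj)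
    then show "G (\<pi> j) (\<pi> i) = (\<Sum>a\<in>{1..n}. \<Sum>b\<in>{1..n}. of_bool (\<pi> j = a \<and> \<pi> i = b) * G a b)"
      using v by (simp add: sum_delta_of_bool del: atLeastAtMost_iff)
  qed
  also have "\<dots> = (\<Sum>a\<in>{1..n}. \<Sum>\<pi>\<in>Sym n. \<Sum>b\<in>{1..n}. of_bool (\<pi> j = a \<and> \<pi> i = b) * G a b)"
    by (rule sum.swap)
  also have "\<dots> = (\<Sum>a\<in>{1..n}. \<Sum>b\<in>{1..n}. \<Sum>\<pi>\<in>Sym n. of_bool (\<pi> j = a \<and> \<pi> i = b) * G a b)"
    by (intro sum.cong refl sum.swap)
  also have "\<dots> = (\<Sum>a\<in>{1..n}. \<Sum>b\<in>{1..n}. fact (n - 2) * G a b)"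
  proof (intro sum.cong refl)
    fix a b assume "a \<in> {1..n}" "b \<in> {1..n}"
    then have "card {\<pi> \<in> Sym n. \<pi> j = a \<and> \<pi> i = b} = fact (n - 2)" if "a \<noteq> b"
      using card_perm_two_cosets[of j n a i b] assms that by (simp add: numeral_2_eq_2)
    then show "(\<Sum>\<pi>\<in>Sym n. of_bool (\<pi> j = a \<and> \<pi> i = b) * G a b) = fact (n - 2) * G a b"
      using assms(4)
      by (cases "a = b") (simp_all only: sum_distrib_right[symmetric] sum_of_bool_card[OF finite_Sym], simp_all)
  qed
  finally show ?thesis
    by (simp add: sum_distrib_left)
qed

text \<open>The involution with \<open>i + reflect n t i\<close> congruent to \<open>t + 2\<close> modulo \<open>n\<close>. As \<open>t\<close> varies, these
  matchings cover every pair of rows exactly once.\<close>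

definition reflect :: "nat \<Rightarrow> nat \<Rightarrow> nat \<Rightarrow> nat" where
  "reflect n t i = (if i \<in> {1..n} then 1 + nat ((int t - int (i - 1)) mod int n) else i)"

lemma reflect_eq:
  "i \<in> {1..n} \<Longrightarrow> reflect n t i = 1 + nat ((int t - int (i - 1)) mod int n)"
  by (simp only: reflect_def if_True)

lemma reflect_in:
  assumes "i \<in> {1..n}"
  shows "reflect n t i \<in> {1..n}"
proof -
  define r where "r = (int t - int (i - 1)) mod int n"
  have "r < int n" "0 \<le> r"
    using assms by (auto simp: r_def)
  then show ?thesis
    unfolding reflect_eq[OF assms] r_def[symmetric] by (auto simp: nat_less_iff Suc_le_eq)
qed

lemma reflect_invol: "reflect n t (reflect n t i) = i"
proof (cases "i \<in> {1..n}")
  case True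
  define r where "r = (int t - int (i - 1)) mod int n"
  have r: "0 \<le> r"
    using True by (auto simp: r_def)
  have "(int t - r) mod int n = (int t - (int t - int (i - 1))) mod int n"
    unfolding r_def by (rule mod_diff_right_eq)
  also have "\<dots> = int (i - 1)"
    using True by (simp add: of_nat_diff)
  finally have "1 + nat ((int t - r) mod int n) = i"
    using True by (simp only: nat_int) auto
  moreover have "int (reflect n t i - 1) = r"
    using r unfolding reflect_eq[OF True] r_def[symmetric] by simp
  ultimately show ?thesis
    using reflect_eq[OF reflect_in[OF True]] by simp
qed (auto simp: reflect_def)

lemma row_matching_reflect: "row_matching n (reflect n t)"
proof
  have "reflect n t i = i" if "i \<notin> {1..n}" for i
    using that by (auto simp: reflect_def)
  then show "reflect n t \<in> Sym n"
    unfolding Sym_def permutes_def mem_Collect_eq using reflect_invol by metis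
qed (rule reflect_invol)

lemma sum_reflect:
  fixes g :: "nat \<Rightarrow> real"
  assumes "i \<in> {1..n}"
  shows "(\<Sum>t<n. g (reflect n t i)) = (\<Sum>j\<in>{1..n}. g j)"
proof (rule sum.reindex_bij_betw)
  define i0 where "i0 = i - 1"
  have i0: "i0 < n"
    using assms by (auto simp: i0_def)
  have val: "int (reflect n t i - 1) = (int t - int i0) mod int n" for t
    using assms i0 by (simp add: reflect_def i0_def)
  have inj: "inj_on (\<lambda>t. reflect n t i) {..<n}"
  proof (rule inj_onI)
    fix t t' assume t: "t \<in> {..<n}" "t' \<in> {..<n}" "reflect n t i = reflect n t' i"
    then have "(int t - int i0) mod int n = (int t' - int i0) mod int n"
      using val by metis
    then have "(int t - int i0 + int i0) mod int n = (int t' - int i0 + int i0) mod int n"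
      by (metis mod_add_left_eq)
    then show "t = t'"
      using t by simp
  qed
  moreover have "(\<lambda>t. reflect n t i) ` {..<n} \<subseteq> {1..n}"
    using reflect_in[OF assms] by blast
  ultimately have "(\<lambda>t. reflect n t i) ` {..<n} = {1..n}"
    by (intro card_subset_eq) (auto simp: card_image)
  then show "bij_betw (\<lambda>t. reflect n t i) {..<n} {1..n}"
    using inj by (simp add: bij_betw_def)
qed

lemma int_dist_0: "int_dist 0 = 0"
  using int_dist_le[of 0 0] int_dist_nonneg[of 0] by simp

text \<open>One matching controls only the switches along its own pairs; summing over the
  \<open>n\<close> reflections reaches all pairs of rows. The constant is twice 512 because each
  pair is counted in both orders.\<close>

lemma switch_sum_bound:
  "fact (n - 2) * (\<Sum>i\<in>{1..n}. \<Sum>j\<in>{1..n}. \<Sum>a\<in>{1..n}. \<Sum>b\<in>{1..n}. (int_dist (switch_diff x i j a b))\<^sup>2)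
    \<le> 1024 * real n * (\<Sum>\<pi>\<in>Sym n. (of_bool (b \<pi>) - (c + (\<Sum>i\<in>{1..n}. x i (\<pi> i))))\<^sup>2)"
proof -
  define Q where "Q i j = (\<Sum>a\<in>{1..n}. \<Sum>b\<in>{1..n}. (int_dist (switch_diff x i j a b))\<^sup>2)" for i j
  define W where "W = (\<Sum>\<pi>\<in>Sym n. (of_bool (b \<pi>) - (c + (\<Sum>i\<in>{1..n}. x i (\<pi> i))))\<^sup>2)"
  have Q_sym: "Q i j = Q j i" for i j
    unfolding Q_def by (subst sum.swap) (simp add: switch_diff_def algebra_simps)
  have Q_diag: "Q i i = 0" for i
    by (simp add: Q_def switch_diff_def int_dist_0)
  have "fact (n - 2) * (\<Sum>i\<in>{1..n}. Q i (reflect n t i)) \<le> 1024 * W" for t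
  proof -
    interpret row_matching n "reflect n t"
      by (rule row_matching_reflect)
    have "fact (n - 2) * (\<Sum>i\<in>{1..n}. Q i (reflect n t i)) = 2 * (\<Sum>i\<in>low. fact (n - 2) * Q i (reflect n t i))"
      by (subst sum_matching[of Q, OF Q_sym Q_diag]) (simp add: sum_distrib_left mult_ac)
    also have "(\<Sum>i\<in>low. fact (n - 2) * Q i (reflect n t i))
        = (\<Sum>i\<in>low. \<Sum>\<pi>\<in>Sym n. (int_dist (switch_diff x i (reflect n t i) (\<pi> (reflect n t i)) (\<pi> i)))\<^sup>2)"
    proof (rule sum.cong[OF refl])
      fix i assume "i \<in> low"
      then have "i \<in> {1..n}" "reflect n t i \<in> {1..n}" "i \<noteq> reflect n t i"
        using reflect_in[of i n t] by (auto simp: low_def)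
      then show "fact (n - 2) * Q i (reflect n t i)
          = (\<Sum>\<pi>\<in>Sym n. (int_dist (switch_diff x i (reflect n t i) (\<pi> (reflect n t i)) (\<pi> i)))\<^sup>2)"
        unfolding Q_def
        by (subst sum_Sym_two_values[where G = "\<lambda>a b. (int_dist (switch_diff x i (reflect n t i) a b))\<^sup>2"])
          (auto simp: switch_diff_def int_dist_0)
    qed
    also have "\<dots> \<le> 512 * W"
      unfolding W_def by (subst sum.swap) (rule matching_switch_bound)
    finally show ?thesis
      by simp
  qed
  then have "(\<Sum>t<n. fact (n - 2) * (\<Sum>i\<in>{1..n}. Q i (reflect n t i))) \<le> (\<Sum>t<n. 1024 * W)"
    by (intro sum_mono)
  moreover have "(\<Sum>t<n. fact (n - 2) * (\<Sum>i\<in>{1..n}. Q i (reflect n t i)))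
      = fact (n - 2) * (\<Sum>i\<in>{1..n}. \<Sum>j\<in>{1..n}. Q i j)"
    unfolding sum_distrib_left[symmetric] by (subst sum.swap) (simp add: sum_reflect del: atLeastAtMost_iff)
  ultimately show ?thesis
    unfolding W_def Q_def by (simp add: mult_ac)
qed

section \<open>Nearly integral matrices with constant row and column sums\<close>

lemma sum_squared_le:
  fixes f :: "'a \<Rightarrow> real"
  shows "(\<Sum>x\<in>X. f x)\<^sup>2 \<le> real (card X) * (\<Sum>x\<in>X. (f x)\<^sup>2)"
proof -
  have "0 \<le> (\<Sum>x\<in>X. \<Sum>y\<in>X. (f x - f y)\<^sup>2)"
    by (intro sum_nonneg) auto
  also have "\<dots> = 2 * (real (card X) * (\<Sum>x\<in>X. (f x)\<^sup>2)) - 2 * (\<Sum>x\<in>X. f x)\<^sup>2"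
    by (simp add: power2_diff sum.distrib sum_subtractf sum_distrib_left[symmetric]
        sum_distrib_right[symmetric] power2_eq_square[of "sum f X"] mult.assoc)
  finally show ?thesis
    by simp
qed

lemma int_dist_eq:
  assumes "\<bar>x - of_int m\<bar> \<le> 1 / 2"
  shows "int_dist x = \<bar>x - of_int m\<bar>"
proof (rule antisym[OF int_dist_le])
  show "\<bar>x - of_int m\<bar> \<le> int_dist x"
  proof (cases "round x = m")
    case False
    then have "1 \<le> \<bar>round x - m\<bar>"
      by linarith
    then have "1 \<le> \<bar>real_of_int (round x) - of_int m\<bar>"
      by linarith
    then show ?thesis
      using assms unfolding int_dist_def by linarith
  qed (simp add: int_dist_def)
qed

lemma int_dist_ge:
  assumes "1 / 16 \<le> x" "x \<le> 15 / 16"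
  shows "1 / 16 \<le> int_dist x"
proof -
  have "real_of_int (round x) \<le> 0 \<or> 1 \<le> real_of_int (round x)"
    by (metis int_one_le_iff_zero_less linorder_not_le of_int_1_le_iff of_int_le_0_iff)
  then show ?thesis
    using assms unfolding int_dist_def by linarith
qed

lemma sq_add4_le: "(p + q + r + s)\<^sup>2 \<le> 4 * (p\<^sup>2 + q\<^sup>2 + r\<^sup>2 + s\<^sup>2)" for p q r s :: real
proof -
  have "0 \<le> (p - q)\<^sup>2 + (p - r)\<^sup>2 + (p - s)\<^sup>2 + (q - r)\<^sup>2 + (q - s)\<^sup>2 + (r - s)\<^sup>2"
    by simp
  then show ?thesis
    by (simp add: power2_eq_square algebra_simps)
qed

text \<open>The constants belong together: the estimate in \<open>near_ind\<close> is
  \<open>(n\<^sup>2 - 96 * n * \<kappa>) / 256\<close>, which \<open>192 * \<kappa> \<le> n\<close>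
  keeps at or above \<open>n\<^sup>2 / 512\<close>, and so above
  \<open>T * n\<^sup>2\<close>.\<close>

locale near_integral_matrix =
  fixes n :: nat and a :: "nat \<Rightarrow> nat \<Rightarrow> real" and \<kappa> T :: real
  assumes bounds: "\<And>i j. i \<in> {1..n} \<Longrightarrow> j \<in> {1..n} \<Longrightarrow> 0 \<le> a i j \<and> a i j \<le> 1"
    and row: "\<And>i. i \<in> {1..n} \<Longrightarrow> (\<Sum>j\<in>{1..n}. a i j) = \<kappa>"
    and col: "\<And>j. j \<in> {1..n} \<Longrightarrow> (\<Sum>i\<in>{1..n}. a i j) = \<kappa>"
    and n_pos: "1 \<le> n" and \<kappa>_small: "192 * \<kappa> \<le> real n" and T_small: "T < 1 / 512"
    and dist: "(\<Sum>i\<in>{1..n}. \<Sum>j\<in>{1..n}. \<Sum>p\<in>{1..n}. \<Sum>q\<in>{1..n}. (int_dist (switch_diff a i j p q))\<^sup>2)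
      \<le> T * (real n)\<^sup>2"
begin

definition ind :: "nat \<Rightarrow> nat \<Rightarrow> real" where
  "ind i p = of_bool (1 / 2 \<le> a i p)"

definition R :: "nat \<Rightarrow> real" where
  "R i = (\<Sum>p\<in>{1..n}. ind i p)"

definition C :: "nat \<Rightarrow> real" where
  "C p = (\<Sum>i\<in>{1..n}. ind i p)"

definition m :: real where
  "m = (\<Sum>i\<in>{1..n}. \<Sum>p\<in>{1..n}. ind i p)"

text \<open>The doubly centred rounding error: \<open>a - ind\<close> minus its row and column means
  plus its overall mean.\<close>

definition err :: "nat \<Rightarrow> nat \<Rightarrow> real" where
  "err i p = a i p - ind i p - \<kappa> / real n - m / (real n)\<^sup>2 + R i / real n + C p / real n"

lemma \<kappa>_nonneg: "0 \<le> \<kappa>"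
  using row[of 1] bounds[of 1] n_pos sum_nonneg[of "{1..n}" "a 1"] by fastforce

text \<open>An entry away from 0 and 1 would make the switch differences through it non-integral, since by
  the row and column sums most of the other three entries involved are tiny.\<close>

lemma near_ind:
  assumes "i \<in> {1..n}" "p \<in> {1..n}"
  shows "\<bar>a i p - ind i p\<bar> \<le> 1 / 8"
proof (rule ccontr)
  assume "\<not> \<bar>a i p - ind i p\<bar> \<le> 1 / 8"
  then have mid: "1 / 8 < a i p" "a i p < 7 / 8"
    using bounds[OF assms] by (cases "1 / 2 \<le> a i p"; simp add: ind_def)+
  \<comment> \<open>A lower bound linear in the other three entries, so that it can be summed over
    all \<open>j\<close> and \<open>q\<close>. If these entries add up to at most 1/32, the switch
    difference lies in [1/16, 15/16]; otherwise the bound is negative.\<close>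
  have pos: "1 / 256 * (1 - 32 * (a i q + a j p + a j q)) \<le> (int_dist (switch_diff a i j p q))\<^sup>2"
    if "j \<in> {1..n}" "q \<in> {1..n}" for j q
  proof (cases "a i q + a j p + a j q \<le> 1 / 32")
    case True
    then have "1 / 16 \<le> int_dist (switch_diff a i j p q)"
      using mid bounds[of i q] bounds[of j p] bounds[of j q] assms that
      by (intro int_dist_ge) (auto simp: switch_diff_def)
    then have "(1 / 16)\<^sup>2 \<le> (int_dist (switch_diff a i j p q))\<^sup>2"
      by (intro power_mono) auto
    moreover have "1 / 256 * (1 - 32 * (a i q + a j p + a j q)) \<le> 1 / 256"
      using bounds[of i q] bounds[of j p] bounds[of j q] assms that by auto
    ultimately show ?thesis
      by (simp add: power2_eq_square)
  next
    case False
    then have "1 / 256 * (1 - 32 * (a i q + a j p + a j q)) \<le> 0"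
      by simp
    then show ?thesis
      by (rule order_trans) simp
  qed
  have "(\<Sum>j\<in>{1..n}. \<Sum>q\<in>{1..n}. 1 / 256 * (1 - 32 * (a i q + a j p + a j q)))
      = 1 / 256 * (real n * real n - 96 * (real n * \<kappa>))"
    using row col assms
    by (simp add: sum.distrib sum_subtractf sum_distrib_left[symmetric] sum_divide_distrib[symmetric]
        algebra_simps add_divide_distrib diff_divide_distrib del: atLeastAtMost_iff)
  moreover have "(\<Sum>j\<in>{1..n}. \<Sum>q\<in>{1..n}. 1 / 256 * (1 - 32 * (a i q + a j p + a j q)))
      \<le> (\<Sum>j\<in>{1..n}. \<Sum>q\<in>{1..n}. (int_dist (switch_diff a i j p q))\<^sup>2)"
    by (intro sum_mono pos)
  moreover have "(\<Sum>j\<in>{1..n}. \<Sum>q\<in>{1..n}. (int_dist (switch_diff a i j p q))\<^sup>2) \<le> T * (real n)\<^sup>2"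
  proof -
    have "(\<Sum>j\<in>{1..n}. \<Sum>q\<in>{1..n}. (int_dist (switch_diff a i j p q))\<^sup>2)
        \<le> (\<Sum>j\<in>{1..n}. \<Sum>p\<in>{1..n}. \<Sum>q\<in>{1..n}. (int_dist (switch_diff a i j p q))\<^sup>2)"
      using assms(2)
      by (intro sum_mono member_le_sum[where f = "\<lambda>p. \<Sum>q\<in>{1..n}. (int_dist (switch_diff a i _ p q))\<^sup>2"])
        (auto intro!: sum_nonneg)
    also have "\<dots> \<le> (\<Sum>i\<in>{1..n}. \<Sum>j\<in>{1..n}. \<Sum>p\<in>{1..n}. \<Sum>q\<in>{1..n}. (int_dist (switch_diff a i j p q))\<^sup>2)"
      using assms(1)
      by (intro member_le_sum[where f = "\<lambda>i. \<Sum>j\<in>{1..n}. \<Sum>p\<in>{1..n}. \<Sum>q\<in>{1..n}. (int_dist (switch_diff a i j p q))\<^sup>2"])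
        (auto intro!: sum_nonneg)
    finally show ?thesis
      using dist by linarith
  qed
  ultimately have "1 / 256 * (real n * real n - 96 * (real n * \<kappa>)) \<le> T * (real n)\<^sup>2"
    by linarith
  moreover have "real n * (192 * \<kappa>) \<le> real n * real n"
    using \<kappa>_small by (intro mult_left_mono) auto
  moreover have "T * (real n)\<^sup>2 < 1 / 512 * (real n)\<^sup>2"
    using T_small n_pos by (intro mult_strict_right_mono) auto
  ultimately show False
    by (simp add: power2_eq_square)
qed

text \<open>\<open>err i p\<close> is the mean over all \<open>j\<close> and \<open>q\<close> of the
  switch difference of the rounding error, so Cauchy-Schwarz bounds its square by the mean of the
  squares.\<close>

lemma sum_err_sq: "(\<Sum>i\<in>{1..n}. \<Sum>p\<in>{1..n}. (err i p)\<^sup>2) \<le> T"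
proof -
  define c where "c i p = a i p - ind i p" for i p
  \<comment> \<open>Four rounding errors of at most 1/8 add up to at most 1/2, so the integer
    obtained by rounding each entry is a nearest one to the switch difference.\<close>
  have int_dist: "(int_dist (switch_diff a i j p q))\<^sup>2 = (switch_diff c i j p q)\<^sup>2"
    if "i \<in> {1..n}" "j \<in> {1..n}" "p \<in> {1..n}" "q \<in> {1..n}" for i j p q
  proof -
    define N :: int where "N = of_bool (1 / 2 \<le> a i p) + of_bool (1 / 2 \<le> a j q)
      - of_bool (1 / 2 \<le> a i q) - of_bool (1 / 2 \<le> a j p)"
    have eq: "switch_diff a i j p q - of_int N = switch_diff c i j p q"
      by (simp add: switch_diff_def c_def N_def ind_def)
    have "\<bar>switch_diff c i j p q\<bar> \<le> 1 / 2"
      unfolding switch_diff_def c_def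
      using near_ind[of i p] near_ind[of j q] near_ind[of i q] near_ind[of j p] that by linarith
    then have "int_dist (switch_diff a i j p q) = \<bar>switch_diff c i j p q\<bar>"
      using int_dist_eq[of "switch_diff a i j p q" N] by (simp add: eq)
    then show ?thesis
      by simp
  qed
  have err: "(\<Sum>j\<in>{1..n}. \<Sum>q\<in>{1..n}. switch_diff c i j p q) = (real n)\<^sup>2 * err i p"
    if "i \<in> {1..n}" "p \<in> {1..n}" for i p
  proof -
    have "(\<Sum>q\<in>{1..n}. c i q) = \<kappa> - R i" "(\<Sum>j\<in>{1..n}. c j p) = \<kappa> - C p"
      using row col that by (auto simp: c_def sum_subtractf R_def C_def)
    moreover have "(\<Sum>j\<in>{1..n}. \<Sum>q\<in>{1..n}. c j q) = real n * \<kappa> - m"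
      using row by (simp add: c_def sum_subtractf m_def del: atLeastAtMost_iff)
    ultimately have "(\<Sum>j\<in>{1..n}. \<Sum>q\<in>{1..n}. switch_diff c i j p q)
        = (real n)\<^sup>2 * c i p + (real n * \<kappa> - m) - real n * (\<kappa> - R i) - real n * (\<kappa> - C p)"
      by (simp add: switch_diff_def sum.distrib sum_subtractf sum_distrib_left[symmetric] power2_eq_square)
    moreover have "(real n)\<^sup>2 * err i p = (real n)\<^sup>2 * c i p - (real n)\<^sup>2 * (\<kappa> / real n)
        - (real n)\<^sup>2 * (m / (real n)\<^sup>2) + (real n)\<^sup>2 * (R i / real n) + (real n)\<^sup>2 * (C p / real n)"
      by (simp only: err_def c_def ring_distribs)
    moreover have "(real n)\<^sup>2 * (m / (real n)\<^sup>2) = m" "(real n)\<^sup>2 * (t / real n) = real n * t" for t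
      using n_pos by (simp_all add: power2_eq_square)
    ultimately show ?thesis
      by (simp add: algebra_simps)
  qed
  have err': "(\<Sum>x\<in>{1..n}\<times>{1..n}. switch_diff c i (fst x) p (snd x)) = (real n)\<^sup>2 * err i p"
    if "i \<in> {1..n}" "p \<in> {1..n}" for i p
    unfolding sum.cartesian_product' fst_conv snd_conv by (rule err[OF that])
  have "((real n)\<^sup>2)\<^sup>2 * (\<Sum>i\<in>{1..n}. \<Sum>p\<in>{1..n}. (err i p)\<^sup>2)
      = (\<Sum>i\<in>{1..n}. \<Sum>p\<in>{1..n}. (\<Sum>x\<in>{1..n}\<times>{1..n}. switch_diff c i (fst x) p (snd x))\<^sup>2)"
    unfolding sum_distrib_left
    by (intro sum.cong refl)
      (simp only: err' power_mult_distrib)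
  also have "\<dots> \<le> (\<Sum>i\<in>{1..n}. \<Sum>p\<in>{1..n}. real (card ({1..n}\<times>{1..n})) *
      (\<Sum>x\<in>{1..n}\<times>{1..n}. (switch_diff c i (fst x) p (snd x))\<^sup>2))"
    by (intro sum_mono sum_squared_le)
  also have "\<dots> = (real n)\<^sup>2 * (\<Sum>i\<in>{1..n}. \<Sum>p\<in>{1..n}. \<Sum>j\<in>{1..n}. \<Sum>q\<in>{1..n}. (switch_diff c i j p q)\<^sup>2)"
    by (simp add: sum.cartesian_product' sum_distrib_left[symmetric] power2_eq_square)
  also have "(\<Sum>i\<in>{1..n}. \<Sum>p\<in>{1..n}. \<Sum>j\<in>{1..n}. \<Sum>q\<in>{1..n}. (switch_diff c i j p q)\<^sup>2)
      = (\<Sum>i\<in>{1..n}. \<Sum>j\<in>{1..n}. \<Sum>p\<in>{1..n}. \<Sum>q\<in>{1..n}. (switch_diff c i j p q)\<^sup>2)"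
    by (intro sum.cong refl sum.swap)
  also have "\<dots> = (\<Sum>i\<in>{1..n}. \<Sum>j\<in>{1..n}. \<Sum>p\<in>{1..n}. \<Sum>q\<in>{1..n}. (int_dist (switch_diff a i j p q))\<^sup>2)"
    by (intro sum.cong refl int_dist[symmetric])
  also have "(real n)\<^sup>2 * \<dots> \<le> (real n)\<^sup>2 * (T * (real n)\<^sup>2)"
    using dist by (intro mult_left_mono) auto
  finally have "((real n)\<^sup>2)\<^sup>2 * (\<Sum>i\<in>{1..n}. \<Sum>p\<in>{1..n}. (err i p)\<^sup>2) \<le> ((real n)\<^sup>2)\<^sup>2 * T"
    by (simp add: power2_eq_square mult_ac)
  then show ?thesis
    using n_pos by simp
qed

text \<open>Squared distance to the constant matrix with the same row sums. For the scaled coset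
  densities it is explicit in the norm of the remainder, see \<open>sum_a'_variance\<close>.\<close>

definition V :: real where
  "V = (\<Sum>i\<in>{1..n}. \<Sum>p\<in>{1..n}. (a i p - \<kappa> / real n)\<^sup>2)"

lemma ind_le: "i \<in> {1..n} \<Longrightarrow> p \<in> {1..n} \<Longrightarrow> ind i p \<le> 2 * a i p"
  using bounds[of i p] by (simp add: ind_def)

lemma ind_nonneg: "0 \<le> ind i p"
  by (simp add: ind_def)

lemma R_le: "i \<in> {1..n} \<Longrightarrow> R i \<le> 2 * \<kappa>" and R_nonneg: "0 \<le> R i"
proof -
  show "R i \<le> 2 * \<kappa>" if "i \<in> {1..n}"
    unfolding R_def row[OF that, symmetric] sum_distrib_left using that by (intro sum_mono ind_le)
qed (auto simp: R_def intro!: sum_nonneg ind_nonneg)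

lemma C_le: "p \<in> {1..n} \<Longrightarrow> C p \<le> 2 * \<kappa>" and C_nonneg: "0 \<le> C p"
proof -
  show "C p \<le> 2 * \<kappa>" if "p \<in> {1..n}"
    unfolding C_def col[OF that, symmetric] sum_distrib_left using that by (intro sum_mono ind_le)
qed (auto simp: C_def intro!: sum_nonneg ind_nonneg)

lemma m_eq: "m = (\<Sum>i\<in>{1..n}. R i)" "m = (\<Sum>p\<in>{1..n}. C p)"
  unfolding m_def R_def C_def by (rule refl, rule sum.swap)

lemma \<kappa>_div: "0 \<le> \<kappa> / real n" "\<kappa> / real n \<le> 1 / 192"
  using \<kappa>_nonneg \<kappa>_small n_pos by (auto simp: field_simps)

text \<open>The row sums alone would only give a bound of order n \<kappa> for the number of large
  entries. The variance improves it to order \<kappa>, since each large entry exceeds the mean by at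
  least 1/4.\<close>

lemma m_bounds:
  assumes "V \<le> \<kappa>"
  shows "0 \<le> m" "m \<le> 16 * \<kappa>"
proof -
  show "0 \<le> m"
    unfolding m_def by (intro sum_nonneg ind_nonneg)
  have "1 / 16 * ind i p \<le> (a i p - \<kappa> / real n)\<^sup>2" if "i \<in> {1..n}" "p \<in> {1..n}" for i p
  proof (cases "1 / 2 \<le> a i p")
    case True
    then have "(1 / 4)\<^sup>2 \<le> (a i p - \<kappa> / real n)\<^sup>2"
      using \<kappa>_div by (intro power_mono) auto
    then show ?thesis
      using True by (simp add: ind_def power2_eq_square)
  qed (simp add: ind_def)
  then have "1 / 16 * m \<le> V"
    unfolding m_def V_def sum_distrib_left by (intro sum_mono)
  then show "m \<le> 16 * \<kappa>"
    using assms by simp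
qed

lemma sum_R_C_sq:
  assumes "V \<le> \<kappa>"
  shows "(\<Sum>i\<in>{1..n}. (R i)\<^sup>2) \<le> 32 * \<kappa>\<^sup>2" "(\<Sum>p\<in>{1..n}. (C p)\<^sup>2) \<le> 32 * \<kappa>\<^sup>2"
proof -
  have *: "2 * \<kappa> * m \<le> 32 * \<kappa>\<^sup>2"
    using mult_left_mono[OF m_bounds(2)[OF assms], of "2 * \<kappa>"] \<kappa>_nonneg by (simp add: power2_eq_square)
  have "(\<Sum>i\<in>{1..n}. (R i)\<^sup>2) \<le> (\<Sum>i\<in>{1..n}. 2 * \<kappa> * R i)"
    unfolding power2_eq_square using R_le R_nonneg by (intro sum_mono mult_right_mono)
  then show "(\<Sum>i\<in>{1..n}. (R i)\<^sup>2) \<le> 32 * \<kappa>\<^sup>2"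
    using * by (simp add: m_eq(1) sum_distrib_left)
  have "(\<Sum>p\<in>{1..n}. (C p)\<^sup>2) \<le> (\<Sum>p\<in>{1..n}. 2 * \<kappa> * C p)"
    unfolding power2_eq_square using C_le C_nonneg by (intro sum_mono mult_right_mono)
  then show "(\<Sum>p\<in>{1..n}. (C p)\<^sup>2) \<le> 32 * \<kappa>\<^sup>2"
    using * by (simp add: m_eq(2) sum_distrib_left)
qed

lemma m_ge:
  assumes "V \<le> \<kappa>"
  shows "V - 4 * T - 1280 * (\<kappa>\<^sup>2 / real n) \<le> m"
proof -
  let ?s = "\<lambda>i p. (err i p)\<^sup>2 + (m / (real n)\<^sup>2)\<^sup>2 + (R i / real n)\<^sup>2 + (C p / real n)\<^sup>2"
  have "(a i p - \<kappa> / real n)\<^sup>2 \<le> ind i p + 4 * ?s i p" if "i \<in> {1..n}" "p \<in> {1..n}" for i p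
  proof (cases "1 / 2 \<le> a i p")
    case True
    then have "0 \<le> a i p - \<kappa> / real n" "a i p - \<kappa> / real n \<le> 1"
      using bounds[OF that] \<kappa>_div by linarith+
    then have "(a i p - \<kappa> / real n)\<^sup>2 \<le> 1\<^sup>2"
      by (intro power_mono)
    then show ?thesis
      using True by (simp add: ind_def add_increasing2)
  next
    case False
    then have "a i p - \<kappa> / real n = err i p + m / (real n)\<^sup>2 + (- (R i / real n)) + (- (C p / real n))"
      by (simp add: err_def ind_def)
    then show ?thesis
      using False sq_add4_le[of "err i p" "m / (real n)\<^sup>2" "- (R i / real n)" "- (C p / real n)"]
      by (simp add: ind_def)
  qed
  then have "V \<le> (\<Sum>i\<in>{1..n}. \<Sum>p\<in>{1..n}. ind i p + 4 * ?s i p)"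
    unfolding V_def by (intro sum_mono)
  also have "\<dots> = m + 4 * ((\<Sum>i\<in>{1..n}. \<Sum>p\<in>{1..n}. (err i p)\<^sup>2) + (real n)\<^sup>2 * (m / (real n)\<^sup>2)\<^sup>2
      + real n * (\<Sum>i\<in>{1..n}. (R i / real n)\<^sup>2) + real n * (\<Sum>p\<in>{1..n}. (C p / real n)\<^sup>2))"
    unfolding m_def[symmetric] sum.distrib sum_distrib_left[symmetric]
    by (simp add: power2_eq_square[of "real n"] sum_distrib_left)
  also have "(real n)\<^sup>2 * (m / (real n)\<^sup>2)\<^sup>2 \<le> 256 * (\<kappa>\<^sup>2 / real n)"
  proof -
    have "(real n)\<^sup>2 * (m / (real n)\<^sup>2)\<^sup>2 = m\<^sup>2 / (real n)\<^sup>2"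
      using n_pos by (simp add: power2_eq_square)
    also have "\<dots> \<le> (16 * \<kappa>)\<^sup>2 / (real n)\<^sup>2"
      using m_bounds[OF assms] by (intro divide_right_mono power_mono) auto
    also have "\<dots> \<le> (16 * \<kappa>)\<^sup>2 / real n"
      using n_pos by (intro divide_left_mono) (auto simp: power2_eq_square)
    finally show ?thesis
      by (simp add: power_mult_distrib)
  qed
  also have "real n * (\<Sum>i\<in>{1..n}. (R i / real n)\<^sup>2) = (\<Sum>i\<in>{1..n}. (R i)\<^sup>2) / real n"
    using n_pos by (simp add: power_divide sum_divide_distrib[symmetric] power2_eq_square[of "real n"])
  also have "\<dots> \<le> 32 * \<kappa>\<^sup>2 / real n"
    using sum_R_C_sq[OF assms] by (intro divide_right_mono) auto
  also have "real n * (\<Sum>p\<in>{1..n}. (C p / real n)\<^sup>2) = (\<Sum>p\<in>{1..n}. (C p)\<^sup>2) / real n"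
    using n_pos by (simp add: power_divide sum_divide_distrib[symmetric] power2_eq_square[of "real n"])
  also have "\<dots> \<le> 32 * \<kappa>\<^sup>2 / real n"
    using sum_R_C_sq[OF assms] by (intro divide_right_mono) auto
  finally show ?thesis
    using sum_err_sq by simp
qed

definition big :: "(nat \<times> nat) set" where
  "big = {x \<in> {1..n} \<times> {1..n}. 1 / 2 \<le> a (fst x) (snd x)}"

lemma sum_big:
  "(\<Sum>i\<in>{1..n}. \<Sum>p\<in>{1..n}. ind i p * f i p) = (\<Sum>x\<in>big. f (fst x) (snd x))"
proof -
  have "(\<Sum>x\<in>big. f (fst x) (snd x))
      = (\<Sum>x\<in>{1..n} \<times> {1..n}. if 1 / 2 \<le> a (fst x) (snd x) then f (fst x) (snd x) else 0)"
    unfolding big_def by (rule sum.inter_filter) simp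
  also have "\<dots> = (\<Sum>i\<in>{1..n}. \<Sum>p\<in>{1..n}. ind i p * f i p)"
    by (simp only: sum.cartesian_product' fst_conv snd_conv) (intro sum.cong refl, simp add: ind_def)
  finally show ?thesis ..
qed

lemma m_eq_card: "m = real (card big)"
  using sum_big[of "\<lambda>_ _. 1"] by (simp add: m_def)

text \<open>At a large entry 1 - a is at most |err| + R / n + C / n, the other terms of
  \<open>err\<close> having a favourable sign. Cauchy-Schwarz over the at most 16 \<kappa> large
  entries gives the square root.\<close>

lemma sum_defect_le:
  assumes "V \<le> \<kappa>"
  shows "(\<Sum>x\<in>big. 1 - a (fst x) (snd x)) \<le> 4 * sqrt (\<kappa> * T) + 64 * (\<kappa>\<^sup>2 / real n)"
proof -
  have T: "0 \<le> T"
    using sum_err_sq by (rule order_trans[rotated]) (intro sum_nonneg, auto)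
  have "ind i p * (1 - a i p) \<le> ind i p * \<bar>err i p\<bar> + ind i p * (R i / real n) + ind i p * (C p / real n)"
    if "i \<in> {1..n}" "p \<in> {1..n}" for i p
  proof (cases "1 / 2 \<le> a i p")
    case True
    have "0 \<le> m / (real n)\<^sup>2"
      using m_bounds[OF assms] by simp
    then show ?thesis
      using True \<kappa>_div by (simp add: ind_def err_def)
  qed (simp add: ind_def)
  then have "(\<Sum>i\<in>{1..n}. \<Sum>p\<in>{1..n}. ind i p * (1 - a i p))
      \<le> (\<Sum>i\<in>{1..n}. \<Sum>p\<in>{1..n}. ind i p * \<bar>err i p\<bar> + ind i p * (R i / real n) + ind i p * (C p / real n))"
    by (intro sum_mono)
  also have "\<dots> = (\<Sum>x\<in>big. \<bar>err (fst x) (snd x)\<bar>)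
      + (\<Sum>i\<in>{1..n}. \<Sum>p\<in>{1..n}. ind i p * (R i / real n)) + (\<Sum>i\<in>{1..n}. \<Sum>p\<in>{1..n}. ind i p * (C p / real n))"
    by (simp only: sum.distrib sum_big)
  also have "(\<Sum>i\<in>{1..n}. \<Sum>p\<in>{1..n}. ind i p * (R i / real n)) = (\<Sum>i\<in>{1..n}. (R i)\<^sup>2) / real n"
    unfolding sum_divide_distrib
    by (intro sum.cong refl) (simp only: sum_distrib_right[symmetric] R_def[symmetric], simp add: power2_eq_square)
  also have "(\<Sum>i\<in>{1..n}. \<Sum>p\<in>{1..n}. ind i p * (C p / real n)) = (\<Sum>p\<in>{1..n}. (C p)\<^sup>2) / real n"
    unfolding sum_divide_distrib
    by (subst sum.swap, intro sum.cong refl)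
      (simp only: sum_distrib_right[symmetric] C_def[symmetric], simp add: power2_eq_square)
  also have "(\<Sum>x\<in>big. \<bar>err (fst x) (snd x)\<bar>) \<le> 4 * sqrt (\<kappa> * T)"
  proof -
    have "(\<Sum>x\<in>big. \<bar>err (fst x) (snd x)\<bar>)\<^sup>2 \<le> real (card big) * (\<Sum>x\<in>big. (\<bar>err (fst x) (snd x)\<bar>)\<^sup>2)"
      by (rule sum_squared_le)
    also have "\<dots> \<le> (16 * \<kappa>) * T"
    proof (rule mult_mono)
      have "(\<Sum>x\<in>big. (\<bar>err (fst x) (snd x)\<bar>)\<^sup>2) \<le> (\<Sum>x\<in>{1..n}\<times>{1..n}. (err (fst x) (snd x))\<^sup>2)"
        by (simp only: power2_abs) (intro sum_mono2, auto simp: big_def)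
      also have "\<dots> \<le> T"
        using sum_err_sq by (simp add: sum.cartesian_product')
      finally show "(\<Sum>x\<in>big. (\<bar>err (fst x) (snd x)\<bar>)\<^sup>2) \<le> T" .
      show "real (card big) \<le> 16 * \<kappa>"
        using m_bounds(2)[OF assms] m_eq_card by linarith
    qed (use \<kappa>_nonneg in \<open>auto intro!: sum_nonneg\<close>)
    finally have "(\<Sum>x\<in>big. \<bar>err (fst x) (snd x)\<bar>)\<^sup>2 \<le> (4 * sqrt (\<kappa> * T))\<^sup>2"
      using \<kappa>_nonneg T by (simp add: power_mult_distrib)
    then show ?thesis
      by (rule power2_le_imp_le) (use \<kappa>_nonneg T in simp)
  qed
  also have "(\<Sum>i\<in>{1..n}. (R i)\<^sup>2) / real n \<le> 32 * \<kappa>\<^sup>2 / real n"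
    using sum_R_C_sq[OF assms] by (intro divide_right_mono) auto
  also have "(\<Sum>p\<in>{1..n}. (C p)\<^sup>2) / real n \<le> 32 * \<kappa>\<^sup>2 / real n"
    using sum_R_C_sq[OF assms] by (intro divide_right_mono) auto
  finally show ?thesis
    unfolding sum_big by simp
qed

end

section \<open>Projection of a family to the span of the coset indicators\<close>

lemma sum_Sym_linear_mult:
  "(\<Sum>\<pi>\<in>Sym n. (\<Sum>i\<in>{1..n}. z i (\<pi> i)) * g \<pi>)
    = (\<Sum>i\<in>{1..n}. \<Sum>j\<in>{1..n}. z i j * (\<Sum>\<pi>\<in>perm_coset n i j. g \<pi>) :: real)"
proof -
  have "(\<Sum>\<pi>\<in>Sym n. (\<Sum>i\<in>{1..n}. z i (\<pi> i)) * g \<pi>)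
      = (\<Sum>\<pi>\<in>Sym n. \<Sum>i\<in>{1..n}. \<Sum>j\<in>{1..n}. z i j * (g \<pi> * of_bool (\<pi> i = j)))"
  proof (rule sum.cong[OF refl])
    fix \<pi> assume \<pi>: "\<pi> \<in> Sym n"
    show "(\<Sum>i\<in>{1..n}. z i (\<pi> i)) * g \<pi>
        = (\<Sum>i\<in>{1..n}. \<Sum>j\<in>{1..n}. z i j * (g \<pi> * of_bool (\<pi> i = j)))"
      unfolding sum_Sym_linear[OF \<pi> finite_atLeastAtMost order_refl, of z] sum_distrib_right
      by (simp only: mult_ac)
  qed
  also have "\<dots> = (\<Sum>i\<in>{1..n}. \<Sum>\<pi>\<in>Sym n. \<Sum>j\<in>{1..n}. z i j * (g \<pi> * of_bool (\<pi> i = j)))"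
    by (rule sum.swap)
  also have "\<dots> = (\<Sum>i\<in>{1..n}. \<Sum>j\<in>{1..n}. \<Sum>\<pi>\<in>Sym n. z i j * (g \<pi> * of_bool (\<pi> i = j)))"
    by (intro sum.cong refl sum.swap)
  finally show ?thesis
    by (simp only: sum_distrib_left[symmetric] sum_perm_coset)
qed

text \<open>Within the coset, row \<open>i\<close> always contributes \<open>y i j\<close>, while
  another row takes each value except \<open>j\<close> equally often. This is the system that
  determines the coefficients of the projection.\<close>

lemma sum_coset_linear:
  assumes "i \<in> {1..n}" "j \<in> {1..n}" "n \<ge> 2"
    and row: "\<And>i. i \<in> {1..n} \<Longrightarrow> (\<Sum>j\<in>{1..n}. y i j) = \<rho>"
    and col: "\<And>j. j \<in> {1..n} \<Longrightarrow> (\<Sum>i\<in>{1..n}. y i j) = \<rho>"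
  shows "(\<Sum>\<pi>\<in>perm_coset n i j. \<Sum>l\<in>{1..n}. y l (\<pi> l)) = fact (n - 2) * (real n * y i j + (real n - 2) * \<rho>)"
proof -
  have fin: "finite (perm_coset n i j)"
    by (simp add: perm_coset_def finite_Sym)
  have other: "(\<Sum>\<pi>\<in>perm_coset n i j. y l (\<pi> l)) = fact (n - 2) * (\<rho> - y l j)"
    if l: "l \<in> {1..n} - {i}" for l
  proof -
    have "(\<lambda>\<pi>. \<pi> l) ` perm_coset n i j \<subseteq> {1..n}"
      using l Sym_in[of _ n l] by (auto simp: perm_coset_def)
    then have "(\<Sum>\<pi>\<in>perm_coset n i j. y l (\<pi> l))
        = (\<Sum>p\<in>{1..n}. \<Sum>\<pi>\<in>{\<pi> \<in> perm_coset n i j. \<pi> l = p}. y l (\<pi> l))"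
      by (subst sum.group[OF fin]) auto
    also have "\<dots> = (\<Sum>p\<in>{1..n}. real (card {\<pi> \<in> Sym n. \<pi> i = j \<and> \<pi> l = p}) * y l p)"
      by (intro sum.cong refl) (simp add: perm_coset_def conj_assoc)
    also have "\<dots> = (\<Sum>p\<in>{1..n} - {j}. fact (n - 2) * y l p)"
    proof (rule sum.mono_neutral_cong_right)
      show "\<forall>p\<in>{1..n} - ({1..n} - {j}). real (card {\<pi> \<in> Sym n. \<pi> i = j \<and> \<pi> l = p}) * y l p = 0"
      proof
        fix p assume "p \<in> {1..n} - ({1..n} - {j})"
        then have "p = j"
          by blast
        then have "{\<pi> \<in> Sym n. \<pi> i = j \<and> \<pi> l = p} = {}"
          using Sym_inj l by blast
        then show "real (card {\<pi> \<in> Sym n. \<pi> i = j \<and> \<pi> l = p}) * y l p = 0"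
          by (simp only: card.empty)
      qed
      show "real (card {\<pi> \<in> Sym n. \<pi> i = j \<and> \<pi> l = p}) * y l p = fact (n - 2) * y l p"
        if "p \<in> {1..n} - {j}" for p
        using card_perm_two_cosets[of i n j l p] assms(1,2) l that by (auto simp: numeral_2_eq_2)
    qed auto
    also have "\<dots> = fact (n - 2) * (\<rho> - y l j)"
      using row[of l] l assms(2) by (simp add: sum_distrib_left[symmetric] sum_diff1)
    finally show ?thesis .
  qed
  have "(\<Sum>\<pi>\<in>perm_coset n i j. \<Sum>l\<in>{1..n}. y l (\<pi> l))
      = (\<Sum>l\<in>{1..n}. \<Sum>\<pi>\<in>perm_coset n i j. y l (\<pi> l))"
    by (rule sum.swap)
  also have "\<dots> = (\<Sum>\<pi>\<in>perm_coset n i j. y i (\<pi> i))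
      + (\<Sum>l\<in>{1..n} - {i}. \<Sum>\<pi>\<in>perm_coset n i j. y l (\<pi> l))"
    using assms(1) by (intro sum.remove) auto
  also have "(\<Sum>\<pi>\<in>perm_coset n i j. y i (\<pi> i)) = (\<Sum>\<pi>\<in>perm_coset n i j. y i j)"
    by (intro sum.cong refl) (simp add: perm_coset_def)
  also have "\<dots> = fact (n - 1) * y i j"
    using card_perm_coset[OF assms(1,2)] by simp
  also have "(\<Sum>l\<in>{1..n} - {i}. \<Sum>\<pi>\<in>perm_coset n i j. y l (\<pi> l))
      = (\<Sum>l\<in>{1..n} - {i}. fact (n - 2) * (\<rho> - y l j))"
    by (intro sum.cong refl other)
  also have "\<dots> = fact (n - 2) * (real (card ({1..n} - {i})) * \<rho> - (\<Sum>l\<in>{1..n} - {i}. y l j))"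
    by (simp only: sum_distrib_left[symmetric] sum_subtractf sum_constant)
  also have "(\<Sum>l\<in>{1..n} - {i}. y l j) = \<rho> - y i j"
    using assms(1) col[OF assms(2)] by (simp add: sum_diff1)
  also have "real (card ({1..n} - {i})) = real n - 1"
    using assms(1,3) by (simp add: of_nat_diff)
  also have "fact (n - 1) = (real n - 1) * fact (n - 2)"
    using assms(3) fact_reduce[of "n - 1", where 'a = real] by (simp add: of_nat_diff numeral_2_eq_2)
  finally show ?thesis
    by (simp add: algebra_simps)
qed

section \<open>Coset densities, projection and remainder of a family\<close>

locale perm_family =
  fixes n :: nat and F :: "(nat \<Rightarrow> nat) set" and \<kappa> :: real
  assumes n: "17 \<le> n" and F: "F \<subseteq> Sym n" and card_F: "real (card F) = \<kappa> * fact (n - 1)"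
begin

definition a :: "nat \<Rightarrow> nat \<Rightarrow> real" where
  "a i j = real (card (F \<inter> perm_coset n i j)) / fact (n - 1)"

text \<open>The coefficients \<open>y\<close> of the projection up to an additive constant, which
  switch differences do not see. Unlike \<open>y\<close>, this matrix has all entries in [0, 1], as
  \<open>near_integral_matrix\<close> demands.\<close>

definition a' :: "nat \<Rightarrow> nat \<Rightarrow> real" where
  "a' i j = (real n - 1) / real n * a i j"

text \<open>The projection of the indicator of \<open>F\<close> to the span of the coset indicators is
  \<open>\<lambda>\<pi>. \<Sum>i\<in>{1..n}. y i (\<pi> i)\<close>.\<close>

definition y :: "nat \<Rightarrow> nat \<Rightarrow> real" where
  "y i j = a' i j - (real n - 2) * \<kappa> / (real n)\<^sup>2"

definition u :: "(nat \<Rightarrow> nat) \<Rightarrow> real" where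
  "u \<pi> = (\<Sum>i\<in>{1..n}. y i (\<pi> i))"

definition h :: "(nat \<Rightarrow> nat) \<Rightarrow> real" where
  "h \<pi> = of_bool (\<pi> \<in> F) - u \<pi>"

text \<open>The squared norm of the remainder \<open>h\<close> in units of
  \<open>fact (n - 1)\<close>, in closed form; see \<open>sum_h_sq\<close>.\<close>

definition \<tau> :: real where
  "\<tau> = \<kappa> - (real n - 1) / real n * (\<Sum>i\<in>{1..n}. \<Sum>j\<in>{1..n}. (a i j)\<^sup>2) + (real n - 2) * \<kappa>\<^sup>2 / real n"

lemma finite_F: "finite F"
  using F finite_Sym finite_subset by blast

lemma sum_F: "(\<Sum>\<pi>\<in>Sym n. of_bool (\<pi> \<in> F)) = \<kappa> * fact (n - 1)"
proof -
  have "{\<pi> \<in> Sym n. \<pi> \<in> F} = F"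
    using F by auto
  then show ?thesis
    by (simp add: sum_of_bool_card[OF finite_Sym] card_F)
qed

lemma sum_coset_F: "(\<Sum>\<pi>\<in>perm_coset n i j. of_bool (\<pi> \<in> F)) = fact (n - 1) * a i j"
proof -
  have "{\<pi> \<in> perm_coset n i j. \<pi> \<in> F} = F \<inter> perm_coset n i j"
    by auto
  moreover have "finite (perm_coset n i j)"
    by (simp add: perm_coset_def finite_Sym)
  ultimately show ?thesis
    by (simp add: sum_of_bool_card a_def)
qed

lemma a_bounds:
  assumes "i \<in> {1..n}" "j \<in> {1..n}"
  shows "0 \<le> a i j" "a i j \<le> 1"
proof -
  have "card (F \<inter> perm_coset n i j) \<le> card (perm_coset n i j)"
    by (intro card_mono) (auto simp: perm_coset_def finite_Sym)
  then have "real (card (F \<inter> perm_coset n i j)) \<le> fact (n - 1)"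
    using card_perm_coset[OF assms] by (metis of_nat_fact of_nat_le_iff)
  then show "0 \<le> a i j" "a i j \<le> 1"
    by (simp_all add: a_def)
qed

lemma a_row:
  assumes "i \<in> {1..n}"
  shows "(\<Sum>j\<in>{1..n}. a i j) = \<kappa>"
proof -
  have "fact (n - 1) * (\<Sum>j\<in>{1..n}. a i j) = fact (n - 1) * \<kappa>"
    using sum_Sym_by_value[OF assms, of "\<lambda>\<pi>. of_bool (\<pi> \<in> F)"]
    by (simp only: sum_coset_F sum_F sum_distrib_left[symmetric] mult.commute)
  then show ?thesis
    by simp
qed

lemma a_col:
  assumes "j \<in> {1..n}"
  shows "(\<Sum>i\<in>{1..n}. a i j) = \<kappa>"
proof -
  have "(\<Sum>i\<in>{1..n}. of_bool (\<pi> i = j)) = (1::real)" if "\<pi> \<in> Sym n" for \<pi>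
  proof -
    have "{i \<in> {1..n}. \<pi> i = j} = {inv \<pi> j}"
      using assms that Sym_in[OF Sym_inv[OF that], of j] Sym_inverses[OF that]
      by (auto simp del: atLeastAtMost_iff)
    then show ?thesis
      by (simp add: sum_of_bool_card)
  qed
  then have "(\<Sum>\<pi>\<in>Sym n. of_bool (\<pi> \<in> F)) = (\<Sum>\<pi>\<in>Sym n. of_bool (\<pi> \<in> F) * (\<Sum>i\<in>{1..n}. of_bool (\<pi> i = j)) :: real)"
    by (intro sum.cong refl) simp
  also have "\<dots> = (\<Sum>i\<in>{1..n}. \<Sum>\<pi>\<in>perm_coset n i j. of_bool (\<pi> \<in> F))"
    unfolding sum_distrib_left sum_perm_coset by (rule sum.swap)
  finally have "fact (n - 1) * (\<Sum>i\<in>{1..n}. a i j) = fact (n - 1) * \<kappa>"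
    by (simp only: sum_coset_F sum_F sum_distrib_left[symmetric] mult.commute)
  then show ?thesis
    by simp
qed

lemma a'_bounds:
  assumes "i \<in> {1..n}" "j \<in> {1..n}"
  shows "0 \<le> a' i j" "a' i j \<le> a i j"
proof -
  have r: "0 \<le> (real n - 1) / real n" "(real n - 1) / real n \<le> 1"
    using n by auto
  show "0 \<le> a' i j"
    unfolding a'_def using a_bounds[OF assms] r by (intro mult_nonneg_nonneg)
  show "a' i j \<le> a i j"
    unfolding a'_def using a_bounds[OF assms] r by (intro mult_left_le_one_le)
qed

lemma a'_row: "i \<in> {1..n} \<Longrightarrow> (\<Sum>j\<in>{1..n}. a' i j) = (real n - 1) / real n * \<kappa>"
  by (simp only: a'_def sum_distrib_left[symmetric] a_row)

lemma a'_col: "j \<in> {1..n} \<Longrightarrow> (\<Sum>i\<in>{1..n}. a' i j) = (real n - 1) / real n * \<kappa>"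
  by (simp only: a'_def sum_distrib_left[symmetric] a_col)

lemma y_row:
  assumes "i \<in> {1..n}"
  shows "(\<Sum>j\<in>{1..n}. y i j) = \<kappa> / real n"
proof -
  have "(\<Sum>j\<in>{1..n}. y i j) = (real n - 1) / real n * \<kappa> - real n * ((real n - 2) * \<kappa> / (real n)\<^sup>2)"
    by (simp only: y_def sum_subtractf a'_row[OF assms]) simp
  also have "\<dots> = \<kappa> / real n"
    using n by (simp add: power2_eq_square field_simps)
  finally show ?thesis .
qed

lemma y_col:
  assumes "j \<in> {1..n}"
  shows "(\<Sum>i\<in>{1..n}. y i j) = \<kappa> / real n"
proof -
  have "(\<Sum>i\<in>{1..n}. y i j) = (real n - 1) / real n * \<kappa> - real n * ((real n - 2) * \<kappa> / (real n)\<^sup>2)"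
    by (simp only: y_def sum_subtractf a'_col[OF assms]) simp
  also have "\<dots> = \<kappa> / real n"
    using n by (simp add: power2_eq_square field_simps)
  finally show ?thesis .
qed

lemma sum_coset_h:
  assumes "i \<in> {1..n}" "j \<in> {1..n}"
  shows "(\<Sum>\<pi>\<in>perm_coset n i j. h \<pi>) = 0"
proof -
  have fct: "fact (n - 1) = (real n - 1) * fact (n - 2)"
    using n fact_reduce[of "n - 1", where 'a = real] by (simp add: of_nat_diff numeral_2_eq_2)
  have "(\<Sum>\<pi>\<in>perm_coset n i j. u \<pi>) = fact (n - 2) * (real n * y i j + (real n - 2) * (\<kappa> / real n))"
    unfolding u_def using n by (intro sum_coset_linear assms y_row y_col) auto
  \<comment> \<open>With row sums \<kappa> / n, this equation is what fixes the constant subtracted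
    in \<open>y\<close>.\<close>
  also have "real n * y i j + (real n - 2) * (\<kappa> / real n) = (real n - 1) * a i j"
    using n by (simp add: y_def a'_def right_diff_distrib power2_eq_square)
  also have "fact (n - 2) * ((real n - 1) * a i j) = fact (n - 1) * a i j"
    unfolding fct by simp
  finally show ?thesis
    by (simp add: h_def sum_subtractf sum_coset_F)
qed

lemma sum_linear_h: "(\<Sum>\<pi>\<in>Sym n. (\<Sum>i\<in>{1..n}. z i (\<pi> i)) * h \<pi>) = 0"
  unfolding sum_Sym_linear_mult by (intro sum.neutral ballI) (simp add: sum_coset_h del: atLeastAtMost_iff)

lemma sum_u_F: "(\<Sum>\<pi>\<in>Sym n. u \<pi> * of_bool (\<pi> \<in> F)) = (\<kappa> - \<tau>) * fact (n - 1)"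
proof -
  have "(\<Sum>\<pi>\<in>Sym n. u \<pi> * of_bool (\<pi> \<in> F)) = (\<Sum>i\<in>{1..n}. \<Sum>j\<in>{1..n}. y i j * (fact (n - 1) * a i j))"
    unfolding u_def sum_Sym_linear_mult[of y n "\<lambda>\<pi>. of_bool (\<pi> \<in> F)"] sum_coset_F ..
  also have "\<dots> = fact (n - 1) * (\<Sum>i\<in>{1..n}. \<Sum>j\<in>{1..n}.
      (real n - 1) / real n * (a i j)\<^sup>2 - (real n - 2) * \<kappa> / (real n)\<^sup>2 * a i j)"
    unfolding sum_distrib_left
    by (intro sum.cong refl) (simp add: y_def a'_def power2_eq_square algebra_simps)
  also have "(\<Sum>i\<in>{1..n}. \<Sum>j\<in>{1..n}.
      (real n - 1) / real n * (a i j)\<^sup>2 - (real n - 2) * \<kappa> / (real n)\<^sup>2 * a i j)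
      = (real n - 1) / real n * (\<Sum>i\<in>{1..n}. \<Sum>j\<in>{1..n}. (a i j)\<^sup>2)
        - (real n - 2) * \<kappa> / (real n)\<^sup>2 * (\<Sum>i\<in>{1..n}. \<Sum>j\<in>{1..n}. a i j)"
    by (simp only: sum_subtractf sum_distrib_left[symmetric])
  also have "(\<Sum>i\<in>{1..n}. \<Sum>j\<in>{1..n}. a i j) = real n * \<kappa>"
  proof -
    have "(\<Sum>i\<in>{1..n}. \<Sum>j\<in>{1..n}. a i j) = (\<Sum>i\<in>{1..n}. \<kappa>)"
      by (intro sum.cong refl a_row)
    then show ?thesis
      by simp
  qed
  also have "(real n - 2) * \<kappa> / (real n)\<^sup>2 * (real n * \<kappa>) = (real n - 2) * \<kappa>\<^sup>2 / real n"
    using n by (simp add: power2_eq_square)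
  finally show ?thesis
    by (simp add: \<tau>_def mult.commute)
qed

lemma sum_h_sq: "(\<Sum>\<pi>\<in>Sym n. (h \<pi>)\<^sup>2) = \<tau> * fact (n - 1)"
proof -
  have "(h \<pi>)\<^sup>2 = of_bool (\<pi> \<in> F) - u \<pi> * of_bool (\<pi> \<in> F) - u \<pi> * h \<pi>" for \<pi>
    by (simp add: h_def power2_eq_square algebra_simps)
  then have "(\<Sum>\<pi>\<in>Sym n. (h \<pi>)\<^sup>2) = \<kappa> * fact (n - 1) - (\<kappa> - \<tau>) * fact (n - 1) - (\<Sum>\<pi>\<in>Sym n. u \<pi> * h \<pi>)"
    by (simp add: sum_subtractf sum_F sum_u_F)
  then show ?thesis
    using sum_linear_h[of y] by (simp add: u_def algebra_simps)
qed

lemma \<tau>_nonneg: "0 \<le> \<tau>"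
proof -
  have "0 \<le> \<tau> * fact (n - 1)"
    unfolding sum_h_sq[symmetric] by (intro sum_nonneg) auto
  then show ?thesis
    by (metis fact_gt_zero mult_neg_pos not_le)
qed

lemma dp_lower_bound:
  "real (derangement_sum (n - 1)) * fact (n - 1) * (\<kappa>\<^sup>2 - \<kappa> + \<tau> / 5) \<le> 2 * real (dp n F)"
proof -
  let ?D = "real (derangement_sum (n - 1))" and ?K = "\<lambda>\<sigma> \<pi>. of_bool (disjoint_perms n \<sigma> \<pi>) :: real"
  have sum_y: "(\<Sum>i\<in>{1..n}. \<Sum>j\<in>{1..n}. y i j) = \<kappa>"
  proof -
    have "(\<Sum>i\<in>{1..n}. \<Sum>j\<in>{1..n}. y i j) = (\<Sum>i\<in>{1..n}. \<kappa> / real n)"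
      by (intro sum.cong refl y_row)
    then show ?thesis
      using n by simp
  qed
  have Ku: "(\<Sum>\<pi>\<in>Sym n. ?K \<sigma> \<pi> * u \<pi>) = ?D * (\<kappa> - u \<sigma>)" if "\<sigma> \<in> Sym n" for \<sigma>
    unfolding u_def sum_disjoint_linear[OF that] sum_y ..
  have "2 * real (dp n F) = disjoint_form n (\<lambda>\<pi>. u \<pi> + h \<pi>)"
    using disjoint_form_indicator[OF _ F] n by (simp add: h_def)
  also have "\<dots> = (\<Sum>\<sigma>\<in>Sym n. (u \<sigma> + h \<sigma>) * (?D * (\<kappa> - u \<sigma>)))
      + (\<Sum>\<sigma>\<in>Sym n. h \<sigma> * (?D * (\<kappa> - u \<sigma>))) + disjoint_form n h"
    by (subst quad_form_split_sym) (simp_all add: Ku disjoint_perms_commute)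
  also have "(\<Sum>\<sigma>\<in>Sym n. (u \<sigma> + h \<sigma>) * (?D * (\<kappa> - u \<sigma>)))
      = (\<Sum>\<sigma>\<in>Sym n. ?D * (\<kappa> * of_bool (\<sigma> \<in> F) - u \<sigma> * of_bool (\<sigma> \<in> F)))"
    by (intro sum.cong refl) (simp add: h_def algebra_simps)
  also have "\<dots> = ?D * (\<kappa> * (\<kappa> * fact (n - 1)) - (\<kappa> - \<tau>) * fact (n - 1))"
    by (simp only: sum_distrib_left[symmetric] sum_subtractf sum_F sum_u_F)
  also have "(\<Sum>\<sigma>\<in>Sym n. h \<sigma> * (?D * (\<kappa> - u \<sigma>))) = 0"
  proof -
    have "\<kappa> - u \<sigma> = (\<Sum>i\<in>{1..n}. \<kappa> / real n - y i (\<sigma> i))" for \<sigma>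
      using n by (simp add: u_def sum_subtractf)
    then have "(\<Sum>\<sigma>\<in>Sym n. h \<sigma> * (?D * (\<kappa> - u \<sigma>)))
        = ?D * (\<Sum>\<sigma>\<in>Sym n. (\<Sum>i\<in>{1..n}. \<kappa> / real n - y i (\<sigma> i)) * h \<sigma>)"
      by (simp add: sum_distrib_left mult_ac)
    then show ?thesis
      using sum_linear_h[of "\<lambda>i j. \<kappa> / real n - y i j"] by simp
  qed
  finally have eq: "2 * real (dp n F) = ?D * fact (n - 1) * (\<kappa>\<^sup>2 - \<kappa> + \<tau>) + disjoint_form n h"
    by (simp add: algebra_simps power2_eq_square)
  have "fact n / (4 * (real n - 2)) \<le> 4 / 5 * ?D"
  proof -
    have "fact n * 5 \<le> 3 * (real n - 1) * ?D * 5"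
      using derangement_sum_ge[of n] n by simp
    also have "\<dots> = (15 * (real n - 1)) * ?D"
      by simp
    \<comment> \<open>Here \<open>n \<ge> 17\<close> enters: it is equivalent to 15 (n - 1) \<le> 16
      (n - 2).\<close>
    also have "\<dots> \<le> (16 * (real n - 2)) * ?D"
      using n by (intro mult_right_mono) auto
    finally show ?thesis
      using n by (simp add: field_simps)
  qed
  then have "fact n / (4 * (real n - 2)) * (\<tau> * fact (n - 1)) \<le> 4 / 5 * ?D * (\<tau> * fact (n - 1))"
    using \<tau>_nonneg by (intro mult_right_mono) auto
  moreover have "- (fact n / (4 * (real n - 2)) * (\<tau> * fact (n - 1))) \<le> disjoint_form n h"
    using disjoint_form_lower_bound[of n h, OF _ sum_coset_h] n unfolding sum_h_sq by simp
  ultimately show ?thesis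
    unfolding eq by (simp add: algebra_simps)
qed

lemma sum_a'_variance:
  "(\<Sum>i\<in>{1..n}. \<Sum>j\<in>{1..n}. (a' i j - (real n - 1) / real n * \<kappa> / real n)\<^sup>2)
    = (real n - 1) / real n * (\<kappa> - \<kappa>\<^sup>2 / real n - \<tau>)"
proof -
  define r where "r = (real n - 1) / real n"
  define S where "S = (\<Sum>i\<in>{1..n}. \<Sum>j\<in>{1..n}. (a i j)\<^sup>2)"
  have "(\<Sum>i\<in>{1..n}. \<Sum>j\<in>{1..n}. (a' i j - (real n - 1) / real n * \<kappa> / real n)\<^sup>2)
      = (\<Sum>i\<in>{1..n}. \<Sum>j\<in>{1..n}. r\<^sup>2 * ((a i j)\<^sup>2 - 2 * (\<kappa> / real n) * a i j + (\<kappa> / real n)\<^sup>2))"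
    by (intro sum.cong refl) (simp add: a'_def r_def[symmetric] power2_eq_square algebra_simps)
  also have "\<dots> = r\<^sup>2 * (S - 2 * (\<kappa> / real n) * (\<Sum>i\<in>{1..n}. \<Sum>j\<in>{1..n}. a i j) + real n * (real n * (\<kappa> / real n)\<^sup>2))"
    by (simp only: S_def sum_distrib_left[symmetric] sum_subtractf sum.distrib) simp
  also have "(\<Sum>i\<in>{1..n}. \<Sum>j\<in>{1..n}. a i j) = real n * \<kappa>"
  proof -
    have "(\<Sum>i\<in>{1..n}. \<Sum>j\<in>{1..n}. a i j) = (\<Sum>i\<in>{1..n}. \<kappa>)"
      by (intro sum.cong refl a_row)
    then show ?thesis
      by simp
  qed
  also have "r\<^sup>2 * (S - 2 * (\<kappa> / real n) * (real n * \<kappa>) + real n * (real n * (\<kappa> / real n)\<^sup>2)) = r * (r * S - r * \<kappa>\<^sup>2)"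
    using n by (simp add: power2_eq_square algebra_simps)
  also have "r * S - r * \<kappa>\<^sup>2 = \<kappa> - \<kappa>\<^sup>2 / real n - \<tau>"
  proof -
    have "\<tau> = \<kappa> - r * S + (real n - 2) * \<kappa>\<^sup>2 / real n"
      by (simp only: \<tau>_def S_def r_def)
    moreover have "r * \<kappa>\<^sup>2 = (real n - 2) * \<kappa>\<^sup>2 / real n + \<kappa>\<^sup>2 / real n"
      using n by (simp add: r_def field_simps)
    ultimately show ?thesis
      by simp
  qed
  finally show ?thesis
    by (simp add: r_def)
qed

lemma sum_switch_dist:
  "(\<Sum>i\<in>{1..n}. \<Sum>j\<in>{1..n}. \<Sum>p\<in>{1..n}. \<Sum>q\<in>{1..n}. (int_dist (switch_diff a' i j p q))\<^sup>2)
    \<le> 1024 * \<tau> * (real n)\<^sup>2"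
proof -
  define X where "X = (\<Sum>i\<in>{1..n}. \<Sum>j\<in>{1..n}. \<Sum>p\<in>{1..n}. \<Sum>q\<in>{1..n}. (int_dist (switch_diff a' i j p q))\<^sup>2)"
  \<comment> \<open>The constant by which \<open>y\<close> differs from \<open>a'\<close>, summed
    over the n rows; it becomes the constant term of the affine function.\<close>
  define c where "c = - (real n * ((real n - 2) * \<kappa> / (real n)\<^sup>2))"
  have "h \<pi> = of_bool (\<pi> \<in> F) - (c + (\<Sum>i\<in>{1..n}. a' i (\<pi> i)))" for \<pi>
    by (simp add: h_def u_def y_def sum_subtractf c_def)
  then have "fact (n - 2) * X \<le> 1024 * real n * (\<Sum>\<pi>\<in>Sym n. (h \<pi>)\<^sup>2)"
    unfolding X_def using switch_sum_bound[of n a' "\<lambda>\<pi>. \<pi> \<in> F" c] by (simp only:)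
  also have "\<dots> = fact (n - 2) * (1024 * \<tau> * (real n * (real n - 1)))"
    unfolding sum_h_sq using n fact_reduce[of "n - 1", where 'a = real]
    by (simp add: of_nat_diff numeral_2_eq_2)
  finally have "X \<le> 1024 * \<tau> * (real n * (real n - 1))"
    by simp
  also have "\<dots> \<le> 1024 * \<tau> * (real n)\<^sup>2"
    using \<tau>_nonneg by (intro mult_left_mono) (auto simp: power2_eq_square right_diff_distrib)
  finally show ?thesis
    unfolding X_def .
qed

end

section \<open>Approximation by a union of cosets\<close>

lemma card_coset_inter_le:
  assumes "x \<in> {1..n} \<times> {1..n}" "x' \<in> {1..n} \<times> {1..n}" "x \<noteq> x'"
  shows "card (case_prod (perm_coset n) x \<inter> case_prod (perm_coset n) x') \<le> fact (n - 2)"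
proof -
  obtain i j i' j' where x: "x = (i, j)" "x' = (i', j')"
    by (metis surj_pair)
  have eq: "perm_coset n i j \<inter> perm_coset n i' j' = {\<pi> \<in> Sym n. \<pi> i = j \<and> \<pi> i' = j'}"
    by (auto simp: perm_coset_def)
  show ?thesis
  proof (cases "i = i' \<longleftrightarrow> j = j'")
    case True
    then have "i \<noteq> i'"
      using assms(3) x by auto
    then show ?thesis
      using card_perm_two_cosets[of i n j i' j'] True assms x eq by (simp add: numeral_2_eq_2)
  next
    case False
    then have "\<not> (\<pi> \<in> Sym n \<and> \<pi> i = j \<and> \<pi> i' = j')" for \<pi>
      using Sym_inj[of \<pi> n i i'] by metis
    then have none: "{\<pi> \<in> Sym n. \<pi> i = j \<and> \<pi> i' = j'} = {}"
      by blast
    show ?thesis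
      unfolding x case_prod_conv eq none by simp
  qed
qed

lemma perm_cosets_eq_image: "perm_cosets n = case_prod (perm_coset n) ` ({1..n} \<times> {1..n})"
  by (auto simp: perm_cosets_def simp del: atLeastAtMost_iff)

text \<open>Distinct cosets meet in at most (n - 2)! permutations, fewer than a coset contains once
  \<open>n \<ge> 3\<close>. For n = 2 the index pairs (1, 1) and (2, 2) give the same coset.\<close>

lemma inj_on_perm_coset:
  assumes "n \<ge> 3"
  shows "inj_on (case_prod (perm_coset n)) ({1..n} \<times> {1..n})"
proof (rule inj_onI, rule ccontr)
  fix x x' assume x: "x \<in> {1..n} \<times> {1..n}" "x' \<in> {1..n} \<times> {1..n}"
    "case_prod (perm_coset n) x = case_prod (perm_coset n) x'" "x \<noteq> x'"
  have "card (case_prod (perm_coset n) x) = fact (n - 1)"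
    using x(1) card_perm_coset by auto
  moreover have "card (case_prod (perm_coset n) x) \<le> fact (n - 2)"
    using card_coset_inter_le[OF x(1,2,4)] x(3) by simp
  moreover have "(fact (n - 2) :: nat) < fact (n - 1)"
    using assms by (intro fact_less_mono_nat) auto
  ultimately show False
    by simp
qed

lemma card_Union_cosets_ge:
  assumes "finite X" "X \<subseteq> {1..n} \<times> {1..n}"
  shows "real (card X) * fact (n - 1) - (real (card X))\<^sup>2 * fact (n - 2)
    \<le> real (card (\<Union>x\<in>X. case_prod (perm_coset n) x))"
  using assms
proof (induction X rule: finite_induct)
  case (insert x X)
  let ?T = "case_prod (perm_coset n)" and ?U = "\<Union>x\<in>X. case_prod (perm_coset n) x"
  have fin: "finite (?T y)" for y
    by (auto simp: perm_coset_def finite_Sym split: prod.split)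
  have "card (?T x \<inter> ?U) \<le> (\<Sum>y\<in>X. card (?T x \<inter> ?T y))"
    unfolding Int_UN_distrib by (rule card_UN_le[OF insert.hyps(1)])
  also have "\<dots> \<le> (\<Sum>y\<in>X. fact (n - 2))"
    using insert by (intro sum_mono card_coset_inter_le) auto
  finally have int: "card (?T x \<inter> ?U) \<le> card X * fact (n - 2)"
    by simp
  have Tx: "card (?T x) = fact (n - 1)"
    using insert.prems card_perm_coset by auto
  have "card (?T x) + card ?U = card (?T x \<union> ?U) + card (?T x \<inter> ?U)"
    using insert.hyps(1) fin by (intro card_Un_Int) auto
  then have "fact (n - 1) + real (card ?U) = real (card (?T x \<union> ?U)) + real (card (?T x \<inter> ?U))"
    using Tx by (metis of_nat_add of_nat_fact)
  moreover have "real (card (?T x \<inter> ?U)) \<le> real (card X) * fact (n - 2)"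
    using int by (metis of_nat_fact of_nat_le_iff of_nat_mult)
  ultimately have "real (card (?T x \<union> ?U)) \<ge> fact (n - 1) + real (card ?U) - real (card X) * fact (n - 2)"
    by linarith
  moreover have "real (card X) * fact (n - 1) - (real (card X))\<^sup>2 * fact (n - 2) \<le> real (card ?U)"
    using insert by auto
  moreover have "(real (card X))\<^sup>2 * fact (n - 2) + real (card X) * fact (n - 2)
      \<le> (real (card X) + 1)\<^sup>2 * (fact (n - 2) :: real)"
    unfolding distrib_right[symmetric] by (intro mult_right_mono) (auto simp: power2_eq_square algebra_simps)
  ultimately show ?case
    using insert.hyps by (simp add: algebra_simps)
qed simp

text \<open>The number of large entries is only estimated from below: if there are too many,
  \<open>k\<close> of them are chosen, otherwise all are kept and the set is padded.\<close>

lemma exists_card_between: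
  assumes "finite S" "B \<subseteq> S" "k \<le> card S"
  obtains B' where "B' \<subseteq> S" "card B' = k" "real (card (B' - B)) \<le> max 0 (real k - real (card B))"
proof (cases "k \<le> card B")
  case True
  then obtain B' where B': "B' \<subseteq> B" "card B' = k"
    by (meson obtain_subset_with_card_n)
  moreover from B' have "card (B' - B) = 0"
    by (metis Diff_eq_empty_iff card.empty)
  ultimately show ?thesis
    using that[of B'] assms(2) by auto
next
  case False
  then obtain B' where B': "B \<subseteq> B'" "B' \<subseteq> S" "card B' = k"
    using exists_subset_between[of B k S] assms by auto
  then have "card (B' - B) = k - card B"
    using assms finite_subset by (metis card_Diff_subset)
  then show ?thesis
    using that[of B'] B' False by auto
qed

context perm_family
begin

text \<open>The cutoff for \<open>w\<close> gives 1024 * 10 * w < 1/512, and 384 k \<le> n gives 192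
  \<kappa> \<le> n, so the matrix \<open>a'\<close> qualifies for
  \<open>near_integral_matrix\<close>. All errors are then collected as multiples of
  \<open>X\<close> and \<open>Y\<close>.\<close>

lemma close_to_cosets:
  assumes k: "1 \<le> k" "384 * real k \<le> real n" and w: "\<bar>\<kappa> - real k\<bar> \<le> w" "\<tau> \<le> 10 * w" "w \<le> 1 / 10 ^ 7"
  obtains K where "K \<subseteq> perm_cosets n" "card K = k"
    "real (card (sym_diff F (\<Union>K))) \<le> 10 ^ 5 * ((real k)\<^sup>2 / real n + real k * sqrt (real k * w)) * fact (n - 1)"
proof -
  define X where "X = (real k)\<^sup>2 / real n"
  define Y where "Y = real k * sqrt (real k * w)"
  define \<kappa>' where "\<kappa>' = (real n - 1) / real n * \<kappa>"
  have w0: "0 \<le> w"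
    using w(1) by linarith
  have \<kappa>: "0 \<le> \<kappa>" "\<kappa> \<le> 2 * real k" "192 * \<kappa> \<le> real n"
    using k w n by auto
  have r: "0 \<le> (real n - 1) / real n" "(real n - 1) / real n \<le> 1"
    using n by auto
  have "0 \<le> \<kappa>'"
    unfolding \<kappa>'_def using r \<kappa> by (intro mult_nonneg_nonneg)
  moreover have "\<kappa>' \<le> \<kappa>"
    unfolding \<kappa>'_def using r \<kappa> by (intro mult_left_le_one_le)
  ultimately have \<kappa>': "0 \<le> \<kappa>'" "\<kappa>' \<le> \<kappa>" .
  have "\<kappa>\<^sup>2 \<le> (2 * real k)\<^sup>2"
    using \<kappa> by (intro power_mono) auto
  then have \<kappa>_sq: "\<kappa>\<^sup>2 / real n \<le> 4 * X"
    unfolding X_def by (simp add: divide_right_mono power_mult_distrib)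
  have "\<kappa>'\<^sup>2 / real n \<le> \<kappa>\<^sup>2 / real n"
    using \<kappa>' by (intro divide_right_mono power_mono) auto
  then have \<kappa>'_sq: "\<kappa>'\<^sup>2 / real n \<le> 4 * X"
    using \<kappa>_sq by linarith
  have "real k * 1 \<le> real k * real k"
    using k(1) by (intro mult_left_mono) auto
  then have "\<kappa> / real n \<le> 2 * (real k * real k) / real n"
    using \<kappa>(2) by (intro divide_right_mono) auto
  then have \<kappa>_n: "\<kappa> / real n \<le> 2 * X"
    by (simp add: X_def power2_eq_square)
  have sqrt_Y: "sqrt (real k * w) \<le> Y"
    using k(1) w0 mult_right_mono[of 1 "real k" "sqrt (real k * w)"] by (simp add: Y_def)
  have w_Y: "w \<le> Y"
  proof -
    have "w * w \<le> 1 * w"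
      using w0 w(3) by (intro mult_right_mono) auto
    also have "\<dots> \<le> real k * w"
      using w0 k(1) by (intro mult_right_mono) auto
    finally have "w \<le> sqrt (real k * w)"
      by (intro real_le_rsqrt) (simp add: power2_eq_square)
    then show ?thesis
      using sqrt_Y by linarith
  qed
  interpret near_integral_matrix n a' \<kappa>' "1024 * \<tau>"
  proof
    show "0 \<le> a' i j \<and> a' i j \<le> 1" if "i \<in> {1..n}" "j \<in> {1..n}" for i j
      using a'_bounds[OF that] a_bounds[OF that] by linarith
    show "192 * \<kappa>' \<le> real n"
      using \<kappa>' \<kappa> by linarith
    show "1024 * \<tau> < 1 / 512"
      using w by simp
    show "1 \<le> n"
      using n by simp
  qed (auto simp only: \<kappa>'_def intro!: a'_row a'_col sum_switch_dist)
  have V: "V = (real n - 1) / real n * (\<kappa> - \<kappa>\<^sup>2 / real n - \<tau>)"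
    unfolding V_def unfolding \<kappa>'_def by (rule sum_a'_variance)
  have "0 \<le> \<kappa>\<^sup>2 / real n"
    by simp
  then have le_\<kappa>: "\<kappa> - \<kappa>\<^sup>2 / real n - \<tau> \<le> \<kappa>"
    using \<tau>_nonneg by linarith
  then have V_le: "V \<le> \<kappa>'"
    unfolding V unfolding \<kappa>'_def using r by (intro mult_left_mono)
  have "V \<ge> \<kappa> - \<kappa>\<^sup>2 / real n - \<tau> - \<kappa> / real n"
  proof -
    define Z where "Z = \<kappa> - \<kappa>\<^sup>2 / real n - \<tau>"
    have "V = Z - Z / real n"
      unfolding V Z_def[symmetric] using n by (simp add: field_simps)
    moreover have "Z / real n \<le> \<kappa> / real n"
      using le_\<kappa> by (intro divide_right_mono) (auto simp: Z_def)
    ultimately show ?thesis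
      by (simp add: Z_def)
  qed
  then have big_ge: "real k - (40971 * Y + 5126 * X) \<le> real (card big)"
    using m_ge[OF V_le] w w_Y \<kappa>_sq \<kappa>'_sq \<kappa>_n unfolding m_eq_card by linarith
  have defect: "(\<Sum>x\<in>big. 1 - a' (fst x) (snd x)) \<le> 576 * Y + 256 * X"
  proof -
    have "\<kappa>' * (1024 * \<tau>) \<le> (2 * real k) * (10240 * w)"
      by (rule mult_mono) (use \<kappa>' \<kappa> \<tau>_nonneg w in auto)
    \<comment> \<open>A perfect square just above 2 * 10240.\<close>
    also have "\<dots> \<le> 144\<^sup>2 * (real k * w)"
      using w0 by simp
    finally have "sqrt (\<kappa>' * (1024 * \<tau>)) \<le> sqrt (144\<^sup>2 * (real k * w))"
      by (rule real_sqrt_le_mono)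
    also have "\<dots> = 144 * sqrt (real k * w)"
      by (simp add: real_sqrt_mult)
    finally show ?thesis
      using sum_defect_le[OF V_le] \<kappa>'_sq sqrt_Y by linarith
  qed
  have "k \<le> n"
    using k by linarith
  then have "k \<le> card ({1..n} \<times> {1..n})"
    using n by (simp add: order_trans[OF _ le_square])
  then obtain B where B: "B \<subseteq> {1..n} \<times> {1..n}" "card B = k" "real (card (B - big)) \<le> max 0 (real k - real (card big))"
    by (rule exists_card_between[rotated 2]) (auto simp: big_def)
  have X0: "0 \<le> X" and Y0: "0 \<le> Y"
    using w0 by (simp_all add: X_def Y_def)
  have finB: "finite B"
    using B(1) finite_subset by blast
  have extra: "real (card (B - big)) \<le> 40971 * Y + 5126 * X"
    using B(3) big_ge X0 Y0 by linarith
  let ?T = "case_prod (perm_coset n)"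
  define G where "G = (\<Union>x\<in>B. ?T x)"
  have finT: "finite (?T x)" for x
    by (auto simp: perm_coset_def finite_Sym split: prod.split)
  have finG: "finite G"
    unfolding G_def using finB finT by blast
  have defectB: "(\<Sum>x\<in>B. 1 - a (fst x) (snd x)) \<le> 41547 * Y + 5382 * X"
  proof -
    have in_range: "fst x \<in> {1..n}" "snd x \<in> {1..n}" if "x \<in> B" for x
      using that B(1) by auto
    have "(\<Sum>x\<in>B. 1 - a (fst x) (snd x))
        = (\<Sum>x\<in>B \<inter> big. 1 - a (fst x) (snd x)) + (\<Sum>x\<in>B - big. 1 - a (fst x) (snd x))"
      using sum.Int_Diff[OF finB] .
    also have "(\<Sum>x\<in>B - big. 1 - a (fst x) (snd x)) \<le> (\<Sum>x\<in>B - big. 1)"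
      using a_bounds in_range by (intro sum_mono) force
    also have "(\<Sum>x\<in>B \<inter> big. 1 - a (fst x) (snd x)) \<le> (\<Sum>x\<in>B \<inter> big. 1 - a' (fst x) (snd x))"
      using a'_bounds in_range by (intro sum_mono) force
    also have "\<dots> \<le> (\<Sum>x\<in>big. 1 - a' (fst x) (snd x))"
    proof (rule sum_mono2)
      show "finite big"
        by (simp add: big_def)
      show "0 \<le> 1 - a' (fst x) (snd x)" if "x \<in> big - B \<inter> big" for x
        using that bounds[of "fst x" "snd x"] by (auto simp: big_def)
    qed auto
    finally show ?thesis
      using defect extra by simp
  qed
  have "real (card (G - F)) \<le> (\<Sum>x\<in>B. real (card (?T x - F)))"
  proof -
    have diff: "G - F = (\<Union>x\<in>B. ?T x - F)"
      by (auto simp: G_def)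
    have "card (G - F) \<le> (\<Sum>x\<in>B. card (?T x - F))"
      unfolding diff by (rule card_UN_le[OF finB])
    then show ?thesis
      by (simp only: of_nat_le_iff of_nat_sum[symmetric])
  qed
  also have "\<dots> = (\<Sum>x\<in>B. fact (n - 1) * (1 - a (fst x) (snd x)))"
  proof (rule sum.cong[OF refl])
    fix x assume "x \<in> B"
    then obtain i j where x: "x = (i, j)" "i \<in> {1..n}" "j \<in> {1..n}"
      using B(1) by auto
    have "card (perm_coset n i j - F) + card (F \<inter> perm_coset n i j) = fact (n - 1)"
      using card_perm_coset[OF x(2,3)] finT[of x] x(1)
      by (metis add.commute card_Int_Diff case_prod_conv inf_commute)
    then have "real (card (perm_coset n i j - F)) + real (card (F \<inter> perm_coset n i j)) = fact (n - 1)"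
      by (metis of_nat_add of_nat_fact)
    moreover have "fact (n - 1) * a i j = real (card (F \<inter> perm_coset n i j))"
      by (simp add: a_def)
    ultimately show "real (card (?T x - F)) = fact (n - 1) * (1 - a (fst x) (snd x))"
      unfolding x(1) case_prod_conv fst_conv snd_conv right_diff_distrib by linarith
  qed
  also have "\<dots> \<le> fact (n - 1) * (41547 * Y + 5382 * X)"
    unfolding sum_distrib_left[symmetric] using defectB by (intro mult_left_mono) auto
  finally have GF: "real (card (G - F)) \<le> fact (n - 1) * (41547 * Y + 5382 * X)" .
  have G_ge: "real (card G) \<ge> fact (n - 1) * (real k - 2 * X)"
  proof -
    have fct: "fact (n - 1) = (real n - 1) * fact (n - 2)"
      using n fact_reduce[of "n - 1", where 'a = real] by (simp add: of_nat_diff numeral_2_eq_2)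
    have "(real k)\<^sup>2 \<le> 2 * X * (real n - 1)"
    proof -
      have "(real k)\<^sup>2 = X * real n"
        using n by (simp add: X_def)
      also have "\<dots> \<le> X * (2 * (real n - 1))"
        using X0 n by (intro mult_left_mono) auto
      finally show ?thesis
        by (simp only: mult_ac)
    qed
    then have "(real k)\<^sup>2 * fact (n - 2) \<le> 2 * X * (real n - 1) * fact (n - 2)"
      by (intro mult_right_mono) auto
    then show ?thesis
      using card_Union_cosets_ge[OF finB B(1)] unfolding G_def[symmetric] B(2) fct
      by (simp add: algebra_simps)
  qed
  \<comment> \<open>The part of \<open>F\<close> outside \<open>G\<close> is eliminated: both sets
    have about \<open>k * fact (n - 1)\<close> elements, so it is nearly as large as
    \<open>G - F\<close>.\<close>
  have "real (card (sym_diff F G)) = real (card F) - real (card G) + 2 * real (card (G - F))"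
  proof -
    have "card (sym_diff F G) = card (F - G) + card (G - F)"
      using finite_F finG by (intro card_Un_disjoint) auto
    moreover have "card F = card (F \<inter> G) + card (F - G)" "card G = card (F \<inter> G) + card (G - F)"
      using card_Int_Diff[OF finite_F, of G] card_Int_Diff[OF finG, of F] by (simp_all add: Int_commute)
    ultimately show ?thesis
      by simp
  qed
  also have "\<dots> \<le> fact (n - 1) * \<kappa> - fact (n - 1) * (real k - 2 * X) + 2 * (fact (n - 1) * (41547 * Y + 5382 * X))"
    using G_ge GF card_F by simp
  also have "\<dots> = fact (n - 1) * (\<kappa> - real k + 2 * X + 2 * (41547 * Y + 5382 * X))"
    by (simp add: algebra_simps)
  also have "\<dots> \<le> fact (n - 1) * (10 ^ 5 * (X + Y))"
    using w(1) w_Y X0 Y0 by (intro mult_left_mono) auto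
  finally have main: "real (card (sym_diff F G)) \<le> 10 ^ 5 * (X + Y) * fact (n - 1)"
    by (simp add: mult.commute)
  show ?thesis
  proof (rule that)
    show "?T ` B \<subseteq> perm_cosets n"
      unfolding perm_cosets_eq_image using B(1) by (rule image_mono)
    show "card (?T ` B) = k"
      using card_image[OF inj_on_subset[OF inj_on_perm_coset B(1)]] n B(2) by simp
    show "real (card (sym_diff F (\<Union>(?T ` B))))
        \<le> 10 ^ 5 * ((real k)\<^sup>2 / real n + real k * sqrt (real k * w)) * fact (n - 1)"
      using main by (simp only: G_def X_def Y_def)
  qed
qed

end

section \<open>Comparison with the initial segment, and the final case distinction\<close>

context perm_family
begin

lemma \<tau>_bound:
  assumes k: "1 \<le> k" "k + 1 \<le> n" and \<epsilon>: "\<kappa> = real k + \<epsilon>" "\<bar>\<epsilon>\<bar> \<le> 1" and "0 \<le> \<beta>"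
    and dp: "real (dp n F) \<le> real (dp n (lex_initial n (card F)))
      + \<beta> * fact (n - 1) * real (derangement_sum (n - 1))"
  shows "\<tau> \<le> 10 * (\<bar>\<epsilon>\<bar> + \<beta>)"
proof -
  let ?D = "real (derangement_sum (n - 1))" and ?f = "fact (n - 1) :: real"
  \<comment> \<open>The number of full cosets in the segment; |\<epsilon>| \<le> 1 keeps \<kappa>
    between m and m + 1.\<close>
  define m where "m = (if 0 \<le> \<epsilon> then k else k - 1)"
  have m: "real m \<le> \<kappa>" "\<kappa> \<le> real m + 1" "m + 1 \<le> n"
    using k \<epsilon> by (auto simp: m_def of_nat_diff)
  have "real m * ?f \<le> real (card F)" "real (card F) \<le> (real m + 1) * ?f"
    unfolding card_F using m by (auto intro!: mult_right_mono)
  then have "real (m * fact (n - 1)) \<le> real (card F)" "real (card F) \<le> real ((m + 1) * fact (n - 1))"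
    by (simp_all add: algebra_simps)
  then have "m * fact (n - 1) \<le> card F" "card F \<le> (m + 1) * fact (n - 1)"
    by (simp_all only: of_nat_le_iff)
  then have T: "2 * real (dp n (lex_initial n (card F)))
      = ?D * (2 * real m * (\<kappa> * ?f) - real m * (real m + 1) * ?f)"
    using dp_lex_initial[OF m(3)] card_F by simp
  have "(2 * real m * \<kappa> - real m * (real m + 1)) \<le> \<kappa>\<^sup>2 - \<kappa> + \<bar>\<epsilon>\<bar>"
  proof (cases "0 \<le> \<epsilon>")
    case True
    then have "\<kappa>\<^sup>2 - \<kappa> + \<bar>\<epsilon>\<bar> - (2 * real m * \<kappa> - real m * (real m + 1)) = \<epsilon>\<^sup>2"
      by (simp add: m_def \<epsilon> power2_eq_square algebra_simps)
    then show ?thesis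
      using zero_le_power2[of \<epsilon>] by linarith
  next
    case False
    then have m_real: "real m = real k - 1"
      using k by (simp add: m_def of_nat_diff)
    have "\<kappa>\<^sup>2 - \<kappa> + \<bar>\<epsilon>\<bar> - (2 * real m * \<kappa> - real m * (real m + 1)) = \<epsilon>\<^sup>2"
      using False unfolding m_real by (simp add: \<epsilon> power2_eq_square algebra_simps)
    then show ?thesis
      using zero_le_power2[of \<epsilon>] by linarith
  qed
  then have "(?D * ?f) * (2 * real m * \<kappa> - real m * (real m + 1)) \<le> (?D * ?f) * (\<kappa>\<^sup>2 - \<kappa> + \<bar>\<epsilon>\<bar>)"
    by (intro mult_left_mono) auto
  then have "(?D * ?f) * (\<kappa>\<^sup>2 - \<kappa> + \<tau> / 5) \<le> (?D * ?f) * (\<kappa>\<^sup>2 - \<kappa> + \<bar>\<epsilon>\<bar> + 2 * \<beta>)"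
    using dp_lower_bound dp T by (simp add: algebra_simps)
  moreover have "0 < ?D * ?f"
  proof -
    have "(0::real) < fact n"
      by simp
    then have "0 < 3 * (real n - 1) * ?D"
      using derangement_sum_ge[of n] n by linarith
    then show ?thesis
      by (simp add: zero_less_mult_iff)
  qed
  ultimately have "\<kappa>\<^sup>2 - \<kappa> + \<tau> / 5 \<le> \<kappa>\<^sup>2 - \<kappa> + \<bar>\<epsilon>\<bar> + 2 * \<beta>"
    by (simp only: mult_le_cancel_left_pos)
  then show ?thesis
    using \<open>0 \<le> \<beta>\<close> by simp
qed

end

lemma exists_cosets_trivial_bound:
  assumes "n \<ge> 3" "k \<le> n" "finite F"
  obtains K where "K \<subseteq> perm_cosets n" "card K = k"
    "card (sym_diff F (\<Union>K)) \<le> card F + k * fact (n - 1)"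
proof -
  let ?T = "case_prod (perm_coset n)"
  have "k \<le> card ({1..n} \<times> {1..n})"
    using assms by (simp add: order_trans[OF _ le_square])
  then obtain B where B: "B \<subseteq> {1..n} \<times> {1..n}" "card B = k"
    by (meson obtain_subset_with_card_n)
  have finB: "finite B"
    using B(1) finite_subset by blast
  have card: "card (?T x) = fact (n - 1)" if "x \<in> B" for x
    using that B(1) card_perm_coset by auto
  have "card (\<Union>(?T ` B)) \<le> (\<Sum>x\<in>B. card (?T x))"
    by (rule card_UN_le[OF finB])
  also have "\<dots> = k * fact (n - 1)"
    using card B(2) by simp
  finally have U: "card (\<Union>(?T ` B)) \<le> k * fact (n - 1)" .
  have finU: "finite (\<Union>(?T ` B))"
    using finB by (auto simp: perm_coset_def finite_Sym split: prod.split)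
  have "card (sym_diff F (\<Union>(?T ` B))) \<le> card F + k * fact (n - 1)"
  proof -
    have "card (sym_diff F (\<Union>(?T ` B))) \<le> card (F \<union> \<Union>(?T ` B))"
      using assms(3) finU by (intro card_mono) auto
    also have "\<dots> \<le> card F + card (\<Union>(?T ` B))"
      by (rule card_Un_le)
    finally show ?thesis
      using U by linarith
  qed
  moreover have "?T ` B \<subseteq> perm_cosets n"
    unfolding perm_cosets_eq_image using B(1) by (rule image_mono)
  moreover have "card (?T ` B) = k"
    using card_image[OF inj_on_subset[OF inj_on_perm_coset B(1)]] assms(1) B(2) by simp
  ultimately show ?thesis
    using that by blast
qed

theorem lemma2p1:
  "\<exists>C c :: real. C > 0 \<and> c > 0 \<and>
    (\<forall>\<^sub>F n :: nat in sequentially.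
      \<forall>(k :: nat) (\<epsilon> :: real) (\<beta> :: real) (F :: (nat \<Rightarrow> nat) set) (s :: nat).
        1 \<le> k \<longrightarrow> real k < real n / 2 \<longrightarrow> \<beta> \<ge> 0 \<longrightarrow> max \<bar>\<epsilon>\<bar> \<beta> \<le> c * real k \<longrightarrow>
        F \<subseteq> Sym n \<longrightarrow> card F = s \<longrightarrow> real s = (real k + \<epsilon>) * fact (n - 1) \<longrightarrow>
        real (dp n F) \<le> real (dp n (lex_initial n s))
          + \<beta> * fact (n - 1) * real (derangement_sum (n - 1)) \<longrightarrow>
        (\<exists>K G. K \<subseteq> perm_cosets n \<and> card K = k \<and> G = \<Union>K \<and>
          real (card (sym_diff F G))
            \<le> C * (real k)\<^sup>2 * (1 / real n + sqrt (6 * (\<bar>\<epsilon>\<bar> + \<beta>) / real k)) * fact (n - 1)))"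
proof (rule exI[of _ "10 ^ 5"], rule exI[of _ 1], intro conjI eventually_sequentiallyI[of 17] allI impI)
  fix n k :: nat and \<epsilon> \<beta> :: real and F :: "(nat \<Rightarrow> nat) set" and s :: nat
  assume n: "17 \<le> n" and k: "1 \<le> k" "real k < real n / 2" and \<beta>: "0 \<le> \<beta>"
    and max: "max \<bar>\<epsilon>\<bar> \<beta> \<le> 1 * real k" and F_Sym: "F \<subseteq> Sym n" and F_card: "card F = s"
    and s: "real s = (real k + \<epsilon>) * fact (n - 1)"
    and dp: "real (dp n F) \<le> real (dp n (lex_initial n s)) + \<beta> * fact (n - 1) * real (derangement_sum (n - 1))"
  interpret perm_family n F "real k + \<epsilon>"
    using n F_Sym F_card s by unfold_locales auto
  define w where "w = \<bar>\<epsilon>\<bar> + \<beta>"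
  have w0: "0 \<le> w"
    using \<beta> by (simp add: w_def)
  have kn: "k + 1 \<le> n"
    using k n by linarith
  let ?f = "fact (n - 1) :: real" and ?r = "sqrt (6 * w / real k)"
  have "\<exists>K\<subseteq>perm_cosets n. card K = k \<and>
      real (card (sym_diff F (\<Union>K))) \<le> 10 ^ 5 * (real k)\<^sup>2 * (1 / real n + ?r) * ?f"
  proof (cases "384 * real k \<le> real n \<and> w \<le> 1 / 10 ^ 7")
    case True
    have "\<bar>\<epsilon>\<bar> \<le> 1"
      using True \<beta> by (simp add: w_def)
    then have "\<tau> \<le> 10 * w"
      unfolding w_def using dp F_card by (intro \<tau>_bound[OF k(1) kn refl _ \<beta>]) simp_all
    then obtain K where K: "K \<subseteq> perm_cosets n" "card K = k"
      "real (card (sym_diff F (\<Union>K))) \<le> 10 ^ 5 * ((real k)\<^sup>2 / real n + real k * sqrt (real k * w)) * ?f"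
      using close_to_cosets[of k w] True k(1) \<beta> by (auto simp: w_def)
    have "sqrt (real k * w) \<le> sqrt ((real k)\<^sup>2 * (6 * w / real k))"
      using k(1) w0 by (intro real_sqrt_le_mono) (simp add: power2_eq_square mult_left_mono)
    also have "\<dots> = real k * ?r"
      by (simp only: real_sqrt_mult[of "(real k)\<^sup>2"] real_sqrt_abs abs_of_nat)
    finally have "real k * sqrt (real k * w) \<le> real k * (real k * ?r)"
      by (intro mult_left_mono) auto
    then have "10 ^ 5 * ((real k)\<^sup>2 / real n + real k * sqrt (real k * w)) * ?f
        \<le> 10 ^ 5 * ((real k)\<^sup>2 / real n + (real k)\<^sup>2 * ?r) * ?f"
      by (intro mult_right_mono mult_left_mono add_left_mono) (auto simp: power2_eq_square mult.assoc)
    also have "\<dots> = 10 ^ 5 * (real k)\<^sup>2 * (1 / real n + ?r) * ?f"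
      by (simp add: distrib_left)
    finally show ?thesis
      using K order_trans by blast
  next
    case False
    \<comment> \<open>The target exceeds the trivial bound \<open>3 * k * fact (n - 1)\<close>. If n
      < 384 k, the term 1 / n suffices; otherwise \<open>w > 1 / 10 ^ 7\<close> makes the square
      root at least 1 / (2000 k), and 10 ^ 5 / 2000 = 50.\<close>
    have "3 / real k \<le> 10 ^ 5 * (1 / real n + ?r)"
    proof (cases "384 * real k \<le> real n")
      case True
      have "6 * (1 / 10 ^ 7) / real k \<le> 6 * w / real k"
        using False True by (intro divide_right_mono) auto
      moreover have "(1 / (2000 * real k))\<^sup>2 \<le> 6 * (1 / 10 ^ 7) / real k"
        using k(1) by (simp add: power2_eq_square field_simps)
      ultimately have "1 / (2000 * real k) \<le> ?r"
        by (intro real_le_rsqrt) linarith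
      then have "10 ^ 5 * (1 / (2000 * real k)) \<le> 10 ^ 5 * (1 / real n + ?r)"
        by (intro mult_left_mono) (auto simp: add_increasing)
      moreover have "3 / real k \<le> 10 ^ 5 * (1 / (2000 * real k))"
        using k(1) by (simp add: field_simps)
      ultimately show ?thesis
        by linarith
    next
      case False
      have "3 / real k \<le> 10 ^ 5 * (1 / real n)"
        using False k(1) n by (simp add: field_simps)
      also have "\<dots> \<le> 10 ^ 5 * (1 / real n + ?r)"
        using w0 by (intro mult_left_mono) auto
      finally show ?thesis .
    qed
    then have "(real k)\<^sup>2 * (3 / real k) * ?f \<le> (real k)\<^sup>2 * (10 ^ 5 * (1 / real n + ?r)) * ?f"
      by (intro mult_left_mono mult_right_mono) auto
    then have big: "3 * real k * ?f \<le> 10 ^ 5 * (real k)\<^sup>2 * (1 / real n + ?r) * ?f"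
      using k(1) by (simp add: power2_eq_square mult_ac)
    obtain K where K: "K \<subseteq> perm_cosets n" "card K = k"
      "card (sym_diff F (\<Union>K)) \<le> card F + k * fact (n - 1)"
      using exists_cosets_trivial_bound[of n k F] n kn finite_F by auto
    then have "real (card (sym_diff F (\<Union>K))) \<le> real (card F + k * fact (n - 1))"
      by (simp only: of_nat_le_iff)
    also have "\<dots> = (real k + \<epsilon> + real k) * ?f"
      using card_F by (simp add: algebra_simps)
    \<comment> \<open>With c = 1 the hypothesis gives \<epsilon> \<le> k, so \<open>F\<close> has at
      most \<open>2 * k * fact (n - 1)\<close> elements.\<close>
    also have "\<dots> \<le> 3 * real k * ?f"
      using max by (intro mult_right_mono) auto
    finally show ?thesis
      using K(1,2) big order_trans by blast
  qed
  then show "\<exists>K G. K \<subseteq> perm_cosets n \<and> card K = k \<and> G = \<Union>K \<and>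
      real (card (sym_diff F G))
        \<le> 10 ^ 5 * (real k)\<^sup>2 * (1 / real n + sqrt (6 * (\<bar>\<epsilon>\<bar> + \<beta>) / real k)) * fact (n - 1)"
    unfolding w_def by blast
qed simp_all

end
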